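(* Let $R$ be a Noetherian local ring of characteristic $p>0$. If $R$ is complete or $R$ is $F$-finite, then for every $n\ge 1$, $R$ is $n$-quasi-$F$-split if and only if $R$ is $n$-quasi-$F$-pure. In particular, the quasi-$F$-pure height and the quasi-$F$-split height of $R$ are the same.
   Context: For a commutative ring $R$ of characteristic $p>0$, $W_n(R)$ ($n\ge1$) is the ring of $n$-truncated $p$-typical Witt vectors $(\alpha_0,\dots,\alpha_{n-1})$ over $R$; $[r]=(r,0,\dots,0)$; the Witt Frobenius is the ring map $F(\alpha_0,\dots,\alpha_{n-1})=(\alpha_0^p,\dots,\alpha_{n-1}^p)$, and $F_*$ denotes restriction of scalars along Frobenius. $R$ is a $W_n(R)$-module via the restriction map $\mathfrak R^{n-1}:W_n(R)\to R$, $\alpha\mapsto\alpha_0$. $R$ is $F$-finite if $F_*R$ is a finitely generated $R$-module. $R$ is $n$-quasi-$F$-split if there is a $W_n(R)$-module homomorphism $\varphi:F_*W_n(R)\to R$ such that the composite $W_n(R)\xrightarrow{F}F_*W_n(R)\xrightarrow{\varphi}R$ equals $\mathfrak R^{n-1}$. The quasi-$F$-split height is the minimal such $n$ ($\infty$ if none exists). Put $\overline{W_n}(R)=W_n(R)/pW_n(R)$ and $Q_{R,n}=F_*\overline{W_n}(R)$, with $W_n(R)$ acting by $\alpha\cdot F_*\overline\beta=F_*\overline{(F(\alpha)\beta)}$; this is induced from the $R$-module structure $r\cdot F_*\overline\alpha=F_*\overline{([r^p]\alpha)}$. Let $\Phi_{R,n}:R\to Q_{R,n}$, $r\mapsto F_*\overline{[r^p]}$.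 A map $M\to N$ of $A$-modules is pure if $L\otimes_AM\to L\otimes_AN$ is injective for every $A$-module $L$. $R$ is $n$-quasi-$F$-pure if $\Phi_{R,n}$ is a pure homomorphism of $W_n(R)$-modules; the quasi-$F$-pure height is the minimal such $n\ge1$ ($\infty$ if none exists). *)

theory Defs
  imports "HOL-Algebra.Algebra" "HOL-Library.Extended_Nat"
begin

section \<open>Rings\<close>

definition has_char :: "nat \<Rightarrow> ('a, 'b) ring_scheme \<Rightarrow> bool" where
  "has_char p R \<longleftrightarrow> (\<forall>m::nat. [m] \<cdot>\<^bsub>R\<^esub> \<one>\<^bsub>R\<^esub> = \<zero>\<^bsub>R\<^esub> \<longleftrightarrow> p dvd m)"

definition local_ring :: "('a, 'b) ring_scheme \<Rightarrow> bool" where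
  "local_ring R \<longleftrightarrow> cring R \<and> (\<exists>!m. maximalideal m R)"

definition max_ideal :: "('a, 'b) ring_scheme \<Rightarrow> 'a set" where
  "max_ideal R = (THE m. maximalideal m R)"

text \<open>Completeness includes separatedness; \<open>I [^]\<^bsub>ideals_set R\<^esub> k\<close> is the ideal power $I^k$.\<close>

definition adically_complete :: "('a, 'b) ring_scheme \<Rightarrow> 'a set \<Rightarrow> bool" where
  "adically_complete R I \<longleftrightarrow>
     (\<Inter>k::nat. I [^]\<^bsub>ideals_set R\<^esub> k) = {\<zero>\<^bsub>R\<^esub>} \<and>
     (\<forall>s :: nat \<Rightarrow> 'a. range s \<subseteq> carrier R \<longrightarrow>
        (\<forall>k::nat. \<exists>N. \<forall>i\<ge>N. \<forall>j\<ge>N. s i \<ominus>\<^bsub>R\<^esub> s j \<in> I [^]\<^bsub>ideals_set R\<^esub> k) \<longrightarrow>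
        (\<exists>l\<in>carrier R. \<forall>k::nat. \<exists>N. \<forall>i\<ge>N. s i \<ominus>\<^bsub>R\<^esub> l \<in> I [^]\<^bsub>ideals_set R\<^esub> k))"

definition complete_local_ring :: "('a, 'b) ring_scheme \<Rightarrow> bool" where
  "complete_local_ring R \<longleftrightarrow> local_ring R \<and> adically_complete R (max_ideal R)"

section \<open>Modules, tensor products, purity\<close>

text \<open>The ring \<open>S\<close> viewed as a module over another ring through a ring homomorphism
  \<open>h\<close> from that ring to \<open>S\<close>.\<close>

definition module_via :: "('c \<Rightarrow> 's) \<Rightarrow> ('s, 'b) ring_scheme \<Rightarrow> ('c, 's) module" where
  "module_via h S = \<lparr>carrier = carrier S, monoid.mult = monoid.mult S, one = \<one>\<^bsub>S\<^esub>,
     ring.zero = \<zero>\<^bsub>S\<^esub>, add = add S, smult = (\<lambda>a x. h a \<otimes>\<^bsub>S\<^esub> x)\<rparr>"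

definition mod_hom ::
  "('c, 'd) ring_scheme \<Rightarrow> ('c, 'x, 'e) module_scheme \<Rightarrow> ('c, 'y, 'f) module_scheme \<Rightarrow> ('x \<Rightarrow> 'y) set"
  where
  "mod_hom A M N = {f \<in> carrier M \<rightarrow> carrier N.
     (\<forall>x\<in>carrier M. \<forall>y\<in>carrier M. f (x \<oplus>\<^bsub>M\<^esub> y) = f x \<oplus>\<^bsub>N\<^esub> f y) \<and>
     (\<forall>a\<in>carrier A. \<forall>x\<in>carrier M. f (a \<odot>\<^bsub>M\<^esub> x) = a \<odot>\<^bsub>N\<^esub> f x)}"

definition fin_gen_module :: "('c, 'd) ring_scheme \<Rightarrow> ('c, 'x, 'e) module_scheme \<Rightarrow> bool" where
  "fin_gen_module A M \<longleftrightarrow> (\<exists>G. finite G \<and> G \<subseteq> carrier M \<and>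
     (\<forall>x\<in>carrier M. \<exists>c \<in> G \<rightarrow> carrier A. x = (\<Oplus>\<^bsub>M\<^esub>g\<in>G. c g \<odot>\<^bsub>M\<^esub> g)))"

definition tensor_rels ::
  "('c, 'd) ring_scheme \<Rightarrow> ('c, 'l, 'e) module_scheme \<Rightarrow> ('c, 'x, 'f) module_scheme
     \<Rightarrow> ('l \<times> 'x \<Rightarrow>\<^sub>0 int) set" where
  "tensor_rels A L M =
     {frag_of (l \<oplus>\<^bsub>L\<^esub> l', x) - frag_of (l, x) - frag_of (l', x) | l l' x.
        l \<in> carrier L \<and> l' \<in> carrier L \<and> x \<in> carrier M} \<union>
     {frag_of (l, x \<oplus>\<^bsub>M\<^esub> x') - frag_of (l, x) - frag_of (l, x') | l x x'.
        l \<in> carrier L \<and> x \<in> carrier M \<and> x' \<in> carrier M} \<union>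
     {frag_of (a \<odot>\<^bsub>L\<^esub> l, x) - frag_of (l, a \<odot>\<^bsub>M\<^esub> x) | a l x.
        a \<in> carrier A \<and> l \<in> carrier L \<and> x \<in> carrier M}"

definition tensor_null ::
  "('c, 'd) ring_scheme \<Rightarrow> ('c, 'l, 'e) module_scheme \<Rightarrow> ('c, 'x, 'f) module_scheme
     \<Rightarrow> ('l \<times> 'x \<Rightarrow>\<^sub>0 int) set" where
  "tensor_null A L M =
     generate (free_Abelian_group (carrier L \<times> carrier M)) (tensor_rels A L M)"

text \<open>Only the underlying abelian group of $L \otimes_A M$ is constructed, which is all that
  injectivity refers to.\<close>

definition tensor ::
  "('c, 'd) ring_scheme \<Rightarrow> ('c, 'l, 'e) module_scheme \<Rightarrow> ('c, 'x, 'f) module_scheme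
     \<Rightarrow> ('l \<times> 'x \<Rightarrow>\<^sub>0 int) set monoid" where
  "tensor A L M = free_Abelian_group (carrier L \<times> carrier M) Mod tensor_null A L M"

text \<open>The map $\mathrm{id}_L \otimes f : L \otimes_A M \to L \otimes_A N$ on cosets.\<close>

definition tensor_map ::
  "('c, 'd) ring_scheme \<Rightarrow> ('c, 'l, 'e) module_scheme \<Rightarrow> ('c, 'y, 'g) module_scheme
     \<Rightarrow> ('x \<Rightarrow> 'y) \<Rightarrow> ('l \<times> 'x \<Rightarrow>\<^sub>0 int) set \<Rightarrow> ('l \<times> 'y \<Rightarrow>\<^sub>0 int) set" where
  "tensor_map A L N f = (\<lambda>T. the_elem
     ((\<lambda>t. tensor_null A L N #>\<^bsub>free_Abelian_group (carrier L \<times> carrier N)\<^esub>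
             frag_extend (\<lambda>(l, x). frag_of (l, f x)) t) ` T))"

text \<open>A definition cannot quantify over the carrier type of the test modules \<open>L\<close>, so that type is
  the parameter \<open>'u\<close>; it plays the role of a universe.  The notion has its usual meaning when \<open>'u\<close>
  is infinite and at least as large as the carrier of \<open>A\<close>: every finitely generated \<open>A\<close>-module
  is then isomorphic to one carried by a subset of \<open>'u\<close>, and injectivity of $L \otimes f$ for
  finitely generated \<open>L\<close> implies it for all \<open>L\<close>, as $L \otimes -$ is the direct limit over the
  finitely generated submodules of \<open>L\<close>.  For $A = W_n(R)$ and infinite \<open>'u\<close>, an injection
  of the carrier of \<open>R\<close> into \<open>'u\<close> suffices.  For small \<open>'u\<close> (for instance \<^typ>\<open>unit\<close>) the
  condition is too weak.\<close>

definition pure_hom ::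
  "'u itself \<Rightarrow> ('c, 'd) ring_scheme \<Rightarrow> ('c, 'x, 'e) module_scheme \<Rightarrow> ('c, 'y, 'f) module_scheme
     \<Rightarrow> ('x \<Rightarrow> 'y) \<Rightarrow> bool" where
  "pure_hom U A M N f \<longleftrightarrow> f \<in> mod_hom A M N \<and>
     (\<forall>L :: ('c, 'u) module. module A L \<longrightarrow>
        inj_on (tensor_map A L N f) (carrier (tensor A L M)))"

section \<open>Truncated Witt vectors\<close>

type_synonym 'v int_mpoly = "('v \<Rightarrow>\<^sub>0 nat) \<Rightarrow>\<^sub>0 int"

definition mpoly_var :: "'v \<Rightarrow> 'v int_mpoly" where
  "mpoly_var v = Poly_Mapping.single (Poly_Mapping.single v 1) 1"

definition eval_int_mpoly :: "('a, 'b) ring_scheme \<Rightarrow> ('v \<Rightarrow> 'a) \<Rightarrow> 'v int_mpoly \<Rightarrow> 'a" where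
  "eval_int_mpoly R x P = (\<Oplus>\<^bsub>R\<^esub>m\<in>Poly_Mapping.keys P. [Poly_Mapping.lookup P m] \<cdot>\<^bsub>R\<^esub>
      (\<Otimes>\<^bsub>R\<^esub>v\<in>Poly_Mapping.keys m. x v [^]\<^bsub>R\<^esub> Poly_Mapping.lookup m v))"

definition ghost :: "nat \<Rightarrow> (nat \<Rightarrow> 'v int_mpoly) \<Rightarrow> nat \<Rightarrow> 'v int_mpoly" where
  "ghost p Z k = (\<Sum>i\<le>k. of_nat (p ^ i) * Z i ^ (p ^ (k - i)))"

text \<open>The Witt sum and product polynomials: the unique sequences of integral polynomials in the
  variables $X_i$ (\<open>Inl i\<close>) and $Y_i$ (\<open>Inr i\<close>) whose ghost components are the sums and
  products of those of $X$ and $Y$.  Existence is Witt's theorem; uniqueness holds since the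
  polynomial ring is torsion-free.\<close>

definition witt_add_poly :: "nat \<Rightarrow> nat \<Rightarrow> (nat + nat) int_mpoly" where
  "witt_add_poly p = (THE S. \<forall>k. ghost p S k =
     ghost p (\<lambda>i. mpoly_var (Inl i)) k + ghost p (\<lambda>i. mpoly_var (Inr i)) k)"

definition witt_mult_poly :: "nat \<Rightarrow> nat \<Rightarrow> (nat + nat) int_mpoly" where
  "witt_mult_poly p = (THE S. \<forall>k. ghost p S k =
     ghost p (\<lambda>i. mpoly_var (Inl i)) k * ghost p (\<lambda>i. mpoly_var (Inr i)) k)"

definition teichmuller :: "nat \<Rightarrow> ('a, 'b) ring_scheme \<Rightarrow> 'a \<Rightarrow> nat \<Rightarrow> 'a" where
  "teichmuller n R r = (\<lambda>i\<in>{..<n}. if i = 0 then r else \<zero>\<^bsub>R\<^esub>)"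

definition witt_ring :: "nat \<Rightarrow> nat \<Rightarrow> ('a, 'b) ring_scheme \<Rightarrow> (nat \<Rightarrow> 'a) ring" where
  "witt_ring p n R = \<lparr>carrier = {..<n} \<rightarrow>\<^sub>E carrier R,
     monoid.mult = (\<lambda>\<alpha> \<beta>. \<lambda>k\<in>{..<n}. eval_int_mpoly R (case_sum \<alpha> \<beta>) (witt_mult_poly p k)),
     one = teichmuller n R \<one>\<^bsub>R\<^esub>,
     ring.zero = (\<lambda>k\<in>{..<n}. \<zero>\<^bsub>R\<^esub>),
     add = (\<lambda>\<alpha> \<beta>. \<lambda>k\<in>{..<n}. eval_int_mpoly R (case_sum \<alpha> \<beta>) (witt_add_poly p k))\<rparr>"

definition witt_frob :: "nat \<Rightarrow> nat \<Rightarrow> ('a, 'b) ring_scheme \<Rightarrow> (nat \<Rightarrow> 'a) \<Rightarrow> nat \<Rightarrow> 'a" where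
  "witt_frob p n R \<alpha> = (\<lambda>i\<in>{..<n}. \<alpha> i [^]\<^bsub>R\<^esub> p)"

section \<open>Quasi-F-splitting and quasi-F-purity\<close>

definition F_finite :: "nat \<Rightarrow> ('a, 'b) ring_scheme \<Rightarrow> bool" where
  "F_finite p R \<longleftrightarrow> fin_gen_module R (module_via (\<lambda>r. r [^]\<^bsub>R\<^esub> p) R)"

text \<open>\<open>R\<close> as a module over $W_n(R)$ through the restriction map $\alpha \mapsto \alpha_0$.\<close>

definition base_module :: "('a, 'b) ring_scheme \<Rightarrow> (nat \<Rightarrow> 'a, 'a) module" where
  "base_module R = module_via (\<lambda>\<alpha>. \<alpha> 0) R"

definition quasi_F_split :: "nat \<Rightarrow> nat \<Rightarrow> ('a, 'b) ring_scheme \<Rightarrow> bool" where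
  "quasi_F_split p n R \<longleftrightarrow>
     (\<exists>\<phi> \<in> mod_hom (witt_ring p n R)
              (module_via (witt_frob p n R) (witt_ring p n R)) (base_module R).
        \<forall>\<alpha>\<in>carrier (witt_ring p n R). \<phi> (witt_frob p n R \<alpha>) = \<alpha> 0)"

definition witt_p_ideal :: "nat \<Rightarrow> nat \<Rightarrow> ('a, 'b) ring_scheme \<Rightarrow> (nat \<Rightarrow> 'a) set" where
  "witt_p_ideal p n R = PIdl\<^bsub>witt_ring p n R\<^esub> ([p] \<cdot>\<^bsub>witt_ring p n R\<^esub> \<one>\<^bsub>witt_ring p n R\<^esub>)"

definition witt_mod_p :: "nat \<Rightarrow> nat \<Rightarrow> ('a, 'b) ring_scheme \<Rightarrow> (nat \<Rightarrow> 'a) set ring" where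
  "witt_mod_p p n R = witt_ring p n R Quot witt_p_ideal p n R"

definition Q_module :: "nat \<Rightarrow> nat \<Rightarrow> ('a, 'b) ring_scheme \<Rightarrow> (nat \<Rightarrow> 'a, (nat \<Rightarrow> 'a) set) module" where
  "Q_module p n R = module_via
     (\<lambda>\<alpha>. witt_p_ideal p n R +>\<^bsub>witt_ring p n R\<^esub> witt_frob p n R \<alpha>) (witt_mod_p p n R)"

definition Phi :: "nat \<Rightarrow> nat \<Rightarrow> ('a, 'b) ring_scheme \<Rightarrow> 'a \<Rightarrow> (nat \<Rightarrow> 'a) set" where
  "Phi p n R r = witt_p_ideal p n R +>\<^bsub>witt_ring p n R\<^esub> teichmuller n R (r [^]\<^bsub>R\<^esub> p)"

definition quasi_F_pure :: "'u itself \<Rightarrow> nat \<Rightarrow> nat \<Rightarrow> ('a, 'b) ring_scheme \<Rightarrow> bool" where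
  "quasi_F_pure U p n R \<longleftrightarrow>
     pure_hom U (witt_ring p n R) (base_module R) (Q_module p n R) (Phi p n R)"

text \<open>The infimum of the empty set in \<^typ>\<open>enat\<close> is \<open>\<infinity>\<close>.\<close>

definition quasi_F_split_height :: "nat \<Rightarrow> ('a, 'b) ring_scheme \<Rightarrow> enat" where
  "quasi_F_split_height p R = (INF n\<in>{n. 1 \<le> n \<and> quasi_F_split p n R}. enat n)"

definition quasi_F_pure_height :: "'u itself \<Rightarrow> nat \<Rightarrow> ('a, 'b) ring_scheme \<Rightarrow> enat" where
  "quasi_F_pure_height U p R = (INF n\<in>{n. 1 \<le> n \<and> quasi_F_pure U p n R}. enat n)"

end

theory Submission
  imports Defs
begin

text \<open>
Write $A = W_n(R)$, let \<open>\<pi>(\<alpha>) = \<alpha>\<^sub>0\<close>, and let \<open>Q\<close> be $A/pA$ with \<open>\<alpha>\<close> acting as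
multiplication by \<open>F(\<alpha>)\<close>.  The two notions are linked by the identity $FV = p$.
If \<open>\<beta>\<^sub>0 = 0\<close>, then \<open>F(\<beta>)\<close> is a multiple of $p$, hence \<open>\<Phi>(\<alpha>\<^sub>0)\<close> is the class of
\<open>F(\<alpha>)\<close> (\<open>Phi_coord0\<close>).  And every $A$-linear \<open>\<phi> : F\<^sub>*A \<rightarrow> R\<close> kills $pA$, because
\<open>\<phi>(p x) = \<phi>(F(V 1) x) = (V 1)\<^sub>0 \<phi>(x) = 0\<close>.  So splitting \<open>F\<close> and splitting \<open>\<Phi>\<close> are the same
thing, and a split map is pure (\<open>retract_imp_pure_hom\<close>, \<open>split_imp_pure\<close>).

For the converse, purity is turned into a statement about equations: a finite system of linear equations
with coefficients in $A$ and right-hand sides in $R$ that has a solution in \<open>Q\<close> has one in $R$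
(\<open>pure_hom_solves_system\<close>).  The test module is the cokernel of the coefficient matrix over $R$;
solvability in \<open>Q\<close> says that the vector of right-hand sides dies in its tensor product with \<open>Q\<close>,
injectivity says that it already dies in the cokernel.  A splitting of \<open>F\<close> is a solution of an
infinite system whose unknowns are the values \<open>\<phi>(\<alpha>)\<close>, and this system holds in \<open>Q\<close> for
\<open>\<phi>(\<alpha>) = \<alpha> mod p\<close>.  It remains to pass from finite subsystems to the whole system.

If $R$ is $F$-finite, then \<open>F\<^sub>*A\<close> is a finite $A$-module: $R$ is finite over its subring of
$p^e$-th powers for every $e$, and these are the scalars that act on the graded pieces of the $V$-filtration
(\<open>F_finite_imp_fin_gen_FW\<close>).  So finitely many unknowns suffice, and over a Noetherian ring finitely
many of the relations among them imply all others (\<open>submodule_annihilators_finite\<close>).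

If $R$ is complete, then $R$ is linearly compact, and a system whose finite subsystems are solvable is solvable
(\<open>complete_imp_linearly_compact\<close>).  This takes the place of Matlis duality.  The proof is Tychonoff's
argument with cosets instead of closed sets: in a maximal family of affine subsets of a power of $R$ with the
finite intersection property, each coordinate is determined modulo every power of the maximal ideal,
because the residue field is simple as a module; completeness glues these residues to an element of $R$, and
Krull's intersection theorem shows that fixing the coordinate at this element is a member of the family.

The ring structure of $W_n(R)$ is obtained from the ghost map.  Over \<open>\<int>[X\<^sub>v]\<close> the ghost map is
injective, and Dwork's criterion describes its image as the sequences satisfying congruences that sums,
products and negatives inherit; this yields the Witt polynomials and all identities.  A general $R$
is a quotient of the polynomial ring with one variable for each element of $R$, and identities between Witt
vectors descend along this quotient map.
\<close>

section \<open>Evaluation of integral polynomials\<close>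

definition mpoly_vars :: "'v int_mpoly \<Rightarrow> 'v set" where
  "mpoly_vars P = (\<Union>m\<in>Poly_Mapping.keys P. Poly_Mapping.keys m)"

definition eval_monom :: "('a, 'b) ring_scheme \<Rightarrow> ('v \<Rightarrow> 'a) \<Rightarrow> ('v \<Rightarrow>\<^sub>0 nat) \<Rightarrow> 'a" where
  "eval_monom R x m = (\<Otimes>\<^bsub>R\<^esub>v\<in>Poly_Mapping.keys m. x v [^]\<^bsub>R\<^esub> Poly_Mapping.lookup m v)"

text \<open>Integral polynomials are the free abelian group on the monomials, so additive statements about them
need to be checked on monomials only.\<close>

lemma int_mpoly_induct [case_names zero monom diff]:
  fixes P :: "'v int_mpoly"
  assumes "Q 0" "\<And>m. Q (frag_of m)" "\<And>a b. Q a \<Longrightarrow> Q b \<Longrightarrow> Q (a - b)"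
  shows "Q P"
  using frag_induction[of P UNIV Q] assms by auto

lemma int_add_pow_0 [simp]: "[(0::int)] \<cdot>\<^bsub>R\<^esub> x = \<zero>\<^bsub>R\<^esub>"
  by (simp add: add_pow_def)

text \<open>Values outside the carrier are harmless at variables that do not occur.  The coordinates of a truncated Witt
vector with index at least $n$ are of this kind.\<close>

lemma (in cring) mpoly_eval_cong:
  assumes "\<And>v. v \<in> mpoly_vars P \<Longrightarrow> x v = y v" "y \<in> mpoly_vars P \<rightarrow> carrier R"
  shows "eval_int_mpoly R x P = eval_int_mpoly R y P"
proof -
  have xy: "x v = y v" "y v \<in> carrier R" if "m \<in> Poly_Mapping.keys P" "v \<in> Poly_Mapping.keys m" for m v
    using that assms unfolding mpoly_vars_def by blast+
  have "(\<Otimes>v\<in>Poly_Mapping.keys m. x v [^] Poly_Mapping.lookup m v) =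
      (\<Otimes>v\<in>Poly_Mapping.keys m. y v [^] Poly_Mapping.lookup m v)" if "m \<in> Poly_Mapping.keys P" for m
    using xy[OF that] by (intro finprod_cong') auto
  moreover have "(\<Otimes>v\<in>Poly_Mapping.keys m. y v [^] Poly_Mapping.lookup m v) \<in> carrier R"
    if "m \<in> Poly_Mapping.keys P" for m
    using that assms(2) by (intro finprod_closed) (auto simp: mpoly_vars_def Pi_iff)
  ultimately show ?thesis
    unfolding eval_int_mpoly_def by (intro finsum_cong) (auto simp: simp_implies_def)
qed

lemma (in cring) eval_monom_closed [simp]:
  "x \<in> UNIV \<rightarrow> carrier R \<Longrightarrow> eval_monom R x m \<in> carrier R"
  unfolding eval_monom_def by (intro finprod_closed) (auto simp: Pi_iff)

lemma (in cring) eval_monom_superset: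
  assumes "x \<in> UNIV \<rightarrow> carrier R" "finite S" "Poly_Mapping.keys m \<subseteq> S"
  shows "eval_monom R x m = (\<Otimes>v\<in>S. x v [^] Poly_Mapping.lookup m v)"
  unfolding eval_monom_def using assms
  by (intro finprod_mono_neutral_cong_left) (auto simp: Pi_iff in_keys_iff)

lemma (in cring) eval_monom_add:
  assumes "x \<in> UNIV \<rightarrow> carrier R"
  shows "eval_monom R x (m + m') = eval_monom R x m \<otimes> eval_monom R x m'"
proof -
  let ?S = "Poly_Mapping.keys m \<union> Poly_Mapping.keys m'"
  have "eval_monom R x (m + m') = (\<Otimes>v\<in>?S. x v [^] Poly_Mapping.lookup m v \<otimes> x v [^] Poly_Mapping.lookup m' v)"
    using assms eval_monom_superset[OF assms, of ?S "m + m'"]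
    by (simp add: keys_add lookup_add Pi_iff nat_pow_mult)
  also have "\<dots> = (\<Otimes>v\<in>?S. x v [^] Poly_Mapping.lookup m v) \<otimes> (\<Otimes>v\<in>?S. x v [^] Poly_Mapping.lookup m' v)"
    using assms by (intro finprod_multf) (auto simp: Pi_iff)
  finally show ?thesis
    using assms eval_monom_superset[OF assms, of ?S m] eval_monom_superset[OF assms, of ?S m'] by simp
qed

lemma (in cring) mpoly_eval_superset:
  assumes "x \<in> UNIV \<rightarrow> carrier R" "finite S" "Poly_Mapping.keys P \<subseteq> S"
  shows "eval_int_mpoly R x P = (\<Oplus>m\<in>S. [Poly_Mapping.lookup P m] \<cdot> eval_monom R x m)"
  unfolding eval_int_mpoly_def eval_monom_def[symmetric] using assms
  by (intro add.finprod_mono_neutral_cong_left) (auto simp: Pi_iff in_keys_iff)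

lemma (in cring) mpoly_eval_closed [simp]:
  "x \<in> UNIV \<rightarrow> carrier R \<Longrightarrow> eval_int_mpoly R x P \<in> carrier R"
  by (subst mpoly_eval_superset[OF _ _ order_refl]) (auto simp: Pi_iff)

lemma (in cring) mpoly_eval_add:
  assumes "x \<in> UNIV \<rightarrow> carrier R"
  shows "eval_int_mpoly R x (P + Q) = eval_int_mpoly R x P \<oplus> eval_int_mpoly R x Q"
proof -
  let ?S = "Poly_Mapping.keys P \<union> Poly_Mapping.keys Q"
  have "eval_int_mpoly R x (P + Q) = (\<Oplus>m\<in>?S. [Poly_Mapping.lookup P m] \<cdot> eval_monom R x m \<oplus>
      [Poly_Mapping.lookup Q m] \<cdot> eval_monom R x m)"
    using assms mpoly_eval_superset[OF assms, of ?S "P + Q"]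
    by (simp add: keys_add lookup_add add.int_pow_mult)
  also have "\<dots> = (\<Oplus>m\<in>?S. [Poly_Mapping.lookup P m] \<cdot> eval_monom R x m) \<oplus>
      (\<Oplus>m\<in>?S. [Poly_Mapping.lookup Q m] \<cdot> eval_monom R x m)"
    using assms by (intro finsum_addf) (auto simp: Pi_iff)
  finally show ?thesis
    using assms mpoly_eval_superset[OF assms, of ?S P] mpoly_eval_superset[OF assms, of ?S Q] by simp
qed

lemma (in cring) mpoly_eval_zero [simp]: "eval_int_mpoly R x 0 = \<zero>"
  by (simp add: eval_int_mpoly_def)

lemma (in cring) mpoly_eval_minus:
  assumes "x \<in> UNIV \<rightarrow> carrier R"
  shows "eval_int_mpoly R x (P - Q) = eval_int_mpoly R x P \<ominus> eval_int_mpoly R x Q"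
  using mpoly_eval_add[OF assms, of "P - Q" Q] assms
  by (simp add: minus_eq add.inv_solve_right)

lemma (in cring) mpoly_eval_single:
  assumes "x \<in> UNIV \<rightarrow> carrier R"
  shows "eval_int_mpoly R x (frag_of m) = eval_monom R x m"
  using assms mpoly_eval_superset[OF assms, of "{m}" "frag_of m"] by simp

lemma (in cring) mpoly_eval_one [simp]: "eval_int_mpoly R x 1 = \<one>"
  by (simp add: eval_int_mpoly_def lookup_one)

lemma (in cring) mpoly_eval_mult:
  assumes x: "x \<in> UNIV \<rightarrow> carrier R"
  shows "eval_int_mpoly R x (P * Q) = eval_int_mpoly R x P \<otimes> eval_int_mpoly R x Q"
proof -
  have 1: "eval_int_mpoly R x (frag_of m * Q) = eval_monom R x m \<otimes> eval_int_mpoly R x Q" for m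
  proof (induction Q rule: int_mpoly_induct)
    case (monom m')
    have "frag_of m * frag_of m' = (frag_of (m + m') :: 'c int_mpoly)"
      by (simp add: mult_single)
    then show ?case using x by (simp add: mpoly_eval_single[OF x] eval_monom_add)
  next
    case (diff a b)
    then show ?case using x
      by (simp add: right_diff_distrib mpoly_eval_minus minus_eq r_distr r_minus)
  qed (use x in auto)
  show ?thesis
  proof (induction P rule: int_mpoly_induct)
    case (monom m)
    then show ?case by (simp add: 1 mpoly_eval_single[OF x])
  next
    case (diff a b)
    then show ?case using x
      by (simp add: left_diff_distrib mpoly_eval_minus minus_eq l_distr l_minus)
  qed (use x in auto)
qed

lemma (in cring) mpoly_eval_power:
  assumes x: "x \<in> UNIV \<rightarrow> carrier R"
  shows "eval_int_mpoly R x (P ^ n) = eval_int_mpoly R x P [^] n"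
  by (induction n) (auto simp: mpoly_eval_mult[OF x] x m_comm)

lemma (in cring) mpoly_eval_var:
  assumes "x \<in> UNIV \<rightarrow> carrier R"
  shows "eval_int_mpoly R x (mpoly_var v) = x v"
  using mpoly_eval_single[OF assms, of "Poly_Mapping.single v 1"] assms
  by (simp add: mpoly_var_def eval_monom_def Pi_iff)

lemma (in cring) mpoly_eval_nat_mult:
  assumes x: "x \<in> UNIV \<rightarrow> carrier R"
  shows "eval_int_mpoly R x (of_nat k * P) = [k] \<cdot> eval_int_mpoly R x P"
proof (induction k)
  case (Suc k)
  have "eval_int_mpoly R x (of_nat (Suc k) * P) = eval_int_mpoly R x (of_nat k * P + P)"
    by (simp add: algebra_simps)
  then show ?case using Suc x by (simp add: mpoly_eval_add)
qed (use x in auto)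

lemma (in cring) mpoly_eval_sum:
  assumes x: "x \<in> UNIV \<rightarrow> carrier R"
  shows "eval_int_mpoly R x (\<Sum>i\<in>I. P i) = (\<Oplus>i\<in>I. eval_int_mpoly R x (P i))"
proof (induction I rule: infinite_finite_induct)
  case (infinite A)
  then show ?case by (simp add: finsum_def finprod_def)
next
  case (insert i I)
  then show ?case using x by (simp add: mpoly_eval_add[OF x] Pi_iff)
qed (use x in auto)

lemma (in ring_hom_cring) hom_eval:
  assumes x: "x \<in> UNIV \<rightarrow> carrier R"
  shows "h (eval_int_mpoly R x P) = eval_int_mpoly S (\<lambda>v. h (x v)) P"
proof -
  have hx: "(\<lambda>v. h (x v)) \<in> UNIV \<rightarrow> carrier S" using x by auto
  have pow: "h (a [^] n) = h a [^]\<^bsub>S\<^esub> n" if "a \<in> carrier R" for a and n :: nat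
    using that by (induction n) auto
  have mon: "h (eval_monom R x m) = eval_monom S (\<lambda>v. h (x v)) m" for m
  proof -
    have "h (\<Otimes>v\<in>K. x v [^] Poly_Mapping.lookup m v) =
        (\<Otimes>\<^bsub>S\<^esub>v\<in>K. h (x v) [^]\<^bsub>S\<^esub> Poly_Mapping.lookup m v)" if "finite K" for K
      using that x hx by (induction K) (auto simp: pow Pi_iff)
    then show ?thesis by (simp add: eval_monom_def)
  qed
  show ?thesis
  proof (induction P rule: int_mpoly_induct)
    case (monom m)
    then show ?case by (simp add: R.mpoly_eval_single[OF x] S.mpoly_eval_single[OF hx] mon)
  next
    case (diff a b)
    then show ?case by (simp add: R.mpoly_eval_minus[OF x] S.mpoly_eval_minus[OF hx] R.minus_eq S.minus_eq x)
  qed auto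
qed

section \<open>Witt's theorem\<close>

text \<open>A type-class ring as a record, so that substitution of polynomials into polynomials is an instance of
\<open>eval_int_mpoly\<close> and shares its lemmas.\<close>

definition univ_ring :: "'p::comm_ring_1 ring" where
  "univ_ring = \<lparr>carrier = UNIV, monoid.mult = (*), one = 1, ring.zero = 0, add = (+)\<rparr>"

lemma univ_ring_sel [simp]:
  "carrier univ_ring = UNIV" "monoid.mult univ_ring = (*)" "one univ_ring = 1"
  "ring.zero univ_ring = 0" "add univ_ring = (+)"
  by (simp_all add: univ_ring_def)

lemma cring_univ_ring: "cring (univ_ring :: 'p::comm_ring_1 ring)"
proof (intro cringI abelian_groupI comm_monoidI)
  fix x :: 'p
  show "\<exists>y\<in>carrier univ_ring. y \<oplus>\<^bsub>univ_ring\<^esub> x = \<zero>\<^bsub>univ_ring\<^esub>"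
    by (auto intro: exI[of _ "- x"])
qed (auto simp: algebra_simps)

interpretation UR: cring "univ_ring :: 'p::comm_ring_1 ring"
  by (rule cring_univ_ring)

lemma univ_ring_ops [simp]:
  "x [^]\<^bsub>univ_ring\<^esub> (n::nat) = x ^ n" "\<ominus>\<^bsub>univ_ring\<^esub> x = - x" "x \<ominus>\<^bsub>univ_ring\<^esub> y = x - y"
  "[n] \<cdot>\<^bsub>univ_ring\<^esub> x = of_nat n * x"
proof -
  show "x [^]\<^bsub>univ_ring\<^esub> n = x ^ n" by (induction n) (auto simp: algebra_simps)
  show *: "\<ominus>\<^bsub>univ_ring\<^esub> x = - x" for x :: 'a
    by (rule UR.minus_equality) auto
  show "x \<ominus>\<^bsub>univ_ring\<^esub> y = x - y" by (simp add: UR.minus_eq *)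
  show "[n] \<cdot>\<^bsub>univ_ring\<^esub> x = of_nat n * x"
    by (induction n) (auto simp: algebra_simps)
qed

subsection \<open>Congruences modulo powers of a prime\<close>

lemma dvd_power_diff:
  fixes x y :: "'r::comm_ring_1"
  assumes "d dvd x - y"
  shows "d dvd x ^ n - y ^ n"
  using assms power_diff_sumr2[of x n y] by (metis dvd_mult2)

text \<open>One $p$-th power improves a congruence modulo $p^{k+1}$ by one step: in
\<open>x\<^sup>p - y\<^sup>p = (x - y) * \<Sum>\<^sub>i x\<^sup>i y\<^sup>p\<^sup>-\<^sup>1\<^sup>-\<^sup>i\<close> the $p$ summands of the second factor are congruent to each other.\<close>

lemma dvd_power_prime_diff:
  fixes x y :: "'r::comm_ring_1"
  assumes "of_nat (p ^ Suc k) dvd x - y"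
  shows "of_nat (p ^ Suc (Suc k)) dvd x ^ p - y ^ p"
proof -
  have p: "of_nat p dvd x - y"
    using assms by (metis dvd_mult_left of_nat_mult power_Suc)
  have "of_nat p dvd (\<Sum>i<p. y ^ (p - Suc i) * x ^ i - y ^ (p - 1))"
  proof (rule dvd_sum)
    fix i assume "i \<in> {..<p}"
    then have "y ^ (p - 1) = y ^ (p - Suc i) * y ^ i"
      by (simp flip: power_add)
    then have "y ^ (p - Suc i) * x ^ i - y ^ (p - 1) = y ^ (p - Suc i) * (x ^ i - y ^ i)"
      by (simp add: algebra_simps)
    then show "of_nat p dvd y ^ (p - Suc i) * x ^ i - y ^ (p - 1)"
      using dvd_power_diff[OF p] by simp
  qed
  moreover have "(\<Sum>i<p. y ^ (p - Suc i) * x ^ i - y ^ (p - 1)) =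
      (\<Sum>i<p. y ^ (p - Suc i) * x ^ i) - of_nat p * y ^ (p - 1)"
    by (simp add: sum_subtractf)
  ultimately have "of_nat p dvd (\<Sum>i<p. y ^ (p - Suc i) * x ^ i)"
    by (metis diff_add_cancel dvd_add dvd_triv_left)
  then have "of_nat (p ^ Suc k) * of_nat p dvd (x - y) * (\<Sum>i<p. y ^ (p - Suc i) * x ^ i)"
    using assms mult_dvd_mono by blast
  then show ?thesis
    by (simp add: power_diff_sumr2 mult_ac)
qed

lemma dvd_power_prime_power_diff:
  fixes x y :: "'r::comm_ring_1"
  assumes "of_nat p dvd x - y"
  shows "of_nat (p ^ Suc k) dvd x ^ (p ^ k) - y ^ (p ^ k)"
proof (induction k)
  case (Suc k)
  then have "of_nat (p ^ Suc (Suc k)) dvd (x ^ (p ^ k)) ^ p - (y ^ (p ^ k)) ^ p"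
    by (rule dvd_power_prime_diff)
  then show ?case by (simp only: power_Suc2 flip: power_mult)
qed (use assms in auto)

lemma dvd_freshman:
  fixes x y :: "'r::comm_ring_1"
  assumes p: "Factorial_Ring.prime p"
  shows "of_nat p dvd (x + y) ^ p - (x ^ p + y ^ p)"
proof -
  have p0: "p > 0" using p prime_gt_0_nat by blast
  have "(x + y) ^ p = (\<Sum>k\<le>p. of_nat (p choose k) * x ^ k * y ^ (p - k))"
    by (rule binomial_ring)
  also have "{..p} = insert 0 (insert p {0<..<p})" using p0 by auto
  also have "(\<Sum>k\<in>\<dots>. of_nat (p choose k) * x ^ k * y ^ (p - k)) =
      x ^ p + y ^ p + (\<Sum>k\<in>{0<..<p}. of_nat (p choose k) * x ^ k * y ^ (p - k))"
    using p0 by simp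
  finally have "(x + y) ^ p - (x ^ p + y ^ p) = (\<Sum>k\<in>{0<..<p}. of_nat (p choose k) * x ^ k * y ^ (p - k))"
    by simp
  moreover have "of_nat p dvd (of_nat (p choose k) * x ^ k * y ^ (p - k) :: 'r)" if "k \<in> {0<..<p}" for k
  proof -
    have "p dvd p choose k" using dvd_choose_prime[of k p] that p by auto
    then obtain c where "p choose k = p * c" by (rule dvdE)
    then show ?thesis by (simp add: mult.assoc)
  qed
  ultimately show ?thesis by (metis (no_types, lifting) dvd_sum)
qed

subsection \<open>Integral polynomials\<close>

lemma lookup_of_nat_mult:
  "Poly_Mapping.lookup (of_nat c * P) m = of_nat c * Poly_Mapping.lookup (P :: 'v int_mpoly) m"
  by (induction c) (auto simp: algebra_simps lookup_add)

lemma mpoly_torsion_free: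
  assumes "c > 0" "of_nat c * P = of_nat c * (Q :: 'v int_mpoly)"
  shows "P = Q"
proof (rule poly_mapping_eqI)
  fix m
  have "of_nat c * Poly_Mapping.lookup P m = of_nat c * Poly_Mapping.lookup Q m"
    using assms(2) by (metis lookup_of_nat_mult)
  then show "Poly_Mapping.lookup P m = Poly_Mapping.lookup Q m" using assms(1) by simp
qed

lemma mpoly_var_power: "mpoly_var v ^ n = frag_of (Poly_Mapping.single v n)"
  by (induction n) (auto simp: mpoly_var_def mult_single simp flip: single_add)

lemma prod_frag_of: "(\<Prod>i\<in>I. frag_of (f i)) = (frag_of (\<Sum>i\<in>I. f i) :: 'v int_mpoly)"
  by (induction I rule: infinite_finite_induct) (auto simp: mult_single)

text \<open>This identifies polynomials of the form \<open>frag_of m\<close>, on which inductions are based, with products of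
variables, on which ring homomorphisms are computed.\<close>

lemma monom_eq_prod_vars:
  "frag_of m = (\<Prod>v\<in>Poly_Mapping.keys m. mpoly_var v ^ Poly_Mapping.lookup m v)"
proof -
  have "(\<Sum>v\<in>Poly_Mapping.keys m. Poly_Mapping.single v (Poly_Mapping.lookup m v)) = m"
    by (rule poly_mapping_eqI) (auto simp: lookup_sum lookup_single when_def in_keys_iff)
  then show ?thesis by (simp add: mpoly_var_power prod_frag_of)
qed

lemma mpoly_vars_var [simp]: "mpoly_vars (mpoly_var v) = {v}"
  by (simp add: mpoly_vars_def mpoly_var_def)

lemma mpoly_vars_minus: "mpoly_vars (P - Q) \<subseteq> mpoly_vars P \<union> mpoly_vars Q"
  using keys_diff[of P Q] by (auto simp: mpoly_vars_def)

lemma mpoly_vars_add: "mpoly_vars (P + Q) \<subseteq> mpoly_vars P \<union> mpoly_vars Q"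
  using keys_add[of P Q] by (auto simp: mpoly_vars_def)

lemma mpoly_vars_mult: "mpoly_vars (P * Q) \<subseteq> mpoly_vars P \<union> mpoly_vars Q"
proof
  fix v assume "v \<in> mpoly_vars (P * Q)"
  then obtain m where m: "m \<in> Poly_Mapping.keys (P * Q)" "v \<in> Poly_Mapping.keys m"
    by (auto simp: mpoly_vars_def)
  obtain a b where ab: "m = a + b" "a \<in> Poly_Mapping.keys P" "b \<in> Poly_Mapping.keys Q"
    using keys_mult[of P Q] m(1) by blast
  then show "v \<in> mpoly_vars P \<union> mpoly_vars Q"
    using m(2) keys_add[of a b] by (auto simp: mpoly_vars_def)
qed

lemma mpoly_vars_of_nat [simp]: "mpoly_vars (of_nat c) = {}"
  by (auto simp: mpoly_vars_def in_keys_iff lookup_of_nat when_def split: if_splits)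

lemma mpoly_vars_one [simp]: "mpoly_vars 1 = {}"
  by (simp add: mpoly_vars_def)

lemma mpoly_vars_of_nat_mult:
  "c > 0 \<Longrightarrow> mpoly_vars (of_nat c * P) = mpoly_vars P"
  by (simp add: mpoly_vars_def in_keys_iff lookup_of_nat_mult keys_def cong: SUP_cong_simp)

lemma mpoly_vars_power: "mpoly_vars (P ^ n) \<subseteq> mpoly_vars P"
proof (induction n)
  case 0
  then show ?case by simp
next
  case (Suc n)
  then show ?case using mpoly_vars_mult[of P "P ^ n"] by auto
qed

lemma mpoly_vars_sum: "mpoly_vars (\<Sum>i\<in>I. P i) \<subseteq> (\<Union>i\<in>I. mpoly_vars (P i))"
proof (induction I rule: infinite_finite_induct)
  case (insert i I)
  then show ?case using mpoly_vars_add[of "P i" "\<Sum>i\<in>I. P i"] by auto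
qed (use mpoly_vars_of_nat[of 0] in auto)

subsection \<open>The lift of Frobenius\<close>

definition frob_lift :: "nat \<Rightarrow> 'v int_mpoly \<Rightarrow> 'v int_mpoly" where
  "frob_lift p = eval_int_mpoly univ_ring (\<lambda>v. mpoly_var v ^ p)"

lemma frob_lift_ops:
  "frob_lift p (P + Q) = frob_lift p P + frob_lift p Q"
  "frob_lift p (P - Q) = frob_lift p P - frob_lift p Q"
  "frob_lift p (P * Q) = frob_lift p P * frob_lift p Q"
  "frob_lift p (P ^ n) = frob_lift p P ^ n"
  "frob_lift p 0 = 0"
  unfolding frob_lift_def
  by (simp_all add: UR.mpoly_eval_add UR.mpoly_eval_minus UR.mpoly_eval_mult UR.mpoly_eval_power)

lemma frob_lift_of_nat_mult: "frob_lift p (of_nat c * P) = of_nat c * frob_lift p P"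
  unfolding frob_lift_def by (simp add: UR.mpoly_eval_nat_mult)

lemma frob_lift_sum: "frob_lift p (\<Sum>i\<in>I. P i) = (\<Sum>i\<in>I. frob_lift p (P i))"
  by (induction I rule: infinite_finite_induct) (auto simp: frob_lift_ops)

lemma frob_lift_monom: "frob_lift p (frag_of m) = frag_of m ^ p"
proof -
  have one: "frob_lift p 1 = 1" for p
    unfolding frob_lift_def using UR.mpoly_eval_one by simp
  have var: "frob_lift p (mpoly_var v) = mpoly_var v ^ p" for v :: 'a
    unfolding frob_lift_def by (simp add: UR.mpoly_eval_var)
  have "frob_lift p (\<Prod>v\<in>K. mpoly_var v ^ f v) = (\<Prod>v\<in>K. mpoly_var v ^ f v) ^ p" for K :: "'a set" and f
    by (induction K rule: infinite_finite_induct)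
      (auto simp: frob_lift_ops one var power_mult_distrib mult.commute simp flip: power_mult)
  then show ?thesis by (simp add: monom_eq_prod_vars)
qed

text \<open>On a monomial the substitution is the $p$-th power itself, and both sides are additive modulo $p$.\<close>

lemma frob_lift_cong:
  assumes p: "Factorial_Ring.prime p"
  shows "of_nat p dvd frob_lift p P - P ^ p"
proof (induction P rule: int_mpoly_induct)
  case zero
  then show ?case using prime_gt_0_nat[OF p] by (simp add: frob_lift_ops power_0_left)
next
  case (monom m)
  then show ?case by (simp add: frob_lift_monom)
next
  case (diff a b)
  have "frob_lift p (a - b) - (a - b) ^ p =
    (frob_lift p a - a ^ p) - (frob_lift p b - b ^ p) + ((a - b + b) ^ p - ((a - b) ^ p + b ^ p))"
    by (simp add: frob_lift_ops)
  then show ?case using diff dvd_freshman[OF p, of "a - b" b] by (metis dvd_add dvd_diff)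
qed

subsection \<open>Ghost components\<close>

lemma ghost_split: "ghost p Z k = (\<Sum>i<k. of_nat (p ^ i) * Z i ^ (p ^ (k - i))) + of_nat (p ^ k) * Z k"
proof -
  have "{..k} = insert k {..<k}" by auto
  then show ?thesis by (simp add: ghost_def add.commute)
qed

lemma ghost_0 [simp]: "ghost p Z 0 = Z 0"
  by (simp add: ghost_def)

text \<open>The $k$-th ghost component determines \<open>p\<^sup>k a\<^sub>k\<close> once the earlier coordinates are known, and the polynomial
ring has no torsion.\<close>

lemma ghost_inj:
  assumes "p > 0" "ghost p a = ghost p b"
  shows "a = b"
proof
  fix k show "a k = b k"
  proof (induction k rule: less_induct)
    case (less k)
    have "ghost p a k = ghost p b k" using assms(2) by simp
    then have "of_nat (p ^ k) * a k = of_nat (p ^ k) * b k"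
      using less by (simp add: ghost_split)
    then show ?case using mpoly_torsion_free[of "p ^ k"] assms(1) by simp
  qed
qed

text \<open>The quantitative form of injectivity.  A congruence modulo $p$ between earlier coordinates becomes one modulo
\<open>p\<^sup>k\<^sup>-\<^sup>i\<^sup>+\<^sup>1\<close> after raising to the power \<open>p\<^sup>k\<^sup>-\<^sup>i\<close>, which with the factor \<open>p\<^sup>i\<close> gives the modulus \<open>p\<^sup>k\<^sup>+\<^sup>1\<close>.\<close>

lemma ghost_cong_imp_cong:
  assumes "p > 0" and gh: "\<And>k. k \<le> n \<Longrightarrow> of_nat (p ^ Suc k) dvd ghost p a k - ghost p b k"
  shows "k \<le> n \<Longrightarrow> of_nat p dvd a k - b k"
proof (induction k rule: less_induct)
  case (less k)
  have "of_nat (p ^ Suc k) dvd (\<Sum>i<k. of_nat (p ^ i) * (a i ^ (p ^ (k - i)) - b i ^ (p ^ (k - i))))"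
  proof (rule dvd_sum)
    fix i assume i: "i \<in> {..<k}"
    then have "of_nat (p ^ Suc (k - i)) dvd a i ^ (p ^ (k - i)) - b i ^ (p ^ (k - i))"
      using less by (intro dvd_power_prime_power_diff) auto
    then have "of_nat (p ^ i) * of_nat (p ^ Suc (k - i)) dvd
        of_nat (p ^ i) * (a i ^ (p ^ (k - i)) - b i ^ (p ^ (k - i)))"
      by (rule mult_dvd_mono[OF dvd_refl])
    moreover have "p ^ i * p ^ Suc (k - i) = p ^ Suc k"
      using i by (simp flip: power_add power_Suc)
    ultimately show "of_nat (p ^ Suc k) dvd of_nat (p ^ i) * (a i ^ (p ^ (k - i)) - b i ^ (p ^ (k - i)))"
      by (metis of_nat_mult)
  qed
  from dvd_diff[OF gh[OF less.prems] this]
  have "of_nat (p ^ Suc k) dvd of_nat (p ^ k) * (a k - b k)"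
    by (simp add: ghost_split sum_subtractf right_diff_distrib del: of_nat_power)
  then obtain z where "of_nat (p ^ k) * (a k - b k) = of_nat (p ^ Suc k) * z"
    by (rule dvdE)
  then have "of_nat (p ^ k) * (a k - b k) = of_nat (p ^ k) * (of_nat p * z)"
    by (simp only: power_Suc2 of_nat_mult mult.assoc)
  then have "a k - b k = of_nat p * z"
    using mpoly_torsion_free[of "p ^ k"] \<open>p > 0\<close> by simp
  then show ?case by simp
qed

text \<open>Dwork's criterion for being a sequence of ghost components.\<close>

definition dwork_seq :: "nat \<Rightarrow> (nat \<Rightarrow> 'v int_mpoly) \<Rightarrow> bool" where
  "dwork_seq p w \<longleftrightarrow> (\<forall>k. of_nat (p ^ Suc k) dvd w (Suc k) - frob_lift p (w k))"

text \<open>Applying the Frobenius lift to the $k$-th ghost component replaces each coordinate by something congruent to its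
$p$-th power; the result is the $(k+1)$-st ghost component without its last summand, up to a multiple of
\<open>p\<^sup>k\<^sup>+\<^sup>1\<close>.  It makes the criterion necessary, and it provides the division by \<open>p\<^sup>k\<^sup>+\<^sup>1\<close> that
makes it sufficient.\<close>

lemma frob_lift_ghost:
  assumes p: "Factorial_Ring.prime p"
  shows "of_nat (p ^ Suc k) dvd
    (\<Sum>i<Suc k. of_nat (p ^ i) * Z i ^ (p ^ (Suc k - i))) - frob_lift p (ghost p Z k)"
proof -
  have "of_nat (p ^ Suc k) dvd
      (\<Sum>i<Suc k. of_nat (p ^ i) * ((Z i ^ p) ^ (p ^ (k - i)) - frob_lift p (Z i) ^ (p ^ (k - i))))"
  proof (rule dvd_sum)
    fix i assume i: "i \<in> {..<Suc k}"
    have "of_nat p dvd Z i ^ p - frob_lift p (Z i)"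
      using frob_lift_cong[OF p, of "Z i"] by (metis dvd_minus_iff minus_diff_eq)
    from dvd_power_prime_power_diff[OF this]
    have "of_nat (p ^ i) * of_nat (p ^ Suc (k - i)) dvd
        of_nat (p ^ i) * ((Z i ^ p) ^ (p ^ (k - i)) - frob_lift p (Z i) ^ (p ^ (k - i)))"
      by (rule mult_dvd_mono[OF dvd_refl])
    moreover have "p ^ i * p ^ Suc (k - i) = p ^ Suc k"
      using i by (simp flip: power_add power_Suc)
    ultimately show "of_nat (p ^ Suc k) dvd
        of_nat (p ^ i) * ((Z i ^ p) ^ (p ^ (k - i)) - frob_lift p (Z i) ^ (p ^ (k - i)))"
      by (metis of_nat_mult)
  qed
  moreover have "(\<Sum>i<Suc k. of_nat (p ^ i) * Z i ^ (p ^ (Suc k - i))) - frob_lift p (ghost p Z k) =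
      (\<Sum>i<Suc k. of_nat (p ^ i) * ((Z i ^ p) ^ (p ^ (k - i)) - frob_lift p (Z i) ^ (p ^ (k - i))))"
    unfolding ghost_def frob_lift_sum lessThan_Suc_atMost sum_subtractf[symmetric]
    by (intro sum.cong refl)
      (auto simp: frob_lift_ops(4) frob_lift_of_nat_mult right_diff_distrib Suc_diff_le simp del: of_nat_power simp flip: power_mult)
  ultimately show ?thesis by simp
qed

lemma dwork_seq_ghost:
  assumes p: "Factorial_Ring.prime p"
  shows "dwork_seq p (ghost p Z)"
  unfolding dwork_seq_def
proof
  fix k
  show "of_nat (p ^ Suc k) dvd ghost p Z (Suc k) - frob_lift p (ghost p Z k)"
    using dvd_add[OF frob_lift_ghost[OF p, of k Z] dvd_triv_left[of "of_nat (p ^ Suc k)" "Z (Suc k)"]]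
    by (simp only: ghost_split[of p Z "Suc k"]) (simp add: algebra_simps)
qed

text \<open>The coordinates with prescribed ghost components, by recursive division; the choice is unique whenever the
division is possible.\<close>

fun unghost :: "nat \<Rightarrow> (nat \<Rightarrow> 'v int_mpoly) \<Rightarrow> nat \<Rightarrow> 'v int_mpoly" where
  "unghost p w k = (SOME y. of_nat (p ^ k) * y =
     w k - (\<Sum>i<k. of_nat (p ^ i) * unghost p w i ^ (p ^ (k - i))))"

declare unghost.simps [simp del]

lemma ghost_unghost:
  assumes p: "Factorial_Ring.prime p" and w: "dwork_seq p w"
  shows "ghost p (unghost p w) = w"
proof
  fix k show "ghost p (unghost p w) k = w k"
  proof (induction k rule: less_induct)
    case (less k)
    have "of_nat (p ^ k) dvd w k - (\<Sum>i<k. of_nat (p ^ i) * unghost p w i ^ (p ^ (k - i)))"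
    proof (cases k)
      case (Suc j)
      have "of_nat (p ^ Suc j) dvd w (Suc j) - frob_lift p (w j)"
        using w by (simp add: dwork_seq_def)
      moreover have "of_nat (p ^ Suc j) dvd
          (\<Sum>i<Suc j. of_nat (p ^ i) * unghost p w i ^ (p ^ (Suc j - i))) - frob_lift p (w j)"
        using frob_lift_ghost[OF p, of j "unghost p w"] less[of j] Suc by simp
      ultimately show ?thesis
        unfolding Suc by (metis (no_types, lifting) diff_diff_eq2 diff_add_cancel dvd_diff)
    qed auto
    then have "\<exists>y. of_nat (p ^ k) * y = w k - (\<Sum>i<k. of_nat (p ^ i) * unghost p w i ^ (p ^ (k - i)))"
      by (rule dvdE) (rule exI, erule sym)
    then have "of_nat (p ^ k) * unghost p w k =
        w k - (\<Sum>i<k. of_nat (p ^ i) * unghost p w i ^ (p ^ (k - i)))"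
      by (subst unghost.simps) (rule someI_ex)
    then show ?case by (simp add: ghost_split)
  qed
qed

lemma dwork_seq_add: "dwork_seq p v \<Longrightarrow> dwork_seq p w \<Longrightarrow> dwork_seq p (\<lambda>k. v k + w k)"
  unfolding dwork_seq_def frob_lift_ops
  by (metis (no_types, lifting) add_diff_add dvd_add)

lemma dwork_seq_uminus: "dwork_seq p w \<Longrightarrow> dwork_seq p (\<lambda>k. - w k)"
  unfolding dwork_seq_def
  using frob_lift_ops(2)[of p 0] frob_lift_ops(5)
  by (metis diff_0 dvd_minus_iff minus_diff_minus)

lemma dwork_seq_mult:
  assumes "dwork_seq p v" "dwork_seq p w" shows "dwork_seq p (\<lambda>k. v k * w k)"
proof -
  have "v (Suc k) * w (Suc k) - frob_lift p (v k * w k) =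
    v (Suc k) * (w (Suc k) - frob_lift p (w k)) + (v (Suc k) - frob_lift p (v k)) * frob_lift p (w k)" for k
    by (simp add: frob_lift_ops algebra_simps)
  then show ?thesis using assms unfolding dwork_seq_def
    by (metis dvd_add dvd_mult dvd_mult2)
qed

text \<open>Dwork sequences are closed under addition and multiplication, so the descriptions by which the Witt polynomials
are defined have exactly one solution.\<close>

lemma witt_poly_spec:
  assumes p: "Factorial_Ring.prime p"
  shows "ghost p (witt_add_poly p) k =
      ghost p (\<lambda>i. mpoly_var (Inl i)) k + ghost p (\<lambda>i. mpoly_var (Inr i)) k"
    and "ghost p (witt_mult_poly p) k =
      ghost p (\<lambda>i. mpoly_var (Inl i)) k * ghost p (\<lambda>i. mpoly_var (Inr i)) k"
proof -
  have uniq: "\<exists>!S. \<forall>k. ghost p S k = w k" if "dwork_seq p w" for w :: "nat \<Rightarrow> (nat + nat) int_mpoly"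
  proof
    show "\<forall>k. ghost p (unghost p w) k = w k" using ghost_unghost[OF p that] by simp
    fix S assume "\<forall>k. ghost p S k = w k"
    then have "ghost p S = ghost p (unghost p w)" using ghost_unghost[OF p that] by auto
    then show "S = unghost p w" using ghost_inj p prime_gt_0_nat by blast
  qed
  show "ghost p (witt_add_poly p) k =
      ghost p (\<lambda>i. mpoly_var (Inl i)) k + ghost p (\<lambda>i. mpoly_var (Inr i)) k"
    using theI'[OF uniq[OF dwork_seq_add[OF dwork_seq_ghost[OF p] dwork_seq_ghost[OF p]]]]
    unfolding witt_add_poly_def by blast
  show "ghost p (witt_mult_poly p) k =
      ghost p (\<lambda>i. mpoly_var (Inl i)) k * ghost p (\<lambda>i. mpoly_var (Inr i)) k"
    using theI'[OF uniq[OF dwork_seq_mult[OF dwork_seq_ghost[OF p] dwork_seq_ghost[OF p]]]]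
    unfolding witt_mult_poly_def by blast
qed

lemma ghost_vars:
  assumes "\<And>i. i \<le> k \<Longrightarrow> mpoly_vars (Z i) \<subseteq> V"
  shows "mpoly_vars (ghost p Z k) \<subseteq> V"
proof -
  have "mpoly_vars (of_nat (p ^ i) * Z i ^ (p ^ (k - i))) \<subseteq> V" if "i \<le> k" for i
    using mpoly_vars_mult[of "of_nat (p ^ i)" "Z i ^ (p ^ (k - i))"] mpoly_vars_power[of "Z i" "p ^ (k - i)"]
      assms[OF that] by (auto simp del: of_nat_power)
  then show ?thesis
    unfolding ghost_def by (intro order_trans[OF mpoly_vars_sum] UN_least) simp
qed

text \<open>Solving for the $k$-th coordinate uses the ghost components up to $k$ only and divides by a power of $p$, which
introduces no variables.\<close>

lemma vars_of_ghost_vars: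
  assumes "p > 0" "\<And>i. i \<le> k \<Longrightarrow> mpoly_vars (ghost p Z i) \<subseteq> V i" "mono V"
  shows "mpoly_vars (Z k) \<subseteq> V k"
  using assms(2)
proof (induction k rule: less_induct)
  case (less k)
  have *: "mpoly_vars (of_nat (p ^ i) * Z i ^ (p ^ (k - i))) \<subseteq> V k" if "i < k" for i
    using mpoly_vars_mult[of "of_nat (p ^ i)" "Z i ^ (p ^ (k - i))"] mpoly_vars_power[of "Z i" "p ^ (k - i)"]
      less.IH[OF that] less.prems that monoD[OF \<open>mono V\<close>, of i k] by (auto simp del: of_nat_power)
  have "mpoly_vars (of_nat (p ^ k) * Z k) = mpoly_vars (ghost p Z k - (\<Sum>i<k. of_nat (p ^ i) * Z i ^ (p ^ (k - i))))"
    by (simp add: ghost_split)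
  also have "\<dots> \<subseteq> mpoly_vars (ghost p Z k) \<union> mpoly_vars (\<Sum>i<k. of_nat (p ^ i) * Z i ^ (p ^ (k - i)))"
    by (rule mpoly_vars_minus)
  also have "\<dots> \<subseteq> V k"
    using less.prems[of k] * by (intro Un_least order_trans[OF mpoly_vars_sum] UN_least) auto
  finally show ?case using assms(1) mpoly_vars_of_nat_mult[of "p ^ k" "Z k"] by simp
qed

text \<open>This makes truncation compatible with the operations: the $k$-th coordinate of a sum or product depends
on the coordinates up to $k$ of the arguments.\<close>

lemma witt_poly_vars:
  assumes p: "Factorial_Ring.prime p"
  shows "mpoly_vars (witt_add_poly p k) \<subseteq> Inl ` {..k} \<union> Inr ` {..k}"
    and "mpoly_vars (witt_mult_poly p k) \<subseteq> Inl ` {..k} \<union> Inr ` {..k}"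
proof -
  let ?V = "\<lambda>k::nat. (Inl ` {..k} \<union> Inr ` {..k} :: (nat + nat) set)"
  have mono: "mono ?V" by (rule monoI) auto
  have l: "mpoly_vars (ghost p (\<lambda>i. mpoly_var (Inl i)) k) \<subseteq> ?V k"
    and r: "mpoly_vars (ghost p (\<lambda>i. mpoly_var (Inr i)) k) \<subseteq> ?V k" for k
    by (intro ghost_vars; auto)+
  have p0: "p > 0" using p prime_gt_0_nat by blast
  have "mpoly_vars (ghost p (witt_add_poly p) i) \<subseteq> ?V i" for i
    using mpoly_vars_add l r unfolding witt_poly_spec[OF p] by (meson Un_least order_trans)
  then show "mpoly_vars (witt_add_poly p k) \<subseteq> ?V k"
    by (rule vars_of_ghost_vars[OF p0 _ mono])
  have "mpoly_vars (ghost p (witt_mult_poly p) i) \<subseteq> ?V i" for i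
    using mpoly_vars_mult l r unfolding witt_poly_spec[OF p] by (meson Un_least order_trans)
  then show "mpoly_vars (witt_mult_poly p k) \<subseteq> ?V k"
    by (rule vars_of_ghost_vars[OF p0 _ mono])
qed

section \<open>The ring of truncated Witt vectors\<close>

definition witt_plus :: "nat \<Rightarrow> (nat \<Rightarrow> 'v int_mpoly) \<Rightarrow> (nat \<Rightarrow> 'v int_mpoly) \<Rightarrow> nat \<Rightarrow> 'v int_mpoly" where
  "witt_plus p a b k = eval_int_mpoly univ_ring (case_sum a b) (witt_add_poly p k)"

definition witt_times :: "nat \<Rightarrow> (nat \<Rightarrow> 'v int_mpoly) \<Rightarrow> (nat \<Rightarrow> 'v int_mpoly) \<Rightarrow> nat \<Rightarrow> 'v int_mpoly" where
  "witt_times p a b k = eval_int_mpoly univ_ring (case_sum a b) (witt_mult_poly p k)"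

lemma univ_ring_finsum [simp]: "(\<Oplus>\<^bsub>univ_ring\<^esub>i\<in>I. f i) = (\<Sum>i\<in>I. f i)"
proof (cases "finite I")
  case True
  then show ?thesis by (induction I) (simp_all add: UR.finsum_insert)
qed (simp add: finsum_def finprod_def)

lemma eval_ghost:
  fixes x :: "'v \<Rightarrow> 'w int_mpoly"
  shows "eval_int_mpoly univ_ring x (ghost p Z k) = ghost p (\<lambda>i. eval_int_mpoly univ_ring x (Z i)) k"
proof -
  have "eval_int_mpoly univ_ring x (of_nat (p ^ i) * Z i ^ (p ^ (k - i))) =
    of_nat (p ^ i) * eval_int_mpoly univ_ring x (Z i) ^ (p ^ (k - i))" for i
    using UR.mpoly_eval_nat_mult[of x "p ^ i"] by (simp add: UR.mpoly_eval_power del: of_nat_power)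
  then show ?thesis unfolding ghost_def by (simp add: UR.mpoly_eval_sum)
qed

lemma ghost_witt_plus:
  assumes "Factorial_Ring.prime p"
  shows "ghost p (witt_plus p a b) k = ghost p a k + ghost p b k"
  using arg_cong[OF witt_poly_spec(1)[OF assms, of k], of "eval_int_mpoly univ_ring (case_sum a b)"]
  by (simp add: UR.mpoly_eval_add eval_ghost UR.mpoly_eval_var witt_plus_def[abs_def])

lemma ghost_witt_times:
  assumes "Factorial_Ring.prime p"
  shows "ghost p (witt_times p a b) k = ghost p a k * ghost p b k"
  using arg_cong[OF witt_poly_spec(2)[OF assms, of k], of "eval_int_mpoly univ_ring (case_sum a b)"]
  by (simp add: UR.mpoly_eval_mult eval_ghost UR.mpoly_eval_var witt_times_def[abs_def])

lemma ghost_zero: "p > 0 \<Longrightarrow> ghost p (\<lambda>i. 0) k = 0"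
  by (simp add: ghost_def power_0_left)

lemma ghost_teichmuller: "p > 0 \<Longrightarrow> ghost p (\<lambda>i. if i = 0 then s else 0) k = s ^ (p ^ k)"
proof -
  assume "p > 0"
  have "ghost p (\<lambda>i. if i = 0 then s else 0) k = (\<Sum>i\<in>{..k}. if i = 0 then s ^ (p ^ k) else 0)"
    unfolding ghost_def using \<open>p > 0\<close> by (intro sum.cong) (auto simp: power_0_left)
  then show ?thesis by simp
qed

text \<open>Throughout, \<open>red\<close> is the map from Witt vectors over \<open>\<int>[X\<^sub>r]\<close>, with one variable for each element $r$ of
the type of $R$, onto \<open>W\<^sub>n(R)\<close>.  It is compatible with the operations
(\<open>red_plus\<close>, \<open>red_times\<close>), so that it suffices to compare ghost components upstairs (\<open>red_eqI\<close>).\<close>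

locale witt_vectors = cring R for R (structure) +
  fixes p n :: nat
  assumes p_prime: "Factorial_Ring.prime p" and char_p: "has_char p R"
begin

abbreviation "W \<equiv> witt_ring p n R"

text \<open>Variables indexed by elements outside the carrier are sent to zero.\<close>

definition lift_ev :: "'a int_mpoly \<Rightarrow> 'a" where
  "lift_ev = eval_int_mpoly R (\<lambda>r. if r \<in> carrier R then r else \<zero>)"

definition red :: "(nat \<Rightarrow> 'a int_mpoly) \<Rightarrow> nat \<Rightarrow> 'a" where
  "red a = (\<lambda>k\<in>{..<n}. lift_ev (a k))"

text \<open>A preimage under \<open>red\<close>.  Zero coordinates are lifted to zero and equal coordinates to equal ones, so that
vanishing and agreement of initial coordinates persist upstairs.\<close>

definition wlift :: "(nat \<Rightarrow> 'a) \<Rightarrow> nat \<Rightarrow> 'a int_mpoly" where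
  "wlift \<alpha> i = (if i < n \<and> \<alpha> i \<noteq> \<zero> then mpoly_var (\<alpha> i) else 0)"

lemma p_pos: "p > 0" using p_prime prime_gt_0_nat by blast

lemma lift_ev_hom: "ring_hom_cring univ_ring R lift_ev"
proof -
  have x: "(\<lambda>r. if r \<in> carrier R then r else \<zero>) \<in> UNIV \<rightarrow> carrier R" by auto
  show ?thesis
    by (intro ring_hom_cringI ring_hom_ringI2 UR.ring_axioms ring_axioms cring_univ_ring is_cring ring_hom_memI)
      (auto simp: lift_ev_def mpoly_eval_add[OF x] mpoly_eval_mult[OF x] mpoly_eval_closed[OF x])
qed

sublocale ev: ring_hom_cring univ_ring R lift_ev by (rule lift_ev_hom)

lemma lift_ev_ops:
  "lift_ev P \<in> carrier R" "lift_ev (P + Q) = lift_ev P \<oplus> lift_ev Q" "lift_ev (P - Q) = lift_ev P \<ominus> lift_ev Q"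
  "lift_ev (P * Q) = lift_ev P \<otimes> lift_ev Q" "lift_ev 0 = \<zero>" "lift_ev 1 = \<one>"
  "lift_ev (P ^ k) = lift_ev P [^] k" "lift_ev (of_nat k * P) = [k] \<cdot> lift_ev P"
  "r \<in> carrier R \<Longrightarrow> lift_ev (mpoly_var r) = r"
proof -
  have x: "(\<lambda>r. if r \<in> carrier R then r else \<zero>) \<in> UNIV \<rightarrow> carrier R" by auto
  show "lift_ev P \<in> carrier R" "lift_ev (P + Q) = lift_ev P \<oplus> lift_ev Q" "lift_ev (P - Q) = lift_ev P \<ominus> lift_ev Q"
  "lift_ev (P * Q) = lift_ev P \<otimes> lift_ev Q" "lift_ev 0 = \<zero>" "lift_ev 1 = \<one>"
  "lift_ev (P ^ k) = lift_ev P [^] k"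
  "r \<in> carrier R \<Longrightarrow> lift_ev (mpoly_var r) = r"
    unfolding lift_ev_def
    by (simp_all add: mpoly_eval_add[OF x] mpoly_eval_minus[OF x] mpoly_eval_mult[OF x] mpoly_eval_power[OF x]
       mpoly_eval_var[OF x] mpoly_eval_closed[OF x])
  show "lift_ev (of_nat k * P) = [k] \<cdot> lift_ev P"
    unfolding lift_ev_def by (rule mpoly_eval_nat_mult[OF x])
qed

lemma char_p_smult: "x \<in> carrier R \<Longrightarrow> [p] \<cdot> x = \<zero>"
proof -
  assume x: "x \<in> carrier R"
  have "[p] \<cdot> \<one> = \<zero>" using char_p by (simp add: has_char_def)
  then have "([p] \<cdot> \<one>) \<otimes> x = \<zero>" using x by simp
  then show ?thesis using x add_pow_ldistr[of \<one> x p] by simp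
qed

lemma lift_ev_cong:
  assumes "of_nat p dvd P - Q" shows "lift_ev P = lift_ev Q"
proof -
  obtain Z where "P - Q = of_nat p * Z" using assms by (rule dvdE)
  then have "P = Q + of_nat p * Z" by (simp add: algebra_simps)
  then show ?thesis by (simp only: lift_ev_ops(2,8)) (simp add: char_p_smult lift_ev_ops(1))
qed

lemma carrier_W: "carrier W = {..<n} \<rightarrow>\<^sub>E carrier R"
  by (simp add: witt_ring_def)

lemma W_coord_closed: "\<alpha> \<in> carrier W \<Longrightarrow> i < n \<Longrightarrow> \<alpha> i \<in> carrier R"
  by (auto simp: carrier_W)

lemma W_eqI: "\<alpha> \<in> carrier W \<Longrightarrow> \<beta> \<in> carrier W \<Longrightarrow> (\<And>i. i < n \<Longrightarrow> \<alpha> i = \<beta> i) \<Longrightarrow> \<alpha> = \<beta>"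
  unfolding carrier_W by (rule PiE_ext) auto

lemma red_closed [simp]: "red a \<in> carrier W"
  by (auto simp: red_def carrier_W lift_ev_ops(1))

lemma red_wlift: "\<alpha> \<in> carrier W \<Longrightarrow> red (wlift \<alpha>) = \<alpha>"
  by (rule W_eqI) (simp, auto simp: red_def wlift_def lift_ev_ops(5,9) W_coord_closed)

lemma lift_ev_poly:
  assumes "k < n" "mpoly_vars P \<subseteq> Inl ` {..k} \<union> Inr ` {..k}"
  shows "lift_ev (eval_int_mpoly univ_ring (case_sum a b) P) = eval_int_mpoly R (case_sum (red a) (red b)) P"
proof -
  have "lift_ev (eval_int_mpoly univ_ring (case_sum a b) P) =
      eval_int_mpoly R (\<lambda>v. lift_ev (case_sum a b v)) P"
    by (rule ev.hom_eval) simp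
  also have "\<dots> = eval_int_mpoly R (case_sum (red a) (red b)) P"
  proof (rule mpoly_eval_cong[symmetric])
    show "(\<lambda>v. lift_ev (case_sum a b v)) \<in> mpoly_vars P \<rightarrow> carrier R" by (auto simp: lift_ev_ops(1))
    fix v assume "v \<in> mpoly_vars P"
    then show "case_sum (red a) (red b) v = lift_ev (case_sum a b v)"
      using assms by (auto simp: red_def)
  qed
  finally show ?thesis .
qed

lemma red_plus: "red a \<oplus>\<^bsub>W\<^esub> red b = red (witt_plus p a b)"
proof -
  have "eval_int_mpoly R (case_sum (red a) (red b)) (witt_add_poly p k) = lift_ev (witt_plus p a b k)"
    if "k < n" for k
    unfolding witt_plus_def using lift_ev_poly[OF that witt_poly_vars(1)[OF p_prime]] by simp
  then show ?thesis by (auto simp: witt_ring_def red_def[of "witt_plus p a b"] cong: restrict_cong)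
qed

lemma red_times: "red a \<otimes>\<^bsub>W\<^esub> red b = red (witt_times p a b)"
proof -
  have "eval_int_mpoly R (case_sum (red a) (red b)) (witt_mult_poly p k) = lift_ev (witt_times p a b k)"
    if "k < n" for k
    unfolding witt_times_def using lift_ev_poly[OF that witt_poly_vars(2)[OF p_prime]] by simp
  then show ?thesis by (auto simp: witt_ring_def red_def[of "witt_times p a b"] cong: restrict_cong)
qed

lemma red_teichmuller: "teichmuller n R (lift_ev s) = red (\<lambda>i. if i = 0 then s else 0)"
  by (auto simp: teichmuller_def red_def lift_ev_ops(5) cong: restrict_cong)

lemma red_zero: "\<zero>\<^bsub>W\<^esub> = red (\<lambda>i. 0)"
  by (auto simp: witt_ring_def red_def lift_ev_ops(5) cong: restrict_cong)

lemma red_one: "\<one>\<^bsub>W\<^esub> = red (\<lambda>i. if i = 0 then 1 else 0)"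
  unfolding red_teichmuller[symmetric] by (simp add: witt_ring_def lift_ev_ops(6))

lemma red_eqI: "(\<And>k. ghost p a k = ghost p b k) \<Longrightarrow> red a = red b"
  using ghost_inj[OF p_pos, of a b] by auto

lemma W_lift_cases:
  assumes "\<alpha> \<in> carrier W" obtains a where "\<alpha> = red a"
  using red_wlift[OF assms] by metis

lemmas ghost_W = ghost_witt_plus[OF p_prime] ghost_witt_times[OF p_prime] ghost_zero[OF p_pos]
  ghost_teichmuller[OF p_pos]

text \<open>For the additive inverse, the negative of a ghost sequence satisfies Dwork's criterion; for \<open>p = 2\<close> it is not
given by negating coordinates.\<close>

lemma cring_W: "cring W"
proof (intro cringI abelian_groupI comm_monoidI)
  fix x y assume "x \<in> carrier W" "y \<in> carrier W"
  then obtain a b where xy: "x = red a" "y = red b" by (metis W_lift_cases)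
  show "x \<oplus>\<^bsub>W\<^esub> y \<in> carrier W" "x \<otimes>\<^bsub>W\<^esub> y \<in> carrier W" by (simp_all add: xy red_plus red_times)
  show "x \<oplus>\<^bsub>W\<^esub> y = y \<oplus>\<^bsub>W\<^esub> x" "x \<otimes>\<^bsub>W\<^esub> y = y \<otimes>\<^bsub>W\<^esub> x"
    unfolding xy red_plus red_times by (rule red_eqI; simp add: ghost_W algebra_simps)+
  show "\<zero>\<^bsub>W\<^esub> \<oplus>\<^bsub>W\<^esub> x = x" "\<one>\<^bsub>W\<^esub> \<otimes>\<^bsub>W\<^esub> x = x"
    unfolding xy red_plus red_times red_zero red_one by (rule red_eqI; simp add: ghost_W)+
  have "ghost p (unghost p (\<lambda>k. - ghost p a k)) = (\<lambda>k. - ghost p a k)"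
    by (intro ghost_unghost[OF p_prime] dwork_seq_uminus dwork_seq_ghost[OF p_prime])
  then have "red (unghost p (\<lambda>k. - ghost p a k)) \<oplus>\<^bsub>W\<^esub> x = \<zero>\<^bsub>W\<^esub>"
    unfolding xy red_plus red_zero by (intro red_eqI) (simp add: ghost_W)
  then show "\<exists>y\<in>carrier W. y \<oplus>\<^bsub>W\<^esub> x = \<zero>\<^bsub>W\<^esub>" by (metis red_closed)
next
  fix x y z assume "x \<in> carrier W" "y \<in> carrier W" "z \<in> carrier W"
  then obtain a b c where xy: "x = red a" "y = red b" "z = red c" by (metis W_lift_cases)
  show "x \<oplus>\<^bsub>W\<^esub> y \<oplus>\<^bsub>W\<^esub> z = x \<oplus>\<^bsub>W\<^esub> (y \<oplus>\<^bsub>W\<^esub> z)" "x \<otimes>\<^bsub>W\<^esub> y \<otimes>\<^bsub>W\<^esub> z = x \<otimes>\<^bsub>W\<^esub> (y \<otimes>\<^bsub>W\<^esub> z)"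
    "(x \<oplus>\<^bsub>W\<^esub> y) \<otimes>\<^bsub>W\<^esub> z = x \<otimes>\<^bsub>W\<^esub> z \<oplus>\<^bsub>W\<^esub> y \<otimes>\<^bsub>W\<^esub> z"
    unfolding xy red_plus red_times by (rule red_eqI; simp add: ghost_W algebra_simps)+
qed (simp_all add: red_zero red_one)

sublocale W: cring W by (rule cring_W)

lemma coord0_hom: "0 < n \<Longrightarrow> (\<lambda>\<alpha>. \<alpha> 0) \<in> ring_hom W R"
proof (rule ring_hom_memI)
  assume n: "0 < n"
  show "\<one>\<^bsub>W\<^esub> 0 = \<one>" using n by (simp add: witt_ring_def teichmuller_def)
  fix x assume x: "x \<in> carrier W" then show "x 0 \<in> carrier R" using n W_coord_closed by blast
  fix y assume "y \<in> carrier W"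
  then obtain a b where xy: "x = red a" "y = red b" using x by (metis W_lift_cases)
  have "witt_plus p a b 0 = a 0 + b 0" "witt_times p a b 0 = a 0 * b 0"
    using ghost_W(1,2)[of a b 0] by simp_all
  then show "(x \<otimes>\<^bsub>W\<^esub> y) 0 = x 0 \<otimes> y 0" "(x \<oplus>\<^bsub>W\<^esub> y) 0 = x 0 \<oplus> y 0"
    using n unfolding xy red_plus red_times by (simp_all add: red_def lift_ev_ops)
qed

lemma frobenius_add:
  assumes "x \<in> carrier R" "y \<in> carrier R"
  shows "(x \<oplus> y) [^] p = x [^] p \<oplus> y [^] p"
  using lift_ev_cong[OF dvd_freshman[OF p_prime, of "mpoly_var x" "mpoly_var y"]] assms
  by (simp add: lift_ev_ops)

lemma frobenius_hom: "ring_hom_cring R R (\<lambda>r. r [^] p)"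
  by (intro ring_hom_cringI ring_hom_ringI2 ring_hom_memI)
    (auto simp: frobenius_add nat_pow_distrib is_cring ring_axioms)

lemma witt_frob_closed [simp]: "\<alpha> \<in> carrier W \<Longrightarrow> witt_frob p n R \<alpha> \<in> carrier W"
  by (auto simp: witt_frob_def carrier_W)

text \<open>In characteristic $p$ the map \<open>r \<mapsto> r\<^sup>p\<close> is a ring endomorphism of $R$, hence commutes with integral polynomials.\<close>

lemma frobenius_poly:
  assumes "\<alpha> \<in> carrier W" "\<beta> \<in> carrier W" "k < n" "mpoly_vars P \<subseteq> Inl ` {..k} \<union> Inr ` {..k}"
  shows "eval_int_mpoly R (case_sum (witt_frob p n R \<alpha>) (witt_frob p n R \<beta>)) P =
    eval_int_mpoly R (case_sum \<alpha> \<beta>) P [^] p"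
proof -
  interpret F: ring_hom_cring R R "\<lambda>r. r [^] p" by (rule frobenius_hom)
  define x where "x = (\<lambda>v. if v \<in> Inl ` {..k} \<union> Inr ` {..k} then case_sum \<alpha> \<beta> v else \<zero>)"
  have x: "x \<in> UNIV \<rightarrow> carrier R" using W_coord_closed assms(1-3) by (auto simp: x_def)
  have "eval_int_mpoly R (case_sum \<alpha> \<beta>) P = eval_int_mpoly R x P"
    by (rule mpoly_eval_cong) (use assms(4) x in \<open>auto simp: x_def\<close>)
  moreover have "eval_int_mpoly R (case_sum (witt_frob p n R \<alpha>) (witt_frob p n R \<beta>)) P =
      eval_int_mpoly R (\<lambda>v. x v [^] p) P"
    by (rule mpoly_eval_cong) (use assms(3,4) x in \<open>auto simp: x_def witt_frob_def\<close>)
  ultimately show ?thesis using F.hom_eval[OF x, of P] by simp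
qed

lemma witt_frob_hom: "witt_frob p n R \<in> ring_hom W W"
proof (rule ring_hom_memI)
  show "witt_frob p n R \<one>\<^bsub>W\<^esub> = \<one>\<^bsub>W\<^esub>"
    using p_pos by (auto simp: witt_frob_def witt_ring_def teichmuller_def fun_eq_iff nat_pow_zero)
  fix x y assume xy: "x \<in> carrier W" "y \<in> carrier W"
  show "witt_frob p n R (x \<otimes>\<^bsub>W\<^esub> y) = witt_frob p n R x \<otimes>\<^bsub>W\<^esub> witt_frob p n R y"
    using frobenius_poly[OF xy _ witt_poly_vars(2)[OF p_prime]]
    by (auto simp: witt_ring_def witt_frob_def[of p n R "restrict _ _"] cong: restrict_cong)
  show "witt_frob p n R (x \<oplus>\<^bsub>W\<^esub> y) = witt_frob p n R x \<oplus>\<^bsub>W\<^esub> witt_frob p n R y"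
    using frobenius_poly[OF xy _ witt_poly_vars(1)[OF p_prime]]
    by (auto simp: witt_ring_def witt_frob_def[of p n R "restrict _ _"] cong: restrict_cong)
qed simp

lemma teichmuller_closed [simp]: "s \<in> carrier R \<Longrightarrow> teichmuller n R s \<in> carrier W"
  by (auto simp: teichmuller_def carrier_W)

text \<open>Both sides have ghost components \<open>s\<close> to the power \<open>p\<^sup>k\<close> times those of \<open>\<beta>\<close>.\<close>

lemma teichmuller_mult:
  assumes "s \<in> carrier R" "\<beta> \<in> carrier W" "k < n"
  shows "(teichmuller n R s \<otimes>\<^bsub>W\<^esub> \<beta>) k = s [^] (p ^ k) \<otimes> \<beta> k"
proof -
  obtain b where b: "\<beta> = red b" using assms W_lift_cases by blast
  have s: "lift_ev (mpoly_var s) = s" using assms by (simp add: lift_ev_ops)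
  have "ghost p (\<lambda>i. mpoly_var s ^ (p ^ i) * b i) k = mpoly_var s ^ (p ^ k) * ghost p b k" for k
    unfolding ghost_def sum_distrib_left
    by (intro sum.cong) (auto simp: power_mult_distrib mult_ac simp flip: power_mult power_add)
  then have "red (witt_times p (\<lambda>i. if i = 0 then mpoly_var s else 0) b) = red (\<lambda>i. mpoly_var s ^ (p ^ i) * b i)"
    by (intro red_eqI) (simp add: ghost_W)
  then have "teichmuller n R s \<otimes>\<^bsub>W\<^esub> \<beta> = red (\<lambda>i. mpoly_var s ^ (p ^ i) * b i)"
    using red_teichmuller[of "mpoly_var s"] s by (simp add: b red_times)
  then show ?thesis using assms s by (simp add: red_def b lift_ev_ops)
qed

lemma witt_frob_teichmuller: "witt_frob p n R (teichmuller n R s) = teichmuller n R (s [^] p)"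
  using p_pos by (auto simp: witt_frob_def teichmuller_def fun_eq_iff nat_pow_zero)

lemma W_nat_mult_lift:
  "\<exists>b. (\<forall>k. ghost p b k = of_nat m * ghost p c k) \<and> [m] \<cdot>\<^bsub>W\<^esub> red c = red b"
proof (induction m)
  case 0
  then show ?case by (intro exI[of _ "\<lambda>i. 0"]) (simp add: ghost_W red_zero)
next
  case (Suc m)
  then obtain b where "\<forall>k. ghost p b k = of_nat m * ghost p c k" "[m] \<cdot>\<^bsub>W\<^esub> red c = red b" by blast
  then show ?case
    by (intro exI[of _ "witt_plus p b c"]) (simp add: ghost_W red_plus algebra_simps)
qed

text \<open>The ghost components of \<open>V F c\<close> for the coordinatewise $p$-th power \<open>F\<close> agree with those of
\<open>p c\<close> up to the error that decides the next lemma.\<close>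

lemma ghost_shift_Suc:
  "ghost p (case_nat 0 (\<lambda>k. c k ^ p)) (Suc k) = of_nat p * ghost p c (Suc k) - of_nat (p ^ Suc (Suc k)) * c (Suc k)"
proof -
  have "ghost p (case_nat 0 (\<lambda>k. c k ^ p)) (Suc k) =
      (\<Sum>i\<le>k. of_nat (p ^ Suc i) * (c i ^ p) ^ (p ^ (k - i)))"
    using p_pos unfolding ghost_def sum.atMost_Suc_shift by (simp add: power_0_left)
  also have "\<dots> = of_nat p * (\<Sum>i<Suc k. of_nat (p ^ i) * c i ^ (p ^ (Suc k - i)))"
    unfolding sum_distrib_left lessThan_Suc_atMost
    by (intro sum.cong refl) (auto simp: Suc_diff_le mult_ac simp flip: power_mult)
  finally show ?thesis by (simp add: ghost_split[of p c "Suc k"] algebra_simps)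
qed

text \<open>The identity $p = VF$ in characteristic $p$.  Upstairs, \<open>p c\<close> and \<open>V F c\<close> have ghost components that are congruent
modulo \<open>p\<^sup>k\<^sup>+\<^sup>1\<close>, so their coordinates are congruent modulo $p$ and agree in $R$.\<close>

lemma W_p_mult:
  assumes "\<gamma> \<in> carrier W" "k < n"
  shows "([p] \<cdot>\<^bsub>W\<^esub> \<gamma>) k = (case k of 0 \<Rightarrow> \<zero> | Suc j \<Rightarrow> \<gamma> j [^] p)"
proof -
  obtain c where c: "\<gamma> = red c" using assms W_lift_cases by blast
  obtain b where b: "\<And>k. ghost p b k = of_nat p * ghost p c k" "[p] \<cdot>\<^bsub>W\<^esub> \<gamma> = red b"
    using W_nat_mult_lift[of p c] c by blast
  have "of_nat (p ^ Suc k) dvd ghost p b k - ghost p (case_nat 0 (\<lambda>k. c k ^ p)) k" for k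
  proof (cases k)
    case (Suc j)
    show ?thesis unfolding Suc ghost_shift_Suc by (simp add: b(1) del: of_nat_power)
  next
    case 0
    show ?thesis unfolding 0 using b(1)[of 0] by simp
  qed
  then have "of_nat p dvd b k - case_nat 0 (\<lambda>k. c k ^ p) k"
    using ghost_cong_imp_cong[OF p_pos, of k b] by blast
  then have "lift_ev (b k) = lift_ev (case_nat 0 (\<lambda>k. c k ^ p) k)" by (rule lift_ev_cong)
  then show ?thesis unfolding b(2) using assms(2) by (auto simp: c red_def lift_ev_ops split: nat.splits)
qed

text \<open>The coordinates of \<open>\<beta>\<close> are shifted down and a zero is appended; the shift back up recovers \<open>\<beta>\<close>.\<close>

lemma witt_frob_dvd_p:
  assumes "\<beta> \<in> carrier W" "\<beta> 0 = \<zero>" "0 < n"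
  shows "\<exists>\<gamma>\<in>carrier W. witt_frob p n R \<beta> = [p] \<cdot>\<^bsub>W\<^esub> \<gamma>"
proof
  let ?g = "\<lambda>k\<in>{..<n}. if Suc k < n then \<beta> (Suc k) else \<zero>"
  show g: "?g \<in> carrier W" using assms by (auto simp: carrier_W W_coord_closed)
  show "witt_frob p n R \<beta> = [p] \<cdot>\<^bsub>W\<^esub> ?g"
  proof (rule W_eqI)
    fix i assume "i < n"
    then show "witt_frob p n R \<beta> i = ([p] \<cdot>\<^bsub>W\<^esub> ?g) i"
      using assms p_pos by (auto simp: W_p_mult[OF g] witt_frob_def nat_pow_zero split: nat.splits)
  qed (use assms g in auto)
qed

lemma p_one_eq_frob_shift:
  assumes "0 < n"
  shows "\<exists>\<gamma>\<in>carrier W. \<gamma> 0 = \<zero> \<and> witt_frob p n R \<gamma> = [p] \<cdot>\<^bsub>W\<^esub> \<one>\<^bsub>W\<^esub>"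
proof
  let ?g = "\<lambda>k\<in>{..<n}. if k = 1 then \<one> else \<zero>"
  show g: "?g \<in> carrier W" by (auto simp: carrier_W)
  have one: "\<one>\<^bsub>W\<^esub> i = (if i = 0 then \<one> else \<zero>)" if "i < n" for i
    using that by (simp add: witt_ring_def teichmuller_def)
  have "witt_frob p n R ?g = [p] \<cdot>\<^bsub>W\<^esub> \<one>\<^bsub>W\<^esub>"
  proof (rule W_eqI)
    fix i assume "i < n"
    then show "witt_frob p n R ?g i = ([p] \<cdot>\<^bsub>W\<^esub> \<one>\<^bsub>W\<^esub>) i"
      using assms p_pos one by (auto simp: W_p_mult witt_frob_def nat_pow_zero split: nat.splits)
  qed (use g in auto)
  then show "?g 0 = \<zero> \<and> witt_frob p n R ?g = [p] \<cdot>\<^bsub>W\<^esub> \<one>\<^bsub>W\<^esub>" using assms by simp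
qed

lemma W_diff_low:
  assumes "\<alpha> \<in> carrier W" "\<beta> \<in> carrier W" and eq: "\<And>j. j < i \<Longrightarrow> \<alpha> j = \<beta> j" and "j < i" "j < n"
  shows "(\<alpha> \<ominus>\<^bsub>W\<^esub> \<beta>) j = \<zero>"
proof -
  let ?a = "wlift \<alpha>" and ?b = "wlift \<beta>"
  define c where "c = unghost p (\<lambda>k. ghost p ?a k + - ghost p ?b k)"
  have c: "ghost p c = (\<lambda>k. ghost p ?a k + - ghost p ?b k)"
    unfolding c_def
    by (intro ghost_unghost[OF p_prime] dwork_seq_add dwork_seq_uminus dwork_seq_ghost[OF p_prime])
  have "red c \<oplus>\<^bsub>W\<^esub> red ?b = red ?a"
    unfolding red_plus by (rule red_eqI) (simp add: ghost_W c)
  then have "\<alpha> \<ominus>\<^bsub>W\<^esub> \<beta> = red c"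
    using assms(1,2) by (metis W.add.inv_solve_right W.minus_eq red_closed red_wlift)
  moreover have "c k = 0" if "k < i" for k
    using that
  proof (induction k rule: less_induct)
    case (less k)
    have "ghost p ?a k = ghost p ?b k"
      unfolding ghost_def using less.prems eq by (intro sum.cong) (auto simp: wlift_def)
    then have "ghost p c k = 0" by (simp add: c)
    moreover have "ghost p c k = of_nat (p ^ k) * c k"
      unfolding ghost_split using less p_pos by (simp add: power_0_left)
    ultimately show ?case using mpoly_torsion_free[of "p ^ k" "c k" 0] p_pos by simp
  qed
  ultimately show ?thesis using assms(4,5) by (simp add: red_def lift_ev_ops)
qed

text \<open>On vectors that vanish below $i$, addition in coordinate $i$ is the addition of $R$: the graded pieces of the
$V$-filtration are copies of the additive group of $R$.\<close>

lemma W_add_low: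
  assumes "\<alpha> \<in> carrier W" "\<beta> \<in> carrier W" and z: "\<And>j. j < i \<Longrightarrow> \<alpha> j = \<zero>" "\<And>j. j < i \<Longrightarrow> \<beta> j = \<zero>"
    and "i < n" "j \<le> i"
  shows "(\<alpha> \<oplus>\<^bsub>W\<^esub> \<beta>) j = \<alpha> j \<oplus> \<beta> j"
proof -
  let ?a = "wlift \<alpha>" and ?b = "wlift \<beta>"
  let ?c = "witt_plus p ?a ?b"
  have "?c k = ?a k + ?b k" if "k \<le> i" for k
    using that
  proof (induction k rule: less_induct)
    case (less k)
    have low: "?a j = 0" "?b j = 0" if "j < k" for j using z less.prems that by (simp_all add: wlift_def)
    have "?c j = 0" if "j < k" for j using less.IH[OF that] less.prems low[OF that] that by simp
    then have "ghost p ?c k = of_nat (p ^ k) * ?c k"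
      unfolding ghost_split using p_pos by (simp add: power_0_left)
    moreover have "ghost p ?a k = of_nat (p ^ k) * ?a k" "ghost p ?b k = of_nat (p ^ k) * ?b k"
      unfolding ghost_split using low p_pos by (simp_all add: power_0_left)
    ultimately have "of_nat (p ^ k) * ?c k = of_nat (p ^ k) * (?a k + ?b k)"
      using ghost_W(1)[of ?a ?b k] by (simp only: distrib_left)
    then show ?case using mpoly_torsion_free[of "p ^ k"] p_pos by simp
  qed
  then have "red ?c j = red ?a j \<oplus> red ?b j"
    using assms by (simp add: red_def lift_ev_ops)
  then show ?thesis using assms(1,2) red_plus[of ?a ?b] by (simp add: red_wlift)
qed

end

section \<open>Modules\<close>

lemma module_via_sel [simp]:
  "carrier (module_via h S) = carrier S" "ring.zero (module_via h S) = \<zero>\<^bsub>S\<^esub>"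
  "add (module_via h S) = add S" "smult (module_via h S) = (\<lambda>a x. h a \<otimes>\<^bsub>S\<^esub> x)"
  by (simp_all add: module_via_def)

lemma module_module_via:
  assumes A: "cring A" and S: "cring S" and h: "h \<in> ring_hom A S"
  shows "module A (module_via h S)"
proof -
  interpret A: cring A by (rule A)
  interpret S: cring S by (rule S)
  have hc: "h a \<in> carrier S" if "a \<in> carrier A" for a using h that by (rule ring_hom_closed)
  show ?thesis
  proof (rule moduleI[OF A])
    show "abelian_group (module_via h S)"
      by (rule abelian_groupI) (auto simp: S.a_ac intro: S.add.l_inv_ex)
  qed (auto simp: hc S.l_distr S.r_distr S.m_assoc ring_hom_mult[OF h] ring_hom_add[OF h] ring_hom_one[OF h])
qed

lemma mod_homD:
  assumes "f \<in> mod_hom A M N"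
  shows "x \<in> carrier M \<Longrightarrow> f x \<in> carrier N"
    "x \<in> carrier M \<Longrightarrow> y \<in> carrier M \<Longrightarrow> f (x \<oplus>\<^bsub>M\<^esub> y) = f x \<oplus>\<^bsub>N\<^esub> f y"
    "a \<in> carrier A \<Longrightarrow> x \<in> carrier M \<Longrightarrow> f (a \<odot>\<^bsub>M\<^esub> x) = a \<odot>\<^bsub>N\<^esub> f x"
  using assms by (auto simp: mod_hom_def)

lemma mod_hom_zero:
  assumes "module A M" "module A N" "f \<in> mod_hom A M N"
  shows "f \<zero>\<^bsub>M\<^esub> = \<zero>\<^bsub>N\<^esub>"
proof -
  interpret M: module A M by fact
  interpret N: module A N by fact
  show ?thesis
    using mod_homD(3)[OF assms(3), of "\<zero>\<^bsub>A\<^esub>" "\<zero>\<^bsub>M\<^esub>"] mod_homD(1)[OF assms(3), of "\<zero>\<^bsub>M\<^esub>"] by simp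
qed

lemma mod_hom_finsum:
  assumes "module A M" "module A N" "f \<in> mod_hom A M N" "finite I" "q \<in> I \<rightarrow> carrier M"
  shows "f (\<Oplus>\<^bsub>M\<^esub>i\<in>I. q i) = (\<Oplus>\<^bsub>N\<^esub>i\<in>I. f (q i))"
proof -
  interpret M: module A M by fact
  interpret N: module A N by fact
  show ?thesis using assms(4,5)
  proof (induction I)
    case empty
    show ?case by (simp add: mod_hom_zero[OF assms(1-3)])
  next
    case (insert i I)
    then show ?case by (simp add: mod_homD[OF assms(3)] Pi_iff)
  qed
qed

text \<open>The quotient of \<open>M\<close> by \<open>K\<close>, realised on a subset of a given type: each class is represented by the image
under \<open>e\<close> of a chosen element.  This transports test modules into the universe over which purity quantifies.\<close>

lemma exists_quotient_module:
  fixes M :: "('c, 'm, 'z) module_scheme" and e :: "'m \<Rightarrow> 'u"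
  assumes M: "module A M" and K: "K \<subseteq> carrier M" "\<zero>\<^bsub>M\<^esub> \<in> K"
    and Kadd: "\<And>x y. x \<in> K \<Longrightarrow> y \<in> K \<Longrightarrow> x \<oplus>\<^bsub>M\<^esub> y \<in> K"
    and Ksmult: "\<And>a x. a \<in> carrier A \<Longrightarrow> x \<in> K \<Longrightarrow> a \<odot>\<^bsub>M\<^esub> x \<in> K"
    and e: "inj_on e (carrier M)"
  shows "\<exists>(L :: ('c, 'u) module) g. module A L \<and> g \<in> mod_hom A M L \<and> g ` carrier M = carrier L \<and>
    (\<forall>x\<in>carrier M. g x = \<zero>\<^bsub>L\<^esub> \<longleftrightarrow> x \<in> K)"
proof -
  interpret M: module A M by (rule M)
  have Kneg: "\<ominus>\<^bsub>M\<^esub> x \<in> K" if "x \<in> K" for x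
    using Ksmult[of "\<ominus>\<^bsub>A\<^esub> \<one>\<^bsub>A\<^esub>" x] that K(1) M.smult_l_minus[of "\<one>\<^bsub>A\<^esub>" x] by auto
  define r where "r x y \<longleftrightarrow> y \<ominus>\<^bsub>M\<^esub> x \<in> K" for x y
  have r_refl: "r x x" if "x \<in> carrier M" for x using that K(2) by (simp add: r_def M.r_neg M.minus_eq)
  have r_sym: "r y x" if "r x y" "x \<in> carrier M" "y \<in> carrier M" for x y
    using Kneg[of "y \<ominus>\<^bsub>M\<^esub> x"] that by (simp add: r_def M.minus_eq M.minus_add M.a_comm)
  have r_trans: "r x z" if "r x y" "r y z" "x \<in> carrier M" "y \<in> carrier M" "z \<in> carrier M" for x y z
  proof -
    have "(z \<ominus>\<^bsub>M\<^esub> y) \<oplus>\<^bsub>M\<^esub> (y \<ominus>\<^bsub>M\<^esub> x) = z \<ominus>\<^bsub>M\<^esub> x"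
      using that(3-5) by (simp add: M.minus_eq M.a_assoc M.r_neg1)
    then show ?thesis using Kadd[of "z \<ominus>\<^bsub>M\<^esub> y" "y \<ominus>\<^bsub>M\<^esub> x"] that(1,2) by (simp add: r_def)
  qed
  define rep where "rep x = (SOME y. y \<in> carrier M \<and> r x y)" for x
  define g where "g x = e (rep x)" for x
  have rep: "rep x \<in> carrier M" "r x (rep x)" if "x \<in> carrier M" for x
    using someI[of "\<lambda>y. y \<in> carrier M \<and> r x y" x] that r_refl by (auto simp: rep_def)
  have g_eq: "g x = g y \<longleftrightarrow> r x y" if x: "x \<in> carrier M" and y: "y \<in> carrier M" for x y
  proof
    assume "g x = g y"
    then have "rep x = rep y"
      using inj_onD[OF e] rep(1)[OF x] rep(1)[OF y] by (simp add: g_def)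
    then show "r x y" using r_trans[OF rep(2)[OF x], of y] r_sym[OF rep(2)[OF y]] rep(1) x y by simp
  next
    assume xy: "r x y"
    have "z \<in> carrier M \<and> r x z \<longleftrightarrow> z \<in> carrier M \<and> r y z" for z
      using r_trans[OF xy, of z] r_trans[OF r_sym[OF xy x y], of z] x y by blast
    then show "g x = g y" by (simp add: g_def rep_def)
  qed
  define s where "s u = inv_into (carrier M) g u" for u
  have s: "s (g x) \<in> carrier M" "r (s (g x)) x" if "x \<in> carrier M" for x
  proof -
    show 1: "s (g x) \<in> carrier M" unfolding s_def using that by (intro inv_into_into) auto
    have "g (s (g x)) = g x" unfolding s_def using that by (intro f_inv_into_f) auto
    then show "r (s (g x)) x" using g_eq 1 that by blast
  qed
  define L :: "('c, 'u) module" where "L = \<lparr>carrier = g ` carrier M, monoid.mult = undefined, one = undefined,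
    ring.zero = g \<zero>\<^bsub>M\<^esub>, add = (\<lambda>u v. g (s u \<oplus>\<^bsub>M\<^esub> s v)), smult = (\<lambda>a u. g (a \<odot>\<^bsub>M\<^esub> s u))\<rparr>"
  have L_sel: "carrier L = g ` carrier M" "\<zero>\<^bsub>L\<^esub> = g \<zero>\<^bsub>M\<^esub>" by (simp_all add: L_def)
  have L_add: "g x \<oplus>\<^bsub>L\<^esub> g y = g (x \<oplus>\<^bsub>M\<^esub> y)" if x: "x \<in> carrier M" and y: "y \<in> carrier M" for x y
  proof -
    have "(x \<ominus>\<^bsub>M\<^esub> s (g x)) \<oplus>\<^bsub>M\<^esub> (y \<ominus>\<^bsub>M\<^esub> s (g y)) = (x \<oplus>\<^bsub>M\<^esub> y) \<ominus>\<^bsub>M\<^esub> (s (g x) \<oplus>\<^bsub>M\<^esub> s (g y))"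
      using x y s by (simp add: M.minus_eq M.minus_add M.a_ac)
    then have "r (s (g x) \<oplus>\<^bsub>M\<^esub> s (g y)) (x \<oplus>\<^bsub>M\<^esub> y)"
      using Kadd[of "x \<ominus>\<^bsub>M\<^esub> s (g x)" "y \<ominus>\<^bsub>M\<^esub> s (g y)"] s(2)[OF x] s(2)[OF y] by (simp add: r_def)
    then show ?thesis using g_eq x y s(1) by (simp add: L_def)
  qed
  have L_smult: "a \<odot>\<^bsub>L\<^esub> g x = g (a \<odot>\<^bsub>M\<^esub> x)" if a: "a \<in> carrier A" and x: "x \<in> carrier M" for a x
  proof -
    have "a \<odot>\<^bsub>M\<^esub> (x \<ominus>\<^bsub>M\<^esub> s (g x)) = a \<odot>\<^bsub>M\<^esub> x \<ominus>\<^bsub>M\<^esub> a \<odot>\<^bsub>M\<^esub> s (g x)"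
      using a x s by (simp add: M.minus_eq M.smult_r_distr M.smult_r_minus)
    then have "r (a \<odot>\<^bsub>M\<^esub> s (g x)) (a \<odot>\<^bsub>M\<^esub> x)"
      using Ksmult[OF a, of "x \<ominus>\<^bsub>M\<^esub> s (g x)"] s(2)[OF x] by (simp add: r_def)
    then show ?thesis using g_eq a x s(1) by (simp add: L_def)
  qed
  have "module A L"
  proof (rule moduleI[OF M.R.is_cring])
    show "abelian_group L"
    proof (rule abelian_groupI)
      fix x assume "x \<in> carrier L"
      then obtain x' where x: "x = g x'" "x' \<in> carrier M" by (auto simp: L_sel)
      then have "g (\<ominus>\<^bsub>M\<^esub> x') \<in> carrier L" "g (\<ominus>\<^bsub>M\<^esub> x') \<oplus>\<^bsub>L\<^esub> x = \<zero>\<^bsub>L\<^esub>"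
        by (auto simp: L_sel L_add M.l_neg)
      then show "\<exists>y\<in>carrier L. y \<oplus>\<^bsub>L\<^esub> x = \<zero>\<^bsub>L\<^esub>" by blast
    qed (auto simp: L_sel L_add M.a_ac)
  qed (auto simp: L_sel L_add L_smult M.smult_l_distr M.smult_r_distr M.smult_assoc1)
  moreover have "g \<in> mod_hom A M L"
    by (auto simp: mod_hom_def L_sel L_add L_smult)
  moreover have "g x = \<zero>\<^bsub>L\<^esub> \<longleftrightarrow> x \<in> K" if "x \<in> carrier M" for x
  proof -
    have "\<ominus>\<^bsub>M\<^esub> \<zero>\<^bsub>M\<^esub> = \<zero>\<^bsub>M\<^esub>" by (metis M.r_neg M.l_zero M.zero_closed M.a_inv_closed)
    then have "x \<ominus>\<^bsub>M\<^esub> \<zero>\<^bsub>M\<^esub> = x" using M.minus_eq[of x "\<zero>\<^bsub>M\<^esub>"] that by (metis M.r_zero)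
    then show ?thesis using g_eq[of "\<zero>\<^bsub>M\<^esub>" x] that by (auto simp: L_sel(2) r_def)
  qed
  ultimately show ?thesis using L_sel(1) by metis
qed

text \<open>The free $R$-module on \<open>J\<close>, as a module over the ring on which \<open>\<pi>\<close> is defined.\<close>

definition free_mod :: "('c \<Rightarrow> 'a) \<Rightarrow> ('a, 'b) ring_scheme \<Rightarrow> 'j set \<Rightarrow> ('c, 'j \<Rightarrow> 'a) module" where
  "free_mod \<pi> R J = \<lparr>carrier = J \<rightarrow>\<^sub>E carrier R, monoid.mult = undefined, one = undefined,
     ring.zero = (\<lambda>j\<in>J. \<zero>\<^bsub>R\<^esub>), add = (\<lambda>v w. \<lambda>j\<in>J. v j \<oplus>\<^bsub>R\<^esub> w j), smult = (\<lambda>a v. \<lambda>j\<in>J. \<pi> a \<otimes>\<^bsub>R\<^esub> v j)\<rparr>"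

lemma free_mod_sel [simp]:
  "carrier (free_mod \<pi> R J) = J \<rightarrow>\<^sub>E carrier R" "\<zero>\<^bsub>free_mod \<pi> R J\<^esub> = (\<lambda>j\<in>J. \<zero>\<^bsub>R\<^esub>)"
  "v \<oplus>\<^bsub>free_mod \<pi> R J\<^esub> w = (\<lambda>j\<in>J. v j \<oplus>\<^bsub>R\<^esub> w j)" "a \<odot>\<^bsub>free_mod \<pi> R J\<^esub> v = (\<lambda>j\<in>J. \<pi> a \<otimes>\<^bsub>R\<^esub> v j)"
  by (simp_all add: free_mod_def)

lemma module_free_mod:
  assumes A: "cring A" and R: "cring R" and h: "\<pi> \<in> ring_hom A R"
  shows "module A (free_mod \<pi> R J)"
proof -
  interpret A: cring A by (rule A)
  interpret R: cring R by (rule R)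
  have hc: "\<pi> a \<in> carrier R" if "a \<in> carrier A" for a using h that by (rule ring_hom_closed)
  show ?thesis
  proof (rule moduleI[OF A])
    show "abelian_group (free_mod \<pi> R J)"
    proof (rule abelian_groupI)
      fix x assume x: "x \<in> carrier (free_mod \<pi> R J)"
      then show "\<exists>y\<in>carrier (free_mod \<pi> R J). y \<oplus>\<^bsub>free_mod \<pi> R J\<^esub> x = \<zero>\<^bsub>free_mod \<pi> R J\<^esub>"
        by (intro bexI[of _ "\<lambda>j\<in>J. \<ominus>\<^bsub>R\<^esub> x j"]) (auto simp: fun_eq_iff R.l_neg PiE_iff)
    qed (auto simp: fun_eq_iff PiE_iff R.a_ac extensional_def)
  qed (auto simp: fun_eq_iff PiE_iff hc R.l_distr R.r_distr R.m_assoc extensional_def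
        ring_hom_mult[OF h] ring_hom_add[OF h] ring_hom_one[OF h])
qed

lemma free_mod_finsum:
  assumes A: "cring A" and R: "cring R" and h: "\<pi> \<in> ring_hom A R"
    and "finite I" "v \<in> I \<rightarrow> (J \<rightarrow>\<^sub>E carrier R)"
  shows "(\<Oplus>\<^bsub>free_mod \<pi> R J\<^esub>i\<in>I. v i) = (\<lambda>j\<in>J. \<Oplus>\<^bsub>R\<^esub>i\<in>I. v i j)"
proof -
  interpret F: module A "free_mod \<pi> R J" by (rule module_free_mod[OF A R h])
  interpret R: cring R by (rule R)
  show ?thesis using assms(4,5)
  proof (induction I)
    case (insert i I)
    then show ?case
      by (subst F.finsum_insert) (auto simp: fun_eq_iff Pi_iff PiE_iff intro!: R.finsum_insert[symmetric])
  qed simp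
qed

lemma inj_on_finite_PiE:
  fixes emb :: "'a \<Rightarrow> 'u"
  assumes inf: "infinite (UNIV :: 'u set)" and emb: "inj_on emb D" and "finite J"
  shows "\<exists>e :: ('j \<Rightarrow> 'a) \<Rightarrow> 'u. inj_on e (J \<rightarrow>\<^sub>E D)"
  using \<open>finite J\<close>
proof (induction J)
  case empty
  show ?case by (intro exI[of _ undefined]) (simp add: inj_on_def)
next
  case (insert j J)
  then obtain e :: "('j \<Rightarrow> 'a) \<Rightarrow> 'u" where e: "inj_on e (J \<rightarrow>\<^sub>E D)" by blast
  obtain pr :: "'u \<times> 'u \<Rightarrow> 'u" where pr: "bij pr"
    using card_of_Times_same_infinite[OF inf] card_of_ordIso[of "UNIV \<times> (UNIV :: 'u set)" "UNIV :: 'u set"] by auto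
  have "inj_on (\<lambda>v. pr (emb (v j), e (restrict v J))) (insert j J \<rightarrow>\<^sub>E D)"
  proof (rule inj_onI)
    fix v w assume v: "v \<in> insert j J \<rightarrow>\<^sub>E D" and w: "w \<in> insert j J \<rightarrow>\<^sub>E D"
      and eq: "pr (emb (v j), e (restrict v J)) = pr (emb (w j), e (restrict w J))"
    then have "emb (v j) = emb (w j)" "e (restrict v J) = e (restrict w J)"
      using bij_is_inj[OF pr] by (auto dest: injD)
    moreover have "restrict v J \<in> J \<rightarrow>\<^sub>E D" "restrict w J \<in> J \<rightarrow>\<^sub>E D" "v j \<in> D" "w j \<in> D"
      using v w by auto
    ultimately have 1: "v j = w j" "restrict v J = restrict w J"
      using inj_onD[OF e] inj_onD[OF emb] by blast+
    show "v = w"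
    proof (rule PiE_ext[OF v w])
      fix i assume "i \<in> insert j J"
      then show "v i = w i" using 1(1) fun_cong[OF 1(2), of i] by (auto split: if_splits)
    qed
  qed
  then show ?case by blast
qed

section \<open>Tensor products\<close>

abbreviation tens_free :: "('c, 'l, 'e) module_scheme \<Rightarrow> ('c, 'x, 'f) module_scheme \<Rightarrow> ('l \<times> 'x \<Rightarrow>\<^sub>0 int) monoid" where
  "tens_free L M \<equiv> free_Abelian_group (carrier L \<times> carrier M)"

text \<open>The map that \<open>f\<close> induces before passing to cosets.\<close>

definition tens_lift :: "('x \<Rightarrow> 'y) \<Rightarrow> ('l \<times> 'x \<Rightarrow>\<^sub>0 int) \<Rightarrow> ('l \<times> 'y \<Rightarrow>\<^sub>0 int)" where
  "tens_lift f = frag_extend (\<lambda>(l, x). frag_of (l, f x))"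

lemma keys_minus_subset: "Poly_Mapping.keys a \<subseteq> S \<Longrightarrow> Poly_Mapping.keys b \<subseteq> S \<Longrightarrow> Poly_Mapping.keys (a - b) \<subseteq> S"
  using keys_diff[of a b] by blast

lemma tensor_relsE:
  assumes "t \<in> tensor_rels A L M"
  obtains l l' x where "t = frag_of (l \<oplus>\<^bsub>L\<^esub> l', x) - frag_of (l, x) - frag_of (l', x)"
      "l \<in> carrier L" "l' \<in> carrier L" "x \<in> carrier M"
  | l x x' where "t = frag_of (l, x \<oplus>\<^bsub>M\<^esub> x') - frag_of (l, x) - frag_of (l, x')"
      "l \<in> carrier L" "x \<in> carrier M" "x' \<in> carrier M"
  | a l x where "t = frag_of (a \<odot>\<^bsub>L\<^esub> l, x) - frag_of (l, a \<odot>\<^bsub>M\<^esub> x)"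
      "a \<in> carrier A" "l \<in> carrier L" "x \<in> carrier M"
  using assms unfolding tensor_rels_def by blast

lemma tensor_rels_subset:
  assumes "module A L" "module A M"
  shows "tensor_rels A L M \<subseteq> carrier (tens_free L M)"
proof -
  interpret L: module A L by fact
  interpret M: module A M by fact
  show ?thesis
  proof
    fix t assume "t \<in> tensor_rels A L M"
    then show "t \<in> carrier (tens_free L M)"
      unfolding carrier_free_Abelian_group_iff
      by (cases rule: tensor_relsE) (simp_all add: keys_minus_subset)
  qed
qed

lemma tensor_null_subgroup:
  assumes "module A L" "module A M"
  shows "subgroup (tensor_null A L M) (tens_free L M)"
  unfolding tensor_null_def
  by (rule group.generate_is_subgroup[OF group_free_Abelian_group tensor_rels_subset[OF assms]])

lemma free_subgroup_ops:
  assumes "subgroup H (free_Abelian_group S)"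
  shows "0 \<in> H" "x \<in> H \<Longrightarrow> y \<in> H \<Longrightarrow> x + y \<in> H" "x \<in> H \<Longrightarrow> - x \<in> H" "x \<in> H \<Longrightarrow> y \<in> H \<Longrightarrow> x - y \<in> H"
    "x \<in> H \<Longrightarrow> Poly_Mapping.keys x \<subseteq> S" "(\<And>i. i \<in> I \<Longrightarrow> f i \<in> H) \<Longrightarrow> sum f I \<in> H"
proof -
  interpret H: subgroup H "free_Abelian_group S" by fact
  show zero: "0 \<in> H" using H.one_closed by simp
  show add: "x + y \<in> H" if "x \<in> H" "y \<in> H" for x y using H.m_closed[OF that] by simp
  show keys: "Poly_Mapping.keys x \<subseteq> S" if "x \<in> H" for x using H.mem_carrier[OF that] by simp
  show neg: "- x \<in> H" if "x \<in> H" for x using H.m_inv_closed[OF that] keys[OF that] by simp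
  show "x - y \<in> H" if "x \<in> H" "y \<in> H" for x y using add[OF that(1) neg[OF that(2)]] by simp
  show "(\<And>i. i \<in> I \<Longrightarrow> f i \<in> H) \<Longrightarrow> sum f I \<in> H"
    by (induction I rule: infinite_finite_induct) (auto simp: zero add)
qed

lemma free_coset_eq_iff:
  assumes H: "subgroup H (free_Abelian_group S)"
  shows "H #>\<^bsub>free_Abelian_group S\<^esub> a = H #>\<^bsub>free_Abelian_group S\<^esub> b \<longleftrightarrow> a - b \<in> H"
proof -
  note ops = free_subgroup_ops[OF H]
  have coset: "H #>\<^bsub>free_Abelian_group S\<^esub> a = {x. x - a \<in> H}" for a
    by (force simp: r_coset_def free_Abelian_group_def)
  show ?thesis
  proof
    assume "H #>\<^bsub>free_Abelian_group S\<^esub> a = H #>\<^bsub>free_Abelian_group S\<^esub> b"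
    then have "a \<in> {x. x - b \<in> H}" using ops(1) unfolding coset by (metis cancel_comm_monoid_add_class.diff_cancel mem_Collect_eq)
    then show "a - b \<in> H" by simp
  next
    assume ab: "a - b \<in> H"
    have "x - a \<in> H \<longleftrightarrow> x - b \<in> H" for x
      using ops(2)[of "x - a" "a - b"] ops(4)[of "x - b" "a - b"] ab by auto
    then show "H #>\<^bsub>free_Abelian_group S\<^esub> a = H #>\<^bsub>free_Abelian_group S\<^esub> b" unfolding coset by simp
  qed
qed

lemma tens_lift_ops [simp]:
  "tens_lift f 0 = 0" "tens_lift f (a + b) = tens_lift f a + tens_lift f b" "tens_lift f (- a) = - tens_lift f a"
  "tens_lift f (a - b) = tens_lift f a - tens_lift f b" "tens_lift f (frag_of (l, x)) = frag_of (l, f x)"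
  by (simp_all add: tens_lift_def frag_extend_add frag_extend_diff frag_extend_minus)

lemma tens_lift_sum: "finite I \<Longrightarrow> tens_lift f (sum g I) = (\<Sum>i\<in>I. tens_lift f (g i))"
  by (induction I rule: finite_induct) auto

lemma tensor_rels_in_null: "x \<in> tensor_rels A L M \<Longrightarrow> x \<in> tensor_null A L M"
  unfolding tensor_null_def by (rule generate.incl)

lemma tensor_null_add_left:
  "l \<in> carrier L \<Longrightarrow> l' \<in> carrier L \<Longrightarrow> x \<in> carrier M \<Longrightarrow>
    frag_of (l \<oplus>\<^bsub>L\<^esub> l', x) - frag_of (l, x) - frag_of (l', x) \<in> tensor_null A L M"
  by (rule tensor_rels_in_null) (unfold tensor_rels_def, blast)

lemma tensor_null_add_right:
  "l \<in> carrier L \<Longrightarrow> x \<in> carrier M \<Longrightarrow> x' \<in> carrier M \<Longrightarrow>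
    frag_of (l, x \<oplus>\<^bsub>M\<^esub> x') - frag_of (l, x) - frag_of (l, x') \<in> tensor_null A L M"
  by (rule tensor_rels_in_null) (unfold tensor_rels_def, blast)

lemma tensor_null_balanced:
  "a \<in> carrier A \<Longrightarrow> l \<in> carrier L \<Longrightarrow> x \<in> carrier M \<Longrightarrow>
    frag_of (a \<odot>\<^bsub>L\<^esub> l, x) - frag_of (l, a \<odot>\<^bsub>M\<^esub> x) \<in> tensor_null A L M"
  by (rule tensor_rels_in_null) (unfold tensor_rels_def, blast)

lemma tens_lift_null:
  assumes L: "module A L" and M: "module A M" and N: "module A N" and f: "f \<in> mod_hom A M N"
    and "t \<in> tensor_null A L M"
  shows "tens_lift f t \<in> tensor_null A L N"
proof -
  interpret L: module A L by fact
  interpret M: module A M by fact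
  note ops = free_subgroup_ops[OF tensor_null_subgroup[OF L N]]
  note keys = free_subgroup_ops(5)[OF tensor_null_subgroup[OF L M], unfolded tensor_null_def]
  have rel: "tens_lift f h \<in> tensor_null A L N" if "h \<in> tensor_rels A L M" for h
    using that
    by (cases rule: tensor_relsE)
      (simp_all add: mod_homD[OF f] tensor_null_add_left tensor_null_add_right tensor_null_balanced)
  show ?thesis
    using assms(5) unfolding tensor_null_def
  proof (induction t rule: generate.induct)
    case one
    then show ?case using ops(1) by (simp add: tensor_null_def)
  next
    case (incl h)
    then show ?case using rel by (simp add: tensor_null_def)
  next
    case (inv h)
    moreover have "Poly_Mapping.keys h \<subseteq> carrier L \<times> carrier M"
      using subsetD[OF tensor_rels_subset[OF L M] inv] by simp
    ultimately show ?case using ops(3)[OF rel] by (simp add: tensor_null_def)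
  next
    case (eng h1 h2)
    then show ?case using ops(2) by (simp add: tensor_null_def)
  qed
qed

lemma tensor_map_coset:
  assumes L: "module A L" and M: "module A M" and N: "module A N" and f: "f \<in> mod_hom A M N"
  shows "tensor_map A L N f (tensor_null A L M #>\<^bsub>tens_free L M\<^esub> t) =
    tensor_null A L N #>\<^bsub>tens_free L N\<^esub> tens_lift f t"
proof -
  let ?T = "tensor_null A L M #>\<^bsub>tens_free L M\<^esub> t"
  note ops = free_subgroup_ops[OF tensor_null_subgroup[OF L M]]
  have "tensor_null A L N #>\<^bsub>tens_free L N\<^esub> tens_lift f s = tensor_null A L N #>\<^bsub>tens_free L N\<^esub> tens_lift f t"
    if "s \<in> ?T" for s
  proof -
    have "s - t \<in> tensor_null A L M" using that by (auto simp: r_coset_def)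
    from tens_lift_null[OF L M N f this] show ?thesis
      by (simp add: free_coset_eq_iff[OF tensor_null_subgroup[OF L N]])
  qed
  moreover have "t \<in> ?T" using ops(1) by (force simp: r_coset_def)
  ultimately have "(\<lambda>s. tensor_null A L N #>\<^bsub>tens_free L N\<^esub> tens_lift f s) ` ?T =
      {tensor_null A L N #>\<^bsub>tens_free L N\<^esub> tens_lift f t}"
    by blast
  then show ?thesis unfolding tensor_map_def tens_lift_def by simp
qed

text \<open>The cosets disappear: injectivity says that the induced map on free abelian groups reflects membership in the
group of relations.\<close>

lemma inj_on_tensor_map_iff:
  assumes L: "module A L" and M: "module A M" and N: "module A N" and f: "f \<in> mod_hom A M N"
  shows "inj_on (tensor_map A L N f) (carrier (tensor A L M)) \<longleftrightarrow>
    (\<forall>t. Poly_Mapping.keys t \<subseteq> carrier L \<times> carrier M \<longrightarrow> tens_lift f t \<in> tensor_null A L N \<longrightarrow> t \<in> tensor_null A L M)"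
    (is "?inj \<longleftrightarrow> ?ker")
proof -
  let ?c = "\<lambda>t. tensor_null A L M #>\<^bsub>tens_free L M\<^esub> t"
  have carr: "carrier (tensor A L M) = {?c t | t. Poly_Mapping.keys t \<subseteq> carrier L \<times> carrier M}"
    by (auto simp: tensor_def FactGroup_def RCOSETS_def)
  note eq = free_coset_eq_iff[OF tensor_null_subgroup[OF L M]] free_coset_eq_iff[OF tensor_null_subgroup[OF L N]]
  show ?thesis
  proof
    assume inj: ?inj
    show ?ker
    proof (intro allI impI)
      fix t assume t: "Poly_Mapping.keys t \<subseteq> carrier L \<times> carrier M" "tens_lift f t \<in> tensor_null A L N"
      have "tensor_map A L N f (?c t) = tensor_map A L N f (?c 0)"
        using t by (simp add: tensor_map_coset[OF L M N f] eq)
      moreover have "?c t \<in> carrier (tensor A L M)" "?c 0 \<in> carrier (tensor A L M)"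
        unfolding carr using t by (blast, force)
      ultimately have "?c t = ?c 0" using inj by (meson inj_onD)
      then show "t \<in> tensor_null A L M" by (simp add: eq)
    qed
  next
    assume ker: ?ker
    show ?inj
    proof (rule inj_onI)
      fix S T assume S: "S \<in> carrier (tensor A L M)" and T: "T \<in> carrier (tensor A L M)"
        and ST: "tensor_map A L N f S = tensor_map A L N f T"
      obtain s t where st: "S = ?c s" "T = ?c t"
          "Poly_Mapping.keys s \<subseteq> carrier L \<times> carrier M" "Poly_Mapping.keys t \<subseteq> carrier L \<times> carrier M"
        using S T unfolding carr by blast
      then have "tens_lift f (s - t) \<in> tensor_null A L N"
        using ST by (simp add: tensor_map_coset[OF L M N f] eq)
      moreover have "Poly_Mapping.keys (s - t) \<subseteq> carrier L \<times> carrier M" using st keys_minus_subset by blast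
      ultimately show "S = T" using ker st by (simp add: eq)
    qed
  qed
qed

lemma retract_imp_pure_hom:
  assumes M: "module A M" and N: "module A N" and f: "f \<in> mod_hom A M N" and g: "g \<in> mod_hom A N M"
    and gf: "\<And>x. x \<in> carrier M \<Longrightarrow> g (f x) = x"
  shows "pure_hom U A M N f"
  unfolding pure_hom_def
proof (intro conjI f allI impI)
  fix L :: "('a, 'g) module" assume L: "module A L"
  have inv: "tens_lift g (tens_lift f t) = t" if "Poly_Mapping.keys t \<subseteq> carrier L \<times> carrier M" for t
    using that by (induction t rule: frag_induction) (auto simp: gf)
  show "inj_on (tensor_map A L N f) (carrier (tensor A L M))"
    unfolding inj_on_tensor_map_iff[OF L M N f]
    using tens_lift_null[OF L N M g] inv by metis
qed

lemma tensor_null_zero_right: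
  assumes "module A L" "module A M" "l \<in> carrier L"
  shows "frag_of (l, \<zero>\<^bsub>M\<^esub>) \<in> tensor_null A L M"
proof -
  interpret M: module A M by fact
  have "frag_of (l, \<zero>\<^bsub>M\<^esub> \<oplus>\<^bsub>M\<^esub> \<zero>\<^bsub>M\<^esub>) - frag_of (l, \<zero>\<^bsub>M\<^esub>) - frag_of (l, \<zero>\<^bsub>M\<^esub>) \<in> tensor_null A L M"
    by (rule tensor_null_add_right) (use assms(3) in auto)
  then show ?thesis
    using free_subgroup_ops(3)[OF tensor_null_subgroup[OF assms(1,2)]] by fastforce
qed

lemma tensor_null_zero_left:
  assumes "module A L" "module A M" "x \<in> carrier M"
  shows "frag_of (\<zero>\<^bsub>L\<^esub>, x) \<in> tensor_null A L M"
proof -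
  interpret L: module A L by fact
  have "frag_of (\<zero>\<^bsub>L\<^esub> \<oplus>\<^bsub>L\<^esub> \<zero>\<^bsub>L\<^esub>, x) - frag_of (\<zero>\<^bsub>L\<^esub>, x) - frag_of (\<zero>\<^bsub>L\<^esub>, x) \<in> tensor_null A L M"
    by (rule tensor_null_add_left) (use assms(3) in auto)
  then show ?thesis
    using free_subgroup_ops(3)[OF tensor_null_subgroup[OF assms(1,2)]] by fastforce
qed

lemma tensor_null_sum_right:
  assumes L: "module A L" and M: "module A M" and l: "l \<in> carrier L" and "finite I" "q \<in> I \<rightarrow> carrier M"
  shows "frag_of (l, \<Oplus>\<^bsub>M\<^esub>i\<in>I. q i) - (\<Sum>i\<in>I. frag_of (l, q i)) \<in> tensor_null A L M"
  using assms(4,5)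
proof (induction I)
  case empty
  interpret M: module A M by fact
  show ?case using tensor_null_zero_right[OF L M l] by simp
next
  case (insert i I)
  interpret M: module A M by fact
  let ?s = "\<Oplus>\<^bsub>M\<^esub>i\<in>I. q i"
  have "frag_of (l, q i \<oplus>\<^bsub>M\<^esub> ?s) - frag_of (l, q i) - frag_of (l, ?s) \<in> tensor_null A L M"
    using l insert by (intro tensor_null_add_right) auto
  moreover have "frag_of (l, ?s) - (\<Sum>i\<in>I. frag_of (l, q i)) \<in> tensor_null A L M"
    using insert by auto
  ultimately have "(frag_of (l, q i \<oplus>\<^bsub>M\<^esub> ?s) - frag_of (l, q i) - frag_of (l, ?s)) +
      (frag_of (l, ?s) - (\<Sum>i\<in>I. frag_of (l, q i))) \<in> tensor_null A L M"
    by (rule free_subgroup_ops(2)[OF tensor_null_subgroup[OF L M]])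
  then show ?case using insert by (simp add: Pi_iff algebra_simps)
qed

lemma tensor_null_sum_left:
  assumes L: "module A L" and M: "module A M" and x: "x \<in> carrier M" and "finite I" "q \<in> I \<rightarrow> carrier L"
  shows "frag_of (\<Oplus>\<^bsub>L\<^esub>i\<in>I. q i, x) - (\<Sum>i\<in>I. frag_of (q i, x)) \<in> tensor_null A L M"
  using assms(4,5)
proof (induction I)
  case empty
  interpret L: module A L by fact
  show ?case using tensor_null_zero_left[OF L M x] by simp
next
  case (insert i I)
  interpret L: module A L by fact
  let ?s = "\<Oplus>\<^bsub>L\<^esub>i\<in>I. q i"
  have "frag_of (q i \<oplus>\<^bsub>L\<^esub> ?s, x) - frag_of (q i, x) - frag_of (?s, x) \<in> tensor_null A L M"
    using x insert by (intro tensor_null_add_left) auto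
  moreover have "frag_of (?s, x) - (\<Sum>i\<in>I. frag_of (q i, x)) \<in> tensor_null A L M"
    using insert by auto
  ultimately have "(frag_of (q i \<oplus>\<^bsub>L\<^esub> ?s, x) - frag_of (q i, x) - frag_of (?s, x)) +
      (frag_of (?s, x) - (\<Sum>i\<in>I. frag_of (q i, x))) \<in> tensor_null A L M"
    by (rule free_subgroup_ops(2)[OF tensor_null_subgroup[OF L M]])
  then show ?case using insert by (simp add: Pi_iff algebra_simps)
qed

text \<open>If the vectors \<open>u\<^sub>j\<close> satisfy \<open>\<Sum>\<^sub>j c\<^sub>j\<^sub>i u\<^sub>j = 0\<close> for all $i$, then
\<open>\<Sum>\<^sub>j u\<^sub>j \<otimes> \<Sum>\<^sub>i c\<^sub>j\<^sub>i q\<^sub>i = \<Sum>\<^sub>i (\<Sum>\<^sub>j c\<^sub>j\<^sub>i u\<^sub>j) \<otimes> q\<^sub>i = 0\<close>.\<close>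

lemma tensor_null_relations:
  assumes L: "module A L" and N: "module A N" and I: "finite I" and J: "finite J"
    and c: "\<And>j i. j \<in> J \<Longrightarrow> i \<in> I \<Longrightarrow> c j i \<in> carrier A" and q: "q \<in> I \<rightarrow> carrier N"
    and u: "u \<in> J \<rightarrow> carrier L" and rel: "\<And>i. i \<in> I \<Longrightarrow> (\<Oplus>\<^bsub>L\<^esub>j\<in>J. c j i \<odot>\<^bsub>L\<^esub> u j) = \<zero>\<^bsub>L\<^esub>"
  shows "(\<Sum>j\<in>J. frag_of (u j, \<Oplus>\<^bsub>N\<^esub>i\<in>I. c j i \<odot>\<^bsub>N\<^esub> q i)) \<in> tensor_null A L N"
proof -
  interpret L: module A L by fact
  interpret N: module A N by fact
  note ops = free_subgroup_ops[OF tensor_null_subgroup[OF L N]]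
  have 1: "(\<Sum>j\<in>J. frag_of (u j, \<Oplus>\<^bsub>N\<^esub>i\<in>I. c j i \<odot>\<^bsub>N\<^esub> q i) - (\<Sum>i\<in>I. frag_of (u j, c j i \<odot>\<^bsub>N\<^esub> q i))) \<in> tensor_null A L N"
    using c q u I by (intro ops(6) tensor_null_sum_right L N) auto
  have 2: "(\<Sum>j\<in>J. \<Sum>i\<in>I. frag_of (c j i \<odot>\<^bsub>L\<^esub> u j, q i) - frag_of (u j, c j i \<odot>\<^bsub>N\<^esub> q i)) \<in> tensor_null A L N"
    using c q u by (intro ops(6) tensor_null_balanced) auto
  have 3: "(\<Sum>i\<in>I. frag_of (\<Oplus>\<^bsub>L\<^esub>j\<in>J. c j i \<odot>\<^bsub>L\<^esub> u j, q i) - (\<Sum>j\<in>J. frag_of (c j i \<odot>\<^bsub>L\<^esub> u j, q i))) \<in> tensor_null A L N"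
    using c q u J by (intro ops(6) tensor_null_sum_left L N) auto
  have 4: "(\<Sum>i\<in>I. frag_of (\<Oplus>\<^bsub>L\<^esub>j\<in>J. c j i \<odot>\<^bsub>L\<^esub> u j, q i)) \<in> tensor_null A L N"
    using q rel by (intro ops(6)) (auto intro!: tensor_null_zero_left[OF L N])
  have swap: "(\<Sum>j\<in>J. \<Sum>i\<in>I. frag_of (c j i \<odot>\<^bsub>L\<^esub> u j, q i)) = (\<Sum>i\<in>I. \<Sum>j\<in>J. frag_of (c j i \<odot>\<^bsub>L\<^esub> u j, q i))"
    by (rule sum.swap)
  show ?thesis
    using ops(4)[OF ops(2)[OF 1 4] ops(2)[OF 2 3]] by (simp add: sum_subtractf swap)
qed

text \<open>The universal property of the tensor product, in the form in which it detects elements that are not zero.\<close>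

lemma bilinear_kills_null:
  assumes L: "module A L" and M: "module A M" and P: "abelian_group P"
    and b: "\<And>l x. l \<in> carrier L \<Longrightarrow> x \<in> carrier M \<Longrightarrow> b l x \<in> carrier P"
    and b1: "\<And>l l' x. l \<in> carrier L \<Longrightarrow> l' \<in> carrier L \<Longrightarrow> x \<in> carrier M \<Longrightarrow> b (l \<oplus>\<^bsub>L\<^esub> l') x = b l x \<oplus>\<^bsub>P\<^esub> b l' x"
    and b2: "\<And>l x x'. l \<in> carrier L \<Longrightarrow> x \<in> carrier M \<Longrightarrow> x' \<in> carrier M \<Longrightarrow> b l (x \<oplus>\<^bsub>M\<^esub> x') = b l x \<oplus>\<^bsub>P\<^esub> b l x'"
    and b3: "\<And>a l x. a \<in> carrier A \<Longrightarrow> l \<in> carrier L \<Longrightarrow> x \<in> carrier M \<Longrightarrow> b (a \<odot>\<^bsub>L\<^esub> l) x = b l (a \<odot>\<^bsub>M\<^esub> x)"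
    and J: "finite J" and u: "u \<in> J \<rightarrow> carrier L" and v: "v \<in> J \<rightarrow> carrier M"
    and null: "(\<Sum>j\<in>J. frag_of (u j, v j)) \<in> tensor_null A L M"
  shows "(\<Oplus>\<^bsub>P\<^esub>j\<in>J. b (u j) (v j)) = \<zero>\<^bsub>P\<^esub>"
proof -
  interpret L: module A L by fact
  interpret M: module A M by fact
  interpret P: abelian_group P by fact
  let ?F = "tens_free L M"
  have img: "(\<lambda>(l, x). b l x) ` (carrier L \<times> carrier M) \<subseteq> carrier (add_monoid P)" using b by auto
  obtain h where h: "h \<in> hom ?F (add_monoid P)"
    and hof: "\<And>z. z \<in> carrier L \<times> carrier M \<Longrightarrow> h (frag_of z) = (\<lambda>(l, x). b l x) z"
    using P.a_comm_group comm_group.free_Abelian_group_universal[OF _ img] by blast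
  interpret h: group_hom ?F "add_monoid P" h
    using h by (simp add: group_hom_def group_hom_axioms_def P.a_group)
  have add: "h (s + t) = h s \<oplus>\<^bsub>P\<^esub> h t" if "Poly_Mapping.keys s \<subseteq> carrier L \<times> carrier M" "Poly_Mapping.keys t \<subseteq> carrier L \<times> carrier M" for s t
    using h.hom_mult[of s t] that by simp
  have hc: "h s \<in> carrier P" if "Poly_Mapping.keys s \<subseteq> carrier L \<times> carrier M" for s
    using h.hom_closed[of s] that by simp
  have zero: "h 0 = \<zero>\<^bsub>P\<^esub>" using h.hom_one by simp
  have neg: "h (- s) = \<ominus>\<^bsub>P\<^esub> h s" if "Poly_Mapping.keys s \<subseteq> carrier L \<times> carrier M" for s
    using h.hom_inv[of s] that by (simp add: a_inv_def)
  have diff: "h (s - t) = h s \<ominus>\<^bsub>P\<^esub> h t" if "Poly_Mapping.keys s \<subseteq> carrier L \<times> carrier M" "Poly_Mapping.keys t \<subseteq> carrier L \<times> carrier M" for s t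
    using add[of s "- t"] neg[of t] that by (simp add: P.minus_eq)
  have cancel: "u \<oplus>\<^bsub>P\<^esub> v \<ominus>\<^bsub>P\<^esub> u \<ominus>\<^bsub>P\<^esub> v = \<zero>\<^bsub>P\<^esub>" if "u \<in> carrier P" "v \<in> carrier P" for u v
  proof -
    have "u \<oplus>\<^bsub>P\<^esub> v \<ominus>\<^bsub>P\<^esub> u = v" using that by (simp add: P.minus_eq P.a_comm[of u v] P.a_assoc P.r_neg)
    then show ?thesis using that by (simp add: P.minus_eq P.r_neg)
  qed
  have rel: "h t = \<zero>\<^bsub>P\<^esub>" if "t \<in> tensor_rels A L M" for t
    using that
    by (cases rule: tensor_relsE)
      (simp_all add: diff keys_minus_subset hof b b1 b2 b3 cancel P.minus_eq[of "b _ _" "b _ _"] P.r_neg)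
  have "h t = \<zero>\<^bsub>P\<^esub> \<and> Poly_Mapping.keys t \<subseteq> carrier L \<times> carrier M" if "t \<in> tensor_null A L M" for t
    using that unfolding tensor_null_def
  proof (induction t rule: generate.induct)
    case one
    then show ?case by (simp add: zero)
  next
    case (incl t)
    then show ?case using rel subsetD[OF tensor_rels_subset[OF L M] incl] by simp
  next
    case (inv t)
    have "Poly_Mapping.keys t \<subseteq> carrier L \<times> carrier M"
      using subsetD[OF tensor_rels_subset[OF L M] inv] by simp
    then show ?case using rel[OF inv] by (simp add: neg)
  next
    case (eng s t)
    then show ?case using keys_add[of s t] by (auto simp: add)
  qed
  moreover have "h (\<Sum>j\<in>J. frag_of (u j, v j)) = (\<Oplus>\<^bsub>P\<^esub>j\<in>J. b (u j) (v j))"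
    using J u v
  proof (induction J)
    case (insert j J)
    have "Poly_Mapping.keys (\<Sum>j\<in>J. frag_of (u j, v j)) \<subseteq> carrier L \<times> carrier M"
      using insert.prems sum_closed_free_Abelian_group[of J "\<lambda>j. frag_of (u j, v j)" "carrier L \<times> carrier M"]
      by (auto simp: Pi_iff)
    then show ?case using insert by (simp add: add hof Pi_iff b)
  qed (simp add: zero)
  ultimately show ?thesis using null by auto
qed

text \<open>The test module \<open>L\<close> is the free $R$-module on the equations modulo the columns of the coefficient matrix.
With the classes \<open>g(\<delta> j)\<close> of the basis vectors, \<open>\<Sum>\<^sub>j g(\<delta> j) \<otimes> b\<^sub>j\<close> goes to zero in \<open>L \<otimes> N\<close>, because the system has
the solution \<open>q\<close> there and the columns vanish in \<open>L\<close>.  By purity it is zero in \<open>L \<otimes> R = L\<close>, so the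
right-hand side is a combination of the columns, whose coefficients solve the system in $R$.\<close>

lemma pure_hom_solves_system:
  fixes emb :: "'a \<Rightarrow> 'u" and A :: "('c, 'd) ring_scheme" and R :: "('a, 'b) ring_scheme" and J :: "'j set"
  assumes A: "cring A" and R: "cring R" and \<pi>: "\<pi> \<in> ring_hom A R" "\<pi> ` carrier A = carrier R"
    and N: "module A N" and pure: "pure_hom TYPE('u) A (module_via \<pi> R) N f"
    and inf: "infinite (UNIV :: 'u set)" and emb: "inj_on emb (carrier R)"
    and I: "finite I" and J: "finite J"
    and c: "\<And>j i. j \<in> J \<Longrightarrow> i \<in> I \<Longrightarrow> c j i \<in> carrier A" and b: "b \<in> J \<rightarrow> carrier R"
    and q: "q \<in> I \<rightarrow> carrier N" and eq: "\<And>j. j \<in> J \<Longrightarrow> (\<Oplus>\<^bsub>N\<^esub>i\<in>I. c j i \<odot>\<^bsub>N\<^esub> q i) = f (b j)"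
  shows "\<exists>y\<in>I \<rightarrow> carrier R. \<forall>j\<in>J. (\<Oplus>\<^bsub>R\<^esub>i\<in>I. \<pi> (c j i) \<otimes>\<^bsub>R\<^esub> y i) = b j"
proof -
  interpret A: cring A by (rule A)
  interpret R: cring R by (rule R)
  have hc [simp]: "\<pi> a \<in> carrier R" if "a \<in> carrier A" for a using \<pi>(1) that by (rule ring_hom_closed)
  let ?M = "module_via \<pi> R" and ?F = "free_mod \<pi> R J :: ('c, 'j \<Rightarrow> 'a) module"
  have M: "module A ?M" by (rule module_module_via[OF A R \<pi>(1)])
  have F: "module A ?F" by (rule module_free_mod[OF A R \<pi>(1)])
  interpret F: module A ?F by (rule F)
  define col where "col y = (\<lambda>j\<in>J. \<Oplus>\<^bsub>R\<^esub>i\<in>I. \<pi> (c j i) \<otimes>\<^bsub>R\<^esub> y i)" for y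
  define K where "K = col ` (I \<rightarrow> carrier R)"
  have terms: "(\<lambda>i. \<pi> (c j i) \<otimes>\<^bsub>R\<^esub> y i) \<in> I \<rightarrow> carrier R" if "j \<in> J" "y \<in> I \<rightarrow> carrier R" for j y
    using that c by auto
  have Ksub: "K \<subseteq> carrier ?F" using terms by (auto simp: K_def col_def intro!: R.finsum_closed)
  have "col (\<lambda>i. \<zero>\<^bsub>R\<^esub>) = \<zero>\<^bsub>?F\<^esub>" using c by (auto simp: col_def fun_eq_iff intro!: R.add.finprod_one_eqI)
  then have K0: "\<zero>\<^bsub>?F\<^esub> \<in> K" unfolding K_def by (metis R.zero_closed image_eqI Pi_I)
  have Kadd: "x \<oplus>\<^bsub>?F\<^esub> y \<in> K" if xy: "x \<in> K" "y \<in> K" for x y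
  proof -
    obtain v w where v: "v \<in> I \<rightarrow> carrier R" "w \<in> I \<rightarrow> carrier R" "x = col v" "y = col w"
      using xy by (auto simp: K_def)
    have "col v \<oplus>\<^bsub>?F\<^esub> col w = col (\<lambda>i. v i \<oplus>\<^bsub>R\<^esub> w i)"
    proof (unfold col_def free_mod_sel, rule restrict_ext)
      fix j assume j: "j \<in> J"
      have "(\<Oplus>\<^bsub>R\<^esub>i\<in>I. \<pi> (c j i) \<otimes>\<^bsub>R\<^esub> (v i \<oplus>\<^bsub>R\<^esub> w i)) = (\<Oplus>\<^bsub>R\<^esub>i\<in>I. \<pi> (c j i) \<otimes>\<^bsub>R\<^esub> v i \<oplus>\<^bsub>R\<^esub> \<pi> (c j i) \<otimes>\<^bsub>R\<^esub> w i)"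
        using v c j by (intro R.finsum_cong') (auto simp: R.r_distr Pi_iff)
      also have "\<dots> = (\<Oplus>\<^bsub>R\<^esub>i\<in>I. \<pi> (c j i) \<otimes>\<^bsub>R\<^esub> v i) \<oplus>\<^bsub>R\<^esub> (\<Oplus>\<^bsub>R\<^esub>i\<in>I. \<pi> (c j i) \<otimes>\<^bsub>R\<^esub> w i)"
        using terms[OF j] v by (intro R.finsum_addf) auto
      finally show "(\<lambda>j\<in>J. \<Oplus>\<^bsub>R\<^esub>i\<in>I. \<pi> (c j i) \<otimes>\<^bsub>R\<^esub> v i) j \<oplus>\<^bsub>R\<^esub> (\<lambda>j\<in>J. \<Oplus>\<^bsub>R\<^esub>i\<in>I. \<pi> (c j i) \<otimes>\<^bsub>R\<^esub> w i) j =
          (\<Oplus>\<^bsub>R\<^esub>i\<in>I. \<pi> (c j i) \<otimes>\<^bsub>R\<^esub> (v i \<oplus>\<^bsub>R\<^esub> w i))" using j by simp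
    qed
    moreover have "(\<lambda>i. v i \<oplus>\<^bsub>R\<^esub> w i) \<in> I \<rightarrow> carrier R" using v by auto
    ultimately show ?thesis unfolding K_def v by blast
  qed
  have Ksmult: "a \<odot>\<^bsub>?F\<^esub> x \<in> K" if a: "a \<in> carrier A" and x: "x \<in> K" for a x
  proof -
    obtain v where v: "v \<in> I \<rightarrow> carrier R" "x = col v" using x by (auto simp: K_def)
    have "a \<odot>\<^bsub>?F\<^esub> col v = col (\<lambda>i. \<pi> a \<otimes>\<^bsub>R\<^esub> v i)"
    proof (unfold col_def free_mod_sel, rule restrict_ext)
      fix j assume j: "j \<in> J"
      have "(\<Oplus>\<^bsub>R\<^esub>i\<in>I. \<pi> (c j i) \<otimes>\<^bsub>R\<^esub> (\<pi> a \<otimes>\<^bsub>R\<^esub> v i)) = (\<Oplus>\<^bsub>R\<^esub>i\<in>I. \<pi> a \<otimes>\<^bsub>R\<^esub> (\<pi> (c j i) \<otimes>\<^bsub>R\<^esub> v i))"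
        using v c j a by (intro R.finsum_cong') (auto simp: R.m_ac Pi_iff)
      also have "\<dots> = \<pi> a \<otimes>\<^bsub>R\<^esub> (\<Oplus>\<^bsub>R\<^esub>i\<in>I. \<pi> (c j i) \<otimes>\<^bsub>R\<^esub> v i)"
        using terms[OF j] v a I by (intro R.finsum_rdistr[symmetric]) auto
      finally show "\<pi> a \<otimes>\<^bsub>R\<^esub> (\<lambda>j\<in>J. \<Oplus>\<^bsub>R\<^esub>i\<in>I. \<pi> (c j i) \<otimes>\<^bsub>R\<^esub> v i) j =
          (\<Oplus>\<^bsub>R\<^esub>i\<in>I. \<pi> (c j i) \<otimes>\<^bsub>R\<^esub> (\<pi> a \<otimes>\<^bsub>R\<^esub> v i))" using j by simp
    qed
    moreover have "(\<lambda>i. \<pi> a \<otimes>\<^bsub>R\<^esub> v i) \<in> I \<rightarrow> carrier R" using v a by auto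
    ultimately show ?thesis unfolding K_def v by blast
  qed
  obtain e :: "('j \<Rightarrow> 'a) \<Rightarrow> 'u" where e: "inj_on e (carrier ?F)"
    using inj_on_finite_PiE[OF inf emb J] by auto
  obtain L :: "('c, 'u) module" and g where L: "module A L" and g: "g \<in> mod_hom A ?F L"
    and gsurj: "g ` carrier ?F = carrier L" and gK: "\<And>x. x \<in> carrier ?F \<Longrightarrow> g x = \<zero>\<^bsub>L\<^esub> \<longleftrightarrow> x \<in> K"
    using exists_quotient_module[OF F Ksub K0 Kadd Ksmult e] by blast
  interpret L: module A L by (rule L)
  define \<delta> where "\<delta> k = (\<lambda>j\<in>J. if j = k then \<one>\<^bsub>R\<^esub> else \<zero>\<^bsub>R\<^esub>)" for k
  have \<delta>: "\<delta> k \<in> carrier ?F" for k by (auto simp: \<delta>_def)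
  have comb: "(\<Oplus>\<^bsub>L\<^esub>j\<in>J. a j \<odot>\<^bsub>L\<^esub> g (\<delta> j)) = g (\<lambda>j\<in>J. \<pi> (a j))" if a: "a \<in> J \<rightarrow> carrier A" for a
  proof -
    have cl: "(\<lambda>j. a j \<odot>\<^bsub>?F\<^esub> \<delta> j) \<in> J \<rightarrow> carrier ?F" using a \<delta> by (intro Pi_I F.smult_closed) auto
    have "(\<Oplus>\<^bsub>L\<^esub>j\<in>J. a j \<odot>\<^bsub>L\<^esub> g (\<delta> j)) = (\<Oplus>\<^bsub>L\<^esub>j\<in>J. g (a j \<odot>\<^bsub>?F\<^esub> \<delta> j))"
    proof (rule L.finsum_cong'[OF refl])
      show "(\<lambda>j. g (a j \<odot>\<^bsub>?F\<^esub> \<delta> j)) \<in> J \<rightarrow> carrier L" using mod_homD(1)[OF g] cl by blast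
      show "a j \<odot>\<^bsub>L\<^esub> g (\<delta> j) = g (a j \<odot>\<^bsub>?F\<^esub> \<delta> j)" if "j \<in> J" for j
        using mod_homD(3)[OF g _ \<delta>, of "a j" j] that a by (simp add: Pi_iff)
    qed
    also have "\<dots> = g (\<Oplus>\<^bsub>?F\<^esub>j\<in>J. a j \<odot>\<^bsub>?F\<^esub> \<delta> j)"
      by (rule mod_hom_finsum[OF F L g J cl, symmetric])
    also have "(\<Oplus>\<^bsub>?F\<^esub>j\<in>J. a j \<odot>\<^bsub>?F\<^esub> \<delta> j) = (\<lambda>k\<in>J. \<Oplus>\<^bsub>R\<^esub>j\<in>J. (a j \<odot>\<^bsub>?F\<^esub> \<delta> j) k)"
      using cl by (intro free_mod_finsum[OF A R \<pi>(1) J]) auto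
    also have "\<dots> = (\<lambda>j\<in>J. \<pi> (a j))"
    proof (rule restrict_ext)
      fix k assume k: "k \<in> J"
      have "(\<Oplus>\<^bsub>R\<^esub>j\<in>J. (a j \<odot>\<^bsub>?F\<^esub> \<delta> j) k) = (\<Oplus>\<^bsub>R\<^esub>j\<in>J. if k = j then \<pi> (a j) else \<zero>\<^bsub>R\<^esub>)"
        using a k by (intro R.finsum_cong') (auto simp: \<delta>_def Pi_iff)
      also have "\<dots> = \<pi> (a k)"
        by (rule R.finsum_singleton[OF k J]) (use a in \<open>auto simp: Pi_iff\<close>)
      finally show "(\<Oplus>\<^bsub>R\<^esub>j\<in>J. (a j \<odot>\<^bsub>?F\<^esub> \<delta> j) k) = \<pi> (a k)" .
    qed
    finally show ?thesis .
  qed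
  have rel: "(\<Oplus>\<^bsub>L\<^esub>j\<in>J. c j i \<odot>\<^bsub>L\<^esub> g (\<delta> j)) = \<zero>\<^bsub>L\<^esub>" if i: "i \<in> I" for i
  proof -
    have "col (\<lambda>k. if i = k then \<one>\<^bsub>R\<^esub> else \<zero>\<^bsub>R\<^esub>) = (\<lambda>j\<in>J. \<pi> (c j i))"
    proof (unfold col_def, rule restrict_ext)
      fix j assume j: "j \<in> J"
      have "(\<Oplus>\<^bsub>R\<^esub>k\<in>I. \<pi> (c j k) \<otimes>\<^bsub>R\<^esub> (if i = k then \<one>\<^bsub>R\<^esub> else \<zero>\<^bsub>R\<^esub>)) = (\<Oplus>\<^bsub>R\<^esub>k\<in>I. if i = k then \<pi> (c j k) else \<zero>\<^bsub>R\<^esub>)"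
        using c j by (intro R.finsum_cong') auto
      also have "\<dots> = \<pi> (c j i)" by (rule R.finsum_singleton[OF i I]) (use c j in auto)
      finally show "(\<Oplus>\<^bsub>R\<^esub>k\<in>I. \<pi> (c j k) \<otimes>\<^bsub>R\<^esub> (if i = k then \<one>\<^bsub>R\<^esub> else \<zero>\<^bsub>R\<^esub>)) = \<pi> (c j i)" .
    qed
    moreover have "col (\<lambda>k. if i = k then \<one>\<^bsub>R\<^esub> else \<zero>\<^bsub>R\<^esub>) \<in> K" unfolding K_def by (rule imageI) auto
    ultimately have "(\<lambda>j\<in>J. \<pi> (c j i)) \<in> K" by simp
    then show ?thesis using comb[of "\<lambda>j. c j i"] c i gK Ksub by auto
  qed
  have f: "f \<in> mod_hom A ?M N" using pure by (simp add: pure_hom_def)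
  have gd: "(\<lambda>j. g (\<delta> j)) \<in> J \<rightarrow> carrier L" using mod_homD(1)[OF g] \<delta> by blast
  let ?t = "\<Sum>j\<in>J. frag_of (g (\<delta> j), b j)"
  have "(\<Sum>j\<in>J. frag_of (g (\<delta> j), \<Oplus>\<^bsub>N\<^esub>i\<in>I. c j i \<odot>\<^bsub>N\<^esub> q i)) \<in> tensor_null A L N"
    by (rule tensor_null_relations[OF L N I J c q gd rel])
  then have "tens_lift f ?t \<in> tensor_null A L N" using eq J by (simp add: tens_lift_sum)
  moreover have "Poly_Mapping.keys ?t \<subseteq> carrier L \<times> carrier ?M"
    using gd b sum_closed_free_Abelian_group[of J "\<lambda>j. frag_of (g (\<delta> j), b j)" "carrier L \<times> carrier ?M"]
    by (auto simp: Pi_iff)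
  ultimately have null: "?t \<in> tensor_null A L ?M"
    using pure L inj_on_tensor_map_iff[OF L M N f] by (auto simp: pure_hom_def)
  (* The identification of L tensor R with L sends (l, r) to a l for any a over r. *)
  define sec where "sec r = (SOME a. a \<in> carrier A \<and> \<pi> a = r)" for r
  have sec: "sec r \<in> carrier A \<and> \<pi> (sec r) = r" if "r \<in> carrier R" for r
  proof -
    from that have "r \<in> \<pi> ` carrier A" by (simp only: \<pi>(2))
    then obtain a where "r = \<pi> a" "a \<in> carrier A" by (rule imageE)
    then show ?thesis unfolding sec_def by (intro someI[of "\<lambda>a. a \<in> carrier A \<and> \<pi> a = r" a]) auto
  qed
  (* L is an R-module: the action of a depends on its image in R only. *)
  have indep: "a \<odot>\<^bsub>L\<^esub> l = a' \<odot>\<^bsub>L\<^esub> l" if a: "a \<in> carrier A" "a' \<in> carrier A" "\<pi> a = \<pi> a'" and l: "l \<in> carrier L" for a a' l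
  proof -
    from l have "l \<in> g ` carrier ?F" by (simp only: gsurj)
    then obtain x where x: "l = g x" "x \<in> carrier ?F" by (rule imageE)
    have eq: "a \<odot>\<^bsub>?F\<^esub> x = a' \<odot>\<^bsub>?F\<^esub> x" using a by simp
    show ?thesis
      unfolding x(1) mod_homD(3)[OF g a(1) x(2), symmetric] mod_homD(3)[OF g a(2) x(2), symmetric] eq ..
  qed
  have "(\<Oplus>\<^bsub>L\<^esub>j\<in>J. sec (b j) \<odot>\<^bsub>L\<^esub> g (\<delta> j)) = \<zero>\<^bsub>L\<^esub>"
  proof (rule bilinear_kills_null[OF L M L.abelian_group_axioms, where b = "\<lambda>l r. sec r \<odot>\<^bsub>L\<^esub> l"])
    fix l r r' assume lr: "l \<in> carrier L" "r \<in> carrier ?M" "r' \<in> carrier ?M"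
    then have "sec (r \<oplus>\<^bsub>R\<^esub> r') \<odot>\<^bsub>L\<^esub> l = (sec r \<oplus>\<^bsub>A\<^esub> sec r') \<odot>\<^bsub>L\<^esub> l"
      by (intro indep) (auto simp: sec ring_hom_add[OF \<pi>(1)])
    then show "sec (r \<oplus>\<^bsub>?M\<^esub> r') \<odot>\<^bsub>L\<^esub> l = sec r \<odot>\<^bsub>L\<^esub> l \<oplus>\<^bsub>L\<^esub> sec r' \<odot>\<^bsub>L\<^esub> l"
      using lr sec by (simp add: L.smult_l_distr)
  next
    fix a l r assume lr: "a \<in> carrier A" "l \<in> carrier L" "r \<in> carrier ?M"
    then have "sec (\<pi> a \<otimes>\<^bsub>R\<^esub> r) \<odot>\<^bsub>L\<^esub> l = (sec r \<otimes>\<^bsub>A\<^esub> a) \<odot>\<^bsub>L\<^esub> l"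
      by (intro indep) (auto simp: sec ring_hom_mult[OF \<pi>(1)] R.m_comm)
    then show "sec r \<odot>\<^bsub>L\<^esub> (a \<odot>\<^bsub>L\<^esub> l) = sec (a \<odot>\<^bsub>?M\<^esub> r) \<odot>\<^bsub>L\<^esub> l"
      using lr sec by (simp add: L.smult_assoc1)
  qed (use sec J gd b null in \<open>auto simp: L.smult_r_distr\<close>)
  moreover have "(\<lambda>j. sec (b j)) \<in> J \<rightarrow> carrier A" using sec b by (auto simp: Pi_iff)
  ultimately have "g (\<lambda>j\<in>J. \<pi> (sec (b j))) = \<zero>\<^bsub>L\<^esub>" using comb by simp
  moreover have "(\<lambda>j\<in>J. \<pi> (sec (b j))) = restrict b J" using sec b by (auto simp: fun_eq_iff Pi_iff)
  ultimately have "restrict b J \<in> K" using gK b by (auto simp: Pi_iff)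
  then obtain y where y: "y \<in> I \<rightarrow> carrier R" "restrict b J = col y" by (auto simp: K_def)
  have "(\<Oplus>\<^bsub>R\<^esub>i\<in>I. \<pi> (c j i) \<otimes>\<^bsub>R\<^esub> y i) = b j" if "j \<in> J" for j
    using fun_cong[OF y(2), of j] that by (simp add: col_def)
  then show ?thesis using y(1) by blast
qed

section \<open>Noetherian local rings\<close>

lemma (in cring) ideal_ops:
  assumes "ideal I R"
  shows "\<zero> \<in> I" "a \<in> I \<Longrightarrow> b \<in> I \<Longrightarrow> a \<oplus> b \<in> I" "a \<in> I \<Longrightarrow> \<ominus> a \<in> I" "a \<in> I \<Longrightarrow> b \<in> I \<Longrightarrow> a \<ominus> b \<in> I"
    "a \<in> I \<Longrightarrow> r \<in> carrier R \<Longrightarrow> r \<otimes> a \<in> I" "a \<in> I \<Longrightarrow> a \<in> carrier R" "I \<subseteq> carrier R"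
proof -
  interpret I: ideal I R by fact
  show "\<zero> \<in> I" "a \<in> I \<Longrightarrow> b \<in> I \<Longrightarrow> a \<oplus> b \<in> I" "a \<in> I \<Longrightarrow> \<ominus> a \<in> I" "a \<in> I \<Longrightarrow> b \<in> I \<Longrightarrow> a \<ominus> b \<in> I"
    "a \<in> I \<Longrightarrow> r \<in> carrier R \<Longrightarrow> r \<otimes> a \<in> I" "a \<in> I \<Longrightarrow> a \<in> carrier R" "I \<subseteq> carrier R"
    using I.a_subset by (auto simp: I.I_l_closed minus_eq)
qed

lemma (in cring) idealI_cring:
  assumes "I \<subseteq> carrier R" "\<zero> \<in> I" "\<And>a b. a \<in> I \<Longrightarrow> b \<in> I \<Longrightarrow> a \<oplus> b \<in> I"
    "\<And>a r. a \<in> I \<Longrightarrow> r \<in> carrier R \<Longrightarrow> r \<otimes> a \<in> I"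
  shows "ideal I R"
proof (rule idealI[OF ring_axioms])
  have neg: "\<ominus> a \<in> I" if "a \<in> I" for a
    using assms(4)[OF that, of "\<ominus> \<one>"] assms(1) that l_minus[of \<one> a] by auto
  show "subgroup I (add_monoid R)"
    by (rule subgroup.intro) (use assms neg in \<open>auto simp flip: a_inv_def\<close>)
  fix a x assume "a \<in> I" "x \<in> carrier R"
  then show "x \<otimes> a \<in> I" "a \<otimes> x \<in> I" using assms(4)[of a x] assms(1) m_comm[of a x] by auto
qed

lemma (in cring) minus_split: "a \<in> carrier R \<Longrightarrow> b \<in> carrier R \<Longrightarrow> c \<in> carrier R \<Longrightarrow> a \<ominus> c = (a \<ominus> b) \<oplus> (b \<ominus> c)"
  by (simp add: minus_eq a_assoc r_neg1)

lemma (in cring) neg_minus: "a \<in> carrier R \<Longrightarrow> b \<in> carrier R \<Longrightarrow> \<ominus> (a \<ominus> b) = b \<ominus> a"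
  by (simp add: minus_eq minus_add a_comm)

lemma (in cring) minus_cancel_right:
  "a \<in> carrier R \<Longrightarrow> b \<in> carrier R \<Longrightarrow> c \<in> carrier R \<Longrightarrow> (a \<ominus> c) \<ominus> (b \<ominus> c) = a \<ominus> b"
  using minus_split[of a c b] neg_minus[of b c] minus_eq[of "a \<ominus> c" "b \<ominus> c"] by simp

lemma (in cring) minus_cancel_left:
  assumes "a \<in> carrier R" "b \<in> carrier R" "c \<in> carrier R" shows "(a \<ominus> b) \<ominus> (a \<ominus> c) = c \<ominus> b"
  using assms minus_split[of c a b] neg_minus[of a c] minus_eq[of "a \<ominus> b" "a \<ominus> c"] a_comm[of "a \<ominus> b" "c \<ominus> a"] by simp

definition adjoin :: "('a, 'b) ring_scheme \<Rightarrow> 'a set \<Rightarrow> 'a \<Rightarrow> 'a set" where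
  "adjoin R I x = {i \<oplus>\<^bsub>R\<^esub> r \<otimes>\<^bsub>R\<^esub> x | i r. i \<in> I \<and> r \<in> carrier R}"

lemma (in cring) adjoin_ideal:
  assumes I: "ideal I R" and x: "x \<in> carrier R"
  shows "ideal (adjoin R I x) R" "I \<subseteq> adjoin R I x" "x \<in> adjoin R I x"
proof -
  note ops = ideal_ops[OF I]
  show "ideal (adjoin R I x) R"
  proof (rule idealI_cring)
    show "adjoin R I x \<subseteq> carrier R" using x ops(7) by (auto simp: adjoin_def)
    have "\<zero> = \<zero> \<oplus> \<zero> \<otimes> x" using x by simp
    then show "\<zero> \<in> adjoin R I x" unfolding adjoin_def using ops(1) by blast
  next
    fix a b assume "a \<in> adjoin R I x" "b \<in> adjoin R I x"
    then obtain i r j s where *: "a = i \<oplus> r \<otimes> x" "b = j \<oplus> s \<otimes> x" "i \<in> I" "j \<in> I" "r \<in> carrier R" "s \<in> carrier R"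
      by (auto simp: adjoin_def)
    then have "a \<oplus> b = (i \<oplus> j) \<oplus> (r \<oplus> s) \<otimes> x" using x ops(6) by (simp add: l_distr a_ac)
    then show "a \<oplus> b \<in> adjoin R I x" unfolding adjoin_def using * ops(2) by blast
  next
    fix a r assume "a \<in> adjoin R I x" and r: "r \<in> carrier R"
    then obtain i s where *: "a = i \<oplus> s \<otimes> x" "i \<in> I" "s \<in> carrier R" by (auto simp: adjoin_def)
    then have "r \<otimes> a = r \<otimes> i \<oplus> (r \<otimes> s) \<otimes> x" using x r ops(6) by (simp add: r_distr m_assoc)
    then show "r \<otimes> a \<in> adjoin R I x" unfolding adjoin_def using * ops(5) r by blast
  qed
  show "I \<subseteq> adjoin R I x"
  proof
    fix i assume "i \<in> I"
    moreover from this have "i = i \<oplus> \<zero> \<otimes> x" using x ops(6) by simp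
    ultimately show "i \<in> adjoin R I x" unfolding adjoin_def by blast
  qed
  have "x = \<zero> \<oplus> \<one> \<otimes> x" using x by simp
  then show "x \<in> adjoin R I x" unfolding adjoin_def using ops(1) by blast
qed

lemma (in noetherian_ring) exists_maximal_ideal_in:
  assumes "\<C> \<noteq> {}" "\<And>I. I \<in> \<C> \<Longrightarrow> ideal I R"
  shows "\<exists>M\<in>\<C>. \<forall>I\<in>\<C>. M \<subseteq> I \<longrightarrow> I = M"
proof (rule subset_Zorn_nonempty[OF assms(1)])
  fix C assume "C \<noteq> {}" "subset.chain \<C> C"
  moreover from this have "subset.chain {I. ideal I R} C"
    using assms(2) by (auto simp: pred_on.chain_def)
  ultimately show "\<Union>C \<in> \<C>"
    using ideal_chain_is_trivial by (auto simp: pred_on.chain_def)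
qed

locale noetherian_local = noetherian_ring R + cring R for R (structure) +
  fixes \<mm> :: "'a set"
  assumes max_\<mm>: "maximalideal \<mm> R"
    and max_unique: "maximalideal I R \<Longrightarrow> I = \<mm>"
begin

lemma \<mm>_ideal: "ideal \<mm> R" using max_\<mm> by (rule maximalideal.axioms(1))

lemma one_notin_\<mm>: "\<one> \<notin> \<mm>"
  using maximalideal.I_notcarr[OF max_\<mm>] ideal.one_imp_carrier[OF \<mm>_ideal] by blast

lemma unit_outside_\<mm>:
  assumes "x \<in> carrier R" "x \<notin> \<mm>" shows "\<exists>y\<in>carrier R. y \<otimes> x = \<one>"
proof (rule ccontr)
  assume no: "\<not> ?thesis"
  let ?C = "{I. ideal I R \<and> x \<in> I \<and> I \<noteq> carrier R}"
  have "\<one> \<notin> PIdl x" using no by (auto simp: cgenideal_def)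
  then have "PIdl x \<noteq> carrier R" using one_closed by metis
  then have "PIdl x \<in> ?C"
    using cgenideal_ideal[OF assms(1)] cgenideal_self[OF assms(1)] by blast
  then obtain M where M: "M \<in> ?C" "\<forall>I\<in>?C. M \<subseteq> I \<longrightarrow> I = M"
    using exists_maximal_ideal_in[of ?C] by blast
  have "maximalideal M R"
    by (rule maximalidealI) (use M in auto)
  then show False using max_unique M(1) assms(2) by blast
qed

abbreviation mpow :: "nat \<Rightarrow> 'a set" where "mpow k \<equiv> \<mm> [^]\<^bsub>ideals_set R\<^esub> k"

lemma mpow_simps: "mpow 0 = carrier R" "mpow (Suc k) = ideal_prod R (mpow k) \<mm>"
  by (simp_all add: ideals_set_def)

lemma mpow_ideal: "ideal (mpow k) R"
proof (induction k)
  case 0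
  then show ?case unfolding mpow_simps by (rule oneideal)
next
  case (Suc k)
  then show ?case unfolding mpow_simps by (rule ideal_prod_is_ideal[OF _ \<mm>_ideal])
qed

lemma mpow_Suc_subset: "mpow (Suc k) \<subseteq> mpow k" "mpow (Suc k) \<subseteq> \<mm>"
  unfolding mpow_simps using ideal_prod_inter[OF mpow_ideal \<mm>_ideal] by auto

lemma mpow_antimono: "i \<le> j \<Longrightarrow> mpow j \<subseteq> mpow i"
  using lift_Suc_antimono_le[of mpow] mpow_Suc_subset(1) by blast

lemma mpow_add: "mpow (i + j) = ideal_prod R (mpow i) (mpow j)"
proof -
  interpret I: comm_monoid "ideals_set R" by (rule ideals_set_is_comm_monoid)
  have "\<mm> \<in> carrier (ideals_set R)" using \<mm>_ideal by (simp add: ideals_set_def)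
  then show ?thesis using I.nat_pow_mult[of \<mm> i j] by (simp add: ideals_set_def)
qed

lemma \<mm>_mult_mpow: "a \<in> \<mm> \<Longrightarrow> b \<in> mpow k \<Longrightarrow> a \<otimes> b \<in> mpow (Suc k)"
  unfolding mpow_simps using ideal_prod.prod[of b "mpow k" a \<mm> R] m_comm[of a b]
    ideal_ops(6)[OF \<mm>_ideal] ideal_ops(6)[OF mpow_ideal] by simp

text \<open>Otherwise an ideal \<open>L\<close> above \<open>K\<close> that is maximal among those containing no power of \<open>\<mm>\<close> would be
prime, since powers contained in \<open>L + (x)\<close> and \<open>L + (y)\<close> multiply to one contained in \<open>L + (xy)\<close>.
It would contain \<open>\<mm>\<close>, a contradiction.\<close>

lemma power_of_\<mm>_in_ideal:
  assumes K: "ideal K R" and rad: "\<And>x. x \<in> \<mm> \<Longrightarrow> \<exists>n::nat. x [^] n \<in> K"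
  shows "\<exists>j. mpow j \<subseteq> K"
proof (rule ccontr)
  assume no: "\<not> ?thesis"
  let ?D = "{L. ideal L R \<and> K \<subseteq> L \<and> (\<forall>j. \<not> mpow j \<subseteq> L)}"
  have "K \<in> ?D" using K no by blast
  then obtain L where L: "L \<in> ?D" "\<forall>I\<in>?D. L \<subseteq> I \<longrightarrow> I = L"
    using exists_maximal_ideal_in[of ?D] by blast
  then have Li: "ideal L R" by blast
  note ops = ideal_ops[OF Li]
  have oneL: "\<one> \<notin> L"
  proof
    assume "\<one> \<in> L"
    then have "mpow 0 \<subseteq> L" using ideal.one_imp_carrier[OF Li] mpow_simps(1) by simp
    then show False using L(1) by blast
  qed
  have prime: "x \<otimes> y \<notin> L" if xy: "x \<in> carrier R" "y \<in> carrier R" "x \<notin> L" "y \<notin> L" for x y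
  proof
    assume xyL: "x \<otimes> y \<in> L"
    have big: "\<exists>j. mpow j \<subseteq> adjoin R L z" if "z \<in> carrier R" "z \<notin> L" for z
    proof (rule ccontr)
      assume "\<not> ?thesis"
      then have "adjoin R L z \<in> ?D" using adjoin_ideal[OF Li that(1)] L(1) by blast
      then have "adjoin R L z = L" using L(2) adjoin_ideal(2)[OF Li that(1)] by blast
      then show False using adjoin_ideal(3)[OF Li that(1)] that(2) by blast
    qed
    obtain a b where ab: "mpow a \<subseteq> adjoin R L x" "mpow b \<subseteq> adjoin R L y" using big xy by blast
    have "mpow (a + b) \<subseteq> L"
    proof
      fix t assume "t \<in> mpow (a + b)"
      then have "t \<in> ideal_prod R (mpow a) (mpow b)" by (simp add: mpow_add)
      then show "t \<in> L"
      proof (induction t rule: ideal_prod.induct)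
        case (prod u v)
        then obtain i r j s where *: "u = i \<oplus> r \<otimes> x" "v = j \<oplus> s \<otimes> y" "i \<in> L" "j \<in> L" "r \<in> carrier R" "s \<in> carrier R"
          using ab by (fastforce simp: adjoin_def)
        have "u \<otimes> v = v \<otimes> i \<oplus> (r \<otimes> x) \<otimes> j \<oplus> (r \<otimes> s) \<otimes> (x \<otimes> y)"
          using * xy ops(6) by (simp add: l_distr r_distr m_ac a_ac)
        moreover have "v \<otimes> i \<in> L" "(r \<otimes> x) \<otimes> j \<in> L" "(r \<otimes> s) \<otimes> (x \<otimes> y) \<in> L"
          using * xy xyL ops(5,6) by auto
        ultimately show ?case using ops(2) by simp
      qed (use ops(2) in auto)
    qed
    then show False using L(1) by blast
  qed
  have "\<mm> \<subseteq> L"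
  proof
    fix x assume x: "x \<in> \<mm>"
    then have xc: "x \<in> carrier R" using ideal_ops(6)[OF \<mm>_ideal] by blast
    obtain n :: nat where n: "x [^] n \<in> L" using rad[OF x] L(1) by blast
    show "x \<in> L"
    proof (rule ccontr)
      assume xL: "x \<notin> L"
      have "x [^] k \<notin> L" for k :: nat
        by (induction k) (use oneL prime[OF _ xc _ xL] xc in auto)
      then show False using n by blast
    qed
  qed
  then have "mpow (Suc 0) \<subseteq> L" using mpow_Suc_subset(2) by blast
  then show False using L(1) by blast
qed

text \<open>Krull's intersection theorem.  If \<open>z\<close> is not in \<open>I\<close>, choose \<open>K\<close> above \<open>I\<close> maximal with
\<open>z \<notin> K\<close>.  Then every element outside \<open>K\<close> generates an ideal that catches \<open>z\<close> modulo \<open>K\<close>.  Hence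
\<open>\<mm> z \<subseteq> K\<close>, and the ideals \<open>(K : x\<^sup>n)\<close>, which become stationary, show that every \<open>x \<in> \<mm>\<close> is nilpotent
modulo \<open>K\<close>.  So \<open>K\<close> contains a power of \<open>\<mm>\<close>, and approximating \<open>z\<close> from \<open>I\<close> to this
power puts \<open>z\<close> into \<open>K\<close>.\<close>

lemma ideal_adically_closed:
  assumes I: "ideal I R" and z: "z \<in> carrier R" and near: "\<And>k. \<exists>i\<in>I. z \<ominus> i \<in> mpow k"
  shows "z \<in> I"
proof (rule ccontr)
  assume zI: "z \<notin> I"
  let ?C = "{K. ideal K R \<and> I \<subseteq> K \<and> z \<notin> K}"
  obtain K where K: "K \<in> ?C" "\<forall>J\<in>?C. K \<subseteq> J \<longrightarrow> J = K"
    using exists_maximal_ideal_in[of ?C] I zI by blast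
  then have Ki: "ideal K R" by blast
  note ops = ideal_ops[OF Ki]
  have zK: "z \<notin> K" using K(1) by blast
  have catch: "\<exists>k\<in>K. \<exists>r\<in>carrier R. z = k \<oplus> r \<otimes> y" if y: "y \<in> carrier R" "y \<notin> K" for y
  proof (rule ccontr)
    assume "\<not> ?thesis"
    then have "z \<notin> adjoin R K y" by (auto simp: adjoin_def)
    then have "adjoin R K y \<in> ?C" using adjoin_ideal[OF Ki y(1)] K(1) by blast
    then have "adjoin R K y = K" using K(2) adjoin_ideal(2)[OF Ki y(1)] by blast
    then show False using adjoin_ideal(3)[OF Ki y(1)] y(2) by blast
  qed
  have socle: "x \<otimes> z \<in> K" if x: "x \<in> \<mm>" for x
  proof (rule ccontr)
    have xc: "x \<in> carrier R" using x ideal_ops(6)[OF \<mm>_ideal] by blast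
    assume "x \<otimes> z \<notin> K"
    then obtain k r where k: "k \<in> K" "r \<in> carrier R" "z = k \<oplus> r \<otimes> (x \<otimes> z)"
      using catch[of "x \<otimes> z"] xc z by blast
    (* z = k + r x z rewrites as (1 - r x) z = k, and 1 - r x is a unit. *)
    let ?u = "\<one> \<ominus> r \<otimes> x"
    have "?u \<notin> \<mm>"
    proof
      assume "?u \<in> \<mm>"
      moreover have "r \<otimes> x \<in> \<mm>" using ideal_ops(5)[OF \<mm>_ideal x k(2)] .
      ultimately have "?u \<oplus> r \<otimes> x \<in> \<mm>" by (rule ideal_ops(2)[OF \<mm>_ideal])
      moreover have "?u \<oplus> r \<otimes> x = \<one>" using k(2) xc by (simp add: minus_eq a_assoc l_neg)
      ultimately show False using one_notin_\<mm> by simp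
    qed
    then obtain y where y: "y \<in> carrier R" "y \<otimes> ?u = \<one>" using unit_outside_\<mm>[of ?u] k(2) xc by auto
    have "?u \<otimes> z = z \<ominus> r \<otimes> (x \<otimes> z)" using k(2) xc z by (simp add: minus_eq l_distr l_minus m_assoc)
    also have "\<dots> = k"
    proof -
      have "(k \<oplus> r \<otimes> (x \<otimes> z)) \<ominus> r \<otimes> (x \<otimes> z) = k"
        using k(1,2) xc z ops(6) by (simp add: minus_eq a_assoc r_neg)
      then show ?thesis using k(3) by simp
    qed
    finally have "y \<otimes> (?u \<otimes> z) \<in> K" using ops(5) k(1) y(1) by simp
    moreover have "y \<otimes> (?u \<otimes> z) = z" using y k(2) xc z by (simp flip: m_assoc)
    ultimately show False using zK by simp
  qed
  have rad: "\<exists>n::nat. x [^] n \<in> K" if x: "x \<in> \<mm>" for x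
  proof -
    have xc: "x \<in> carrier R" using x ideal_ops(6)[OF \<mm>_ideal] by blast
    define Q where "Q n = {y \<in> carrier R. y \<otimes> x [^] (n::nat) \<in> K}" for n
    have Qi: "ideal (Q n) R" for n
      by (rule idealI_cring) (use ops(1,2,5) xc in \<open>auto simp: Q_def l_distr m_assoc\<close>)
    then obtain n where n: "\<forall>J\<in>range Q. Q n \<subseteq> J \<longrightarrow> J = Q n"
      using exists_maximal_ideal_in[of "range Q"] by blast
    have step: "y \<otimes> x [^] Suc n = x \<otimes> (y \<otimes> x [^] n)" if "y \<in> carrier R" for y
      using that xc by (simp add: m_ac)
    have "Q n \<subseteq> Q (Suc n)" using ops(5) xc step by (auto simp: Q_def simp del: nat_pow_Suc)
    then have stable: "Q (Suc n) = Q n" using n by blast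
    have "x [^] n \<in> K"
    proof (rule ccontr)
      assume "x [^] n \<notin> K"
      then obtain k r where k: "k \<in> K" "r \<in> carrier R" "z = k \<oplus> r \<otimes> x [^] n"
        using catch[of "x [^] n"] xc by blast
      have "x \<otimes> z = x \<otimes> k \<oplus> x \<otimes> (r \<otimes> x [^] n)"
        using k(1,2) xc ops(6) by (simp add: k(3) r_distr)
      then have "x \<otimes> (r \<otimes> x [^] n) = x \<otimes> z \<ominus> x \<otimes> k"
        using k(1,2) xc ops(6) by (simp add: minus_eq a_ac r_neg1 r_neg2 r_neg l_neg)
      then have "r \<otimes> x [^] Suc n \<in> K" using step[OF k(2)] socle[OF x] ops(4) ops(5)[OF k(1) xc] by simp
      then have "r \<in> Q n" using k(2) stable by (auto simp: Q_def)
      then have "z \<in> K" using k ops(2) by (simp add: Q_def)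
      then show False using zK by blast
    qed
    then show ?thesis ..
  qed
  obtain j where j: "mpow j \<subseteq> K" using power_of_\<mm>_in_ideal[OF Ki rad] by blast
  obtain i where i: "i \<in> I" "z \<ominus> i \<in> mpow j" using near by metis
  have "(z \<ominus> i) \<oplus> i = z" using i(1) ideal_ops(6)[OF I] z by (simp add: minus_eq a_assoc l_neg)
  moreover have "(z \<ominus> i) \<oplus> i \<in> K" using i j K(1) ops(2) by blast
  ultimately show False using zK by simp
qed

section \<open>Linear compactness\<close>

text \<open>Cosets of submodules of the power of $R$ with exponent \<open>'x\<close>, together with the empty set.\<close>

definition affine_set :: "('x \<Rightarrow> 'a) set \<Rightarrow> bool" where
  "affine_set C \<longleftrightarrow> C \<subseteq> UNIV \<rightarrow> carrier R \<and>
    (\<forall>f\<in>C. \<forall>g\<in>C. \<forall>h\<in>C. \<forall>r\<in>carrier R. (\<lambda>x. f x \<oplus> r \<otimes> (g x \<ominus> h x)) \<in> C)"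

definition coord_coset :: "'x \<Rightarrow> 'a \<Rightarrow> 'a set \<Rightarrow> ('x \<Rightarrow> 'a) set" where
  "coord_coset q a J = {f \<in> UNIV \<rightarrow> carrier R. f q \<ominus> a \<in> J}"

definition fip :: "'z set set \<Rightarrow> bool" where
  "fip \<F> \<longleftrightarrow> (\<forall>S. finite S \<longrightarrow> S \<subseteq> \<F> \<longrightarrow> \<Inter>S \<noteq> {})"

lemma affine_Int: "affine_set A \<Longrightarrow> affine_set B \<Longrightarrow> affine_set (A \<inter> B)"
  by (auto simp: affine_set_def)

lemma affine_UNIV: "affine_set (UNIV \<rightarrow> carrier R)"
  by (auto simp: affine_set_def Pi_iff)

lemma affine_coord_coset:
  assumes J: "ideal J R" and a: "a \<in> carrier R"
  shows "affine_set (coord_coset q a J)"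
  unfolding affine_set_def
proof (intro conjI ballI)
  note ops = ideal_ops[OF J]
  show "coord_coset q a J \<subseteq> UNIV \<rightarrow> carrier R" by (auto simp: coord_coset_def)
  fix f g h r assume fgh: "f \<in> coord_coset q a J" "g \<in> coord_coset q a J" "h \<in> coord_coset q a J" "r \<in> carrier R"
  then have c: "f x \<in> carrier R" "g x \<in> carrier R" "h x \<in> carrier R" for x by (auto simp: coord_coset_def)
  have "g q \<ominus> h q = (g q \<ominus> a) \<ominus> (h q \<ominus> a)"
    using c[of q] a by (simp add: minus_cancel_right)
  then have "g q \<ominus> h q \<in> J" using fgh ops(4) by (simp add: coord_coset_def)
  then have "(f q \<ominus> a) \<oplus> r \<otimes> (g q \<ominus> h q) \<in> J" using fgh ops(2,5) by (simp add: coord_coset_def)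
  moreover have "(f q \<oplus> r \<otimes> (g q \<ominus> h q)) \<ominus> a = (f q \<ominus> a) \<oplus> r \<otimes> (g q \<ominus> h q)"
    using c[of q] a fgh(4) by (simp add: minus_eq a_ac)
  ultimately show "(\<lambda>x. f x \<oplus> r \<otimes> (g x \<ominus> h x)) \<in> coord_coset q a J"
    using c fgh(4) by (simp add: coord_coset_def)
qed

end

text \<open>A maximal family of affine sets with the finite intersection property is the analogue of an ultrafilter.  It
is closed under intersection, and contains every affine set that meets all its members.\<close>

locale maximal_affine_fip = noetherian_local +
  fixes \<F> :: "('x \<Rightarrow> 'a) set set"
  assumes affine: "A \<in> \<F> \<Longrightarrow> affine_set A"
    and fip: "fip \<F>"
    and maximal: "affine_set A \<Longrightarrow> fip (insert A \<F>) \<Longrightarrow> A \<in> \<F>"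
begin

lemma F_finite_Inter:
  assumes "finite S" "S \<subseteq> \<F>" "S \<noteq> {}"
  shows "\<Inter>S \<in> \<F>"
proof (rule maximal)
  show "affine_set (\<Inter>S)"
    using assms(1,3,2) by (induction S rule: finite_ne_induct) (auto simp: affine affine_Int)
  show "fip (insert (\<Inter>S) \<F>)"
    unfolding fip_def
  proof (intro allI impI)
    fix T assume T: "finite T" "T \<subseteq> insert (\<Inter>S) \<F>"
    have "\<Inter>(S \<union> (T - {\<Inter>S})) \<noteq> {}" using fip T assms unfolding fip_def by (metis Diff_subset_conv Un_insert_left Un_subset_iff finite_Diff finite_UnI sup_bot_left)
    then show "\<Inter>T \<noteq> {}" by blast
  qed
qed

lemma F_Int: "A \<in> \<F> \<Longrightarrow> B \<in> \<F> \<Longrightarrow> A \<inter> B \<in> \<F>"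
  using F_finite_Inter[of "{A, B}"] by simp

lemma F_nonempty: "A \<in> \<F> \<Longrightarrow> A \<noteq> {}"
  using fip unfolding fip_def by (metis Inter_insert bot.extremum empty_subsetI finite.emptyI finite.insertI insert_subset Inf_empty inf_top.right_neutral)

lemma F_meets:
  assumes A: "affine_set A" "A \<noteq> {}" and meets: "\<And>B. B \<in> \<F> \<Longrightarrow> A \<inter> B \<noteq> {}"
  shows "A \<in> \<F>"
proof (rule maximal[OF A(1)])
  show "fip (insert A \<F>)"
    unfolding fip_def
  proof (intro allI impI)
    fix T assume T: "finite T" "T \<subseteq> insert A \<F>"
    show "\<Inter>T \<noteq> {}"
    proof (cases "T - {A} = {}")
      case True
      then have "T \<subseteq> {A}" by blast
      then show ?thesis using A(2) by (metis Inter_insert Inter_empty UNIV_not_empty inf_top.right_neutral subset_singletonD)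
    next
      case False
      then have "\<Inter>(T - {A}) \<in> \<F>" using T by (intro F_finite_Inter) auto
      then have "A \<inter> \<Inter>(T - {A}) \<noteq> {}" by (rule meets)
      then show ?thesis by blast
    qed
  qed
qed

lemma F_UNIV: "UNIV \<rightarrow> carrier R \<in> \<F>"
proof (rule F_meets[OF affine_UNIV])
  have "(\<lambda>x. \<zero>) \<in> UNIV \<rightarrow> carrier R" by simp
  then show "UNIV \<rightarrow> carrier R \<noteq> {}" by blast
  fix B assume B: "B \<in> \<F>"
  then have "B \<subseteq> UNIV \<rightarrow> carrier R" using affine by (simp add: affine_set_def)
  then show "(UNIV \<rightarrow> carrier R) \<inter> B \<noteq> {}" using F_nonempty[OF B] by blast
qed

lemma F_upward: "A \<in> \<F> \<Longrightarrow> affine_set B \<Longrightarrow> A \<subseteq> B \<Longrightarrow> B \<in> \<F>"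
  using F_meets[of B] F_Int F_nonempty by blast

lemma F_carrier: "A \<in> \<F> \<Longrightarrow> f \<in> A \<Longrightarrow> f x \<in> carrier R"
  using affine[of A] by (auto simp: affine_set_def)

lemma F_comb: "A \<in> \<F> \<Longrightarrow> f \<in> A \<Longrightarrow> g \<in> A \<Longrightarrow> h \<in> A \<Longrightarrow> r \<in> carrier R \<Longrightarrow>
    (\<lambda>x. f x \<oplus> r \<otimes> (g x \<ominus> h x)) \<in> A"
  using affine[of A] by (simp add: affine_set_def)

text \<open>Suppose that coordinate \<open>q\<close> is known modulo \<open>J + (g)\<close>, where \<open>\<mm> g \<subseteq> J\<close>, so that \<open>(J + (g))/J\<close> is a quotient of
the residue field.  The values of a member of the family in this quotient form a coset of a subspace, that
is, a point or everything.  If they are everything for each member, any point will do; otherwise a member \<open>B'\<close> with a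
single value decides.\<close>

lemma refine_coset_step:
  assumes J: "ideal J R" and g: "g \<in> carrier R" and mg: "\<And>a. a \<in> \<mm> \<Longrightarrow> a \<otimes> g \<in> J"
    and a: "a \<in> carrier R" and big: "coord_coset q a (adjoin R J g) \<in> \<F>"
  shows "\<exists>a'\<in>carrier R. coord_coset q a' J \<in> \<F>"
proof (cases "coord_coset q a J \<in> \<F>")
  case True
  then show ?thesis using a by blast
next
  case False
  note ops = ideal_ops[OF J]
  have "coord_coset q a J \<noteq> {}"
    using a ops(1) by (auto simp: coord_coset_def r_neg minus_eq intro!: exI[of _ "\<lambda>x. a"])
  then obtain B where B: "B \<in> \<F>" "coord_coset q a J \<inter> B = {}"
    using False F_meets[OF affine_coord_coset[OF J a]] by blast
  define B' where "B' = B \<inter> coord_coset q a (adjoin R J g)"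
  have B': "B' \<in> \<F>" unfolding B'_def using B(1) big by (rule F_Int)
  then obtain f0 where f0: "f0 \<in> B'" using F_nonempty by blast
  have y: "f0 q \<in> carrier R" using F_carrier[OF B' f0] .
  have "B' \<subseteq> coord_coset q (f0 q) J"
  proof
    fix f assume f: "f \<in> B'"
    have fq: "f x \<in> carrier R" for x using F_carrier[OF B' f] .
    have "f q \<ominus> a \<in> adjoin R J g" "f0 q \<ominus> a \<in> adjoin R J g"
      using f f0 by (auto simp: B'_def coord_coset_def)
    then have "(f q \<ominus> a) \<ominus> (f0 q \<ominus> a) \<in> adjoin R J g" by (rule ideal_ops(4)[OF adjoin_ideal(1)[OF J g]])
    moreover have "(f q \<ominus> a) \<ominus> (f0 q \<ominus> a) = f q \<ominus> f0 q"
      using fq[of q] y a by (simp add: minus_cancel_right)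
    ultimately obtain j c where jc: "f q \<ominus> f0 q = j \<oplus> c \<otimes> g" "j \<in> J" "c \<in> carrier R"
      by (auto simp: adjoin_def)
    obtain i b where ib: "f0 q \<ominus> a = i \<oplus> b \<otimes> g" "i \<in> J" "b \<in> carrier R"
      using \<open>f0 q \<ominus> a \<in> adjoin R J g\<close> by (auto simp: adjoin_def)
    (* If c were a unit, moving from f0 in the direction f - f0 would reach the excluded coset of a. *)
    have "c \<in> \<mm>"
    proof (rule ccontr)
      assume "c \<notin> \<mm>"
      then obtain d where d: "d \<in> carrier R" "d \<otimes> c = \<one>" using unit_outside_\<mm> jc(3) by blast
      let ?r = "\<ominus> (b \<otimes> d)"
      let ?h = "\<lambda>x. f0 x \<oplus> ?r \<otimes> (f x \<ominus> f0 x)"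
      have hB: "?h \<in> B'" using F_comb[OF B' f0 f f0, of ?r] d ib by simp
      have "?h q \<ominus> a \<in> J"
      proof -
        have "?h q \<ominus> a = (f0 q \<ominus> a) \<oplus> ?r \<otimes> (f q \<ominus> f0 q)"
          using y fq[of q] a d(1) ib(3) by (simp add: minus_eq a_ac)
        also have "\<dots> = i \<oplus> b \<otimes> g \<oplus> ?r \<otimes> (j \<oplus> c \<otimes> g)" by (simp only: ib(1) jc(1))
        also have "?r \<otimes> (j \<oplus> c \<otimes> g) = ?r \<otimes> j \<oplus> \<ominus> (b \<otimes> (d \<otimes> c) \<otimes> g)"
          using d(1) ib(3) jc ops(6) g by (simp add: r_distr l_minus m_assoc)
        also have "\<dots> = ?r \<otimes> j \<oplus> \<ominus> (b \<otimes> g)" using d ib(3) by simp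
        also have "i \<oplus> b \<otimes> g \<oplus> (?r \<otimes> j \<oplus> \<ominus> (b \<otimes> g)) = i \<oplus> ?r \<otimes> j"
        proof -
          have "?r \<otimes> j \<oplus> \<ominus> (b \<otimes> g) = \<ominus> (b \<otimes> g) \<oplus> ?r \<otimes> j"
            using d(1) ib(3) jc ops(6) g by (intro a_comm) auto
          then show ?thesis using d(1) ib jc ops(6) g by (simp add: a_assoc r_neg2)
        qed
        finally have "?h q \<ominus> a = i \<oplus> ?r \<otimes> j" .
        moreover have "i \<oplus> ?r \<otimes> j \<in> J" using ops(2,5) ib jc d by simp
        ultimately show ?thesis by simp
      qed
      moreover have "?h \<in> UNIV \<rightarrow> carrier R" using F_carrier[OF B' hB] by (rule Pi_I)
      moreover have "?h \<in> B" using hB by (simp add: B'_def)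
      ultimately have "?h \<in> coord_coset q a J \<inter> B" unfolding coord_coset_def by (intro IntI CollectI conjI)
      then show False using B(2) by blast
    qed
    then have "f q \<ominus> f0 q \<in> J" using jc mg ops(2) by simp
    then show "f \<in> coord_coset q (f0 q) J" using fq by (simp add: coord_coset_def)
  qed
  then have "coord_coset q (f0 q) J \<in> \<F>" using F_upward[OF B' affine_coord_coset[OF J y]] by blast
  then show ?thesis using y by blast
qed

text \<open>From \<open>\<mm>\<^sup>k\<close> to \<open>\<mm>\<^sup>k\<^sup>+\<^sup>1\<close> the generators of \<open>\<mm>\<^sup>k\<close> are removed one at a time.\<close>

lemma coord_coset_mpow: "\<exists>a\<in>carrier R. coord_coset q a (mpow k) \<in> \<F>"
proof (induction k)
  case 0
  have "coord_coset q \<zero> (mpow 0) = UNIV \<rightarrow> carrier R" unfolding mpow_simps by (auto simp: coord_coset_def Pi_iff)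
  then show ?case using F_UNIV zero_closed by metis
next
  case (Suc k)
  obtain G where G: "G \<subseteq> carrier R" "finite G" "mpow k = Idl G" using finetely_gen[OF mpow_ideal] by metis
  let ?I = "\<lambda>G. Idl (mpow (Suc k) \<union> G)"
  have gen: "\<exists>a\<in>carrier R. coord_coset q a (mpow (Suc k)) \<in> \<F>"
    if "finite H" "H \<subseteq> mpow k" "a \<in> carrier R" "coord_coset q a (?I H) \<in> \<F>" for H a
    using that
  proof (induction H arbitrary: a)
    case empty
    have "?I {} = mpow (Suc k)"
      unfolding Un_empty_right
      by (rule equalityI[OF genideal_minimal[OF mpow_ideal order_refl] genideal_self[OF ideal_ops(7)[OF mpow_ideal]]])
    then show ?case using empty(2,3) by metis
  next
    case (insert g H)
    have sub: "mpow (Suc k) \<union> H \<subseteq> carrier R" "g \<in> carrier R"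
      using insert.prems(1) ideal_ops(7)[OF mpow_ideal] by blast+
    have Ii: "ideal (?I H) R" by (rule genideal_ideal[OF sub(1)])
    have "?I (insert g H) \<subseteq> adjoin R (?I H) g"
      using adjoin_ideal[OF Ii sub(2)] genideal_self[OF sub(1)]
      by (intro genideal_minimal) auto
    then have "coord_coset q a (?I (insert g H)) \<subseteq> coord_coset q a (adjoin R (?I H) g)"
      by (auto simp: coord_coset_def)
    then have "coord_coset q a (adjoin R (?I H) g) \<in> \<F>"
      by (rule F_upward[OF insert.prems(3) affine_coord_coset[OF adjoin_ideal(1)[OF Ii sub(2)] insert.prems(2)]])
    moreover have "b \<otimes> g \<in> ?I H" if "b \<in> \<mm>" for b
      using \<mm>_mult_mpow[OF that, of g k] insert.prems(1) genideal_self[OF sub(1)] by blast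
    ultimately obtain a' where "a' \<in> carrier R" "coord_coset q a' (?I H) \<in> \<F>"
      using refine_coset_step[OF Ii sub(2) _ insert.prems(2)] by blast
    then show ?case using insert.IH insert.prems(1) by blast
  qed
  obtain a where a: "a \<in> carrier R" "coord_coset q a (mpow k) \<in> \<F>" using Suc by blast
  have GI: "G \<subseteq> mpow k" using genideal_self[OF G(1)] G(3) by simp
  have sub: "mpow (Suc k) \<union> G \<subseteq> carrier R" using G(1) ideal_ops(7)[OF mpow_ideal] by blast
  have "mpow k \<subseteq> ?I G" unfolding G(3)
    using genideal_self[OF sub] by (intro genideal_minimal genideal_ideal[OF sub]) blast
  then have "coord_coset q a (mpow k) \<subseteq> coord_coset q a (?I G)" by (auto simp: coord_coset_def)
  then have "coord_coset q a (?I G) \<in> \<F>"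
    by (rule F_upward[OF a(2) affine_coord_coset[OF genideal_ideal[OF sub] a(1)]])
  then show ?case using gen[OF G(2) GI a(1)] by blast
qed

text \<open>The approximations of the coordinate modulo the powers of \<open>\<mm>\<close> form a Cauchy sequence, as members of the family
intersect.  For its limit \<open>l\<close> and a member \<open>B\<close>, the values of \<open>B\<close> at \<open>q\<close> are a coset of an ideal that comes
arbitrarily close to \<open>l\<close>; since ideals are closed, \<open>l\<close> is one of these values.\<close>

lemma coord_point:
  assumes complete: "adically_complete R \<mm>"
  shows "\<exists>l\<in>carrier R. {f \<in> UNIV \<rightarrow> carrier R. f q = l} \<in> \<F>"
proof -
  obtain s where s: "\<And>k. s k \<in> carrier R" "\<And>k. coord_coset q (s k) (mpow k) \<in> \<F>"
    using coord_coset_mpow[of q] by metis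
  have cauchy: "s i \<ominus> s j \<in> mpow k" if "i \<ge> k" "j \<ge> k" for i j k
  proof -
    obtain f where f: "f \<in> coord_coset q (s i) (mpow i) \<inter> coord_coset q (s j) (mpow j)"
      using F_nonempty[OF F_Int[OF s(2) s(2)]] by blast
    then have fc: "f q \<in> carrier R" by (auto simp: coord_coset_def)
    have "f q \<ominus> s i \<in> mpow k" "f q \<ominus> s j \<in> mpow k"
      using f mpow_antimono that by (auto simp: coord_coset_def)
    then have "(f q \<ominus> s j) \<ominus> (f q \<ominus> s i) \<in> mpow k" by - (rule ideal_ops(4)[OF mpow_ideal])
    moreover have "(f q \<ominus> s j) \<ominus> (f q \<ominus> s i) = s i \<ominus> s j"
      using fc s(1)[of i] s(1)[of j] by (simp add: minus_cancel_left)
    ultimately show ?thesis by simp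
  qed
  have "range s \<subseteq> carrier R" using s(1) by blast
  then obtain l where l: "l \<in> carrier R" "\<And>k. \<exists>N. \<forall>i\<ge>N. s i \<ominus> l \<in> mpow k"
    using complete cauchy unfolding adically_complete_def by metis
  have near: "coord_coset q l (mpow k) \<in> \<F>" for k
  proof -
    obtain N where N: "\<forall>i\<ge>N. s i \<ominus> l \<in> mpow k" using l(2) by blast
    let ?i = "max N k"
    have "coord_coset q (s ?i) (mpow ?i) \<subseteq> coord_coset q l (mpow k)"
    proof
      fix f assume f: "f \<in> coord_coset q (s ?i) (mpow ?i)"
      then have fc: "f q \<in> carrier R" by (auto simp: coord_coset_def)
      have "f q \<ominus> s ?i \<in> mpow k" using f mpow_antimono[of k ?i] by (auto simp: coord_coset_def)
      then have "f q \<ominus> l \<in> mpow k"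
        using ideal_ops(2)[OF mpow_ideal, of "f q \<ominus> s ?i" k "s ?i \<ominus> l"] N minus_split[OF fc s(1)[of ?i] l(1)]
        by simp
      then show "f \<in> coord_coset q l (mpow k)" using f by (auto simp: coord_coset_def)
    qed
    then show ?thesis by (rule F_upward[OF s(2) affine_coord_coset[OF mpow_ideal l(1)]])
  qed
  have zero: "{f \<in> UNIV \<rightarrow> carrier R. f q = l} = coord_coset q l {\<zero>}"
    using l(1) by (auto simp: coord_coset_def minus_eq r_neg) (metis PiE UNIV_I minus_eq r_right_minus_eq)
  have "coord_coset q l {\<zero>} \<in> \<F>"
  proof (rule F_meets[OF affine_coord_coset[OF zeroideal l(1)]])
    show "coord_coset q l {\<zero>} \<noteq> {}" using l(1) unfolding zero[symmetric] by (auto intro!: exI[of _ "\<lambda>x. l"])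
    fix B assume B: "B \<in> \<F>"
    obtain f0 where f0: "f0 \<in> B" using F_nonempty[OF B] by blast
    have c: "f q \<in> carrier R" if "f \<in> B" for f using F_carrier[OF B that] .
    define I where "I = {f q \<ominus> f0 q | f. f \<in> B}"
    have Imem: "f q \<ominus> f0 q \<in> I" if "f \<in> B" for f using that by (auto simp: I_def)
    have Ii: "ideal I R"
    proof (rule idealI_cring)
      show "I \<subseteq> carrier R" using c f0 by (auto simp: I_def)
      show "\<zero> \<in> I" using f0 c[OF f0] by (force simp: I_def minus_eq r_neg)
    next
      fix a b assume "a \<in> I" "b \<in> I"
      then obtain f g where fg: "a = f q \<ominus> f0 q" "b = g q \<ominus> f0 q" "f \<in> B" "g \<in> B" by (auto simp: I_def)
      have "(\<lambda>x. f x \<oplus> \<one> \<otimes> (g x \<ominus> f0 x)) \<in> B" by (rule F_comb[OF B]) (use fg f0 in auto)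
      from Imem[OF this] have "(f q \<oplus> \<one> \<otimes> (g q \<ominus> f0 q)) \<ominus> f0 q \<in> I" .
      moreover have "a \<oplus> b = (f q \<oplus> \<one> \<otimes> (g q \<ominus> f0 q)) \<ominus> f0 q"
        using c fg f0 by (simp add: minus_eq a_ac)
      ultimately show "a \<oplus> b \<in> I" by simp
    next
      fix a r assume "a \<in> I" and r: "r \<in> carrier R"
      then obtain f where f: "a = f q \<ominus> f0 q" "f \<in> B" by (auto simp: I_def)
      have "(\<lambda>x. f0 x \<oplus> r \<otimes> (f x \<ominus> f0 x)) \<in> B" by (rule F_comb[OF B]) (use f f0 r in auto)
      from Imem[OF this] have "(f0 q \<oplus> r \<otimes> (f q \<ominus> f0 q)) \<ominus> f0 q \<in> I" .
      moreover have "r \<otimes> a = (f0 q \<oplus> r \<otimes> (f q \<ominus> f0 q)) \<ominus> f0 q"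
        using c f f0 r a_comm[of "f0 q" "r \<otimes> (f q \<ominus> f0 q)"] by (simp add: minus_eq a_assoc r_neg)
      ultimately show "r \<otimes> a \<in> I" by simp
    qed
    have "l \<ominus> f0 q \<in> I"
    proof (rule ideal_adically_closed[OF Ii])
      fix k
      obtain f where f: "f \<in> coord_coset q l (mpow k)" "f \<in> B" using F_nonempty[OF F_Int[OF near B]] by blast
      have "(l \<ominus> f0 q) \<ominus> (f q \<ominus> f0 q) = \<ominus> (f q \<ominus> l)"
        using c[OF f(2)] c[OF f0] l(1) by (simp add: minus_cancel_right neg_minus)
      moreover have "\<ominus> (f q \<ominus> l) \<in> mpow k" using f(1) ideal_ops(3)[OF mpow_ideal] by (simp add: coord_coset_def)
      ultimately show "\<exists>i\<in>I. (l \<ominus> f0 q) \<ominus> i \<in> mpow k" using f(2) by (auto simp: I_def)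
    qed (use l(1) c[OF f0] in simp)
    then obtain f where f: "l \<ominus> f0 q = f q \<ominus> f0 q" "f \<in> B" by (auto simp: I_def)
    then have "f q = l" using c[OF f(2)] c[OF f0] l(1) by (simp add: minus_eq)
    moreover have "f \<in> UNIV \<rightarrow> carrier R" using F_carrier[OF B f(2)] by (rule Pi_I)
    ultimately have "f \<in> coord_coset q l {\<zero>} \<inter> B" unfolding zero[symmetric] using f(2) by simp
    then show "coord_coset q l {\<zero>} \<inter> B \<noteq> {}" by (metis empty_iff)
  qed
  then show ?thesis unfolding zero[symmetric] using l(1) by blast
qed

end

context noetherian_local
begin

text \<open>Zorn's lemma: a finite subfamily of the union of a chain lies in one of its members.\<close>

lemma exists_maximal_affine_fip:
  assumes aff: "\<And>A. A \<in> \<F>0 \<Longrightarrow> affine_set A" and fip0: "fip \<F>0"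
  shows "\<exists>\<F>. \<F>0 \<subseteq> \<F> \<and> maximal_affine_fip R \<mm> \<F>"
proof -
  let ?Z = "{\<F>. \<F>0 \<subseteq> \<F> \<and> (\<forall>A\<in>\<F>. affine_set A) \<and> fip \<F>}"
  have "\<exists>M\<in>?Z. \<forall>Y\<in>?Z. M \<subseteq> Y \<longrightarrow> Y = M"
  proof (rule subset_Zorn_nonempty)
    show "?Z \<noteq> {}" using aff fip0 by blast
    fix C assume C: "C \<noteq> {}" "subset.chain ?Z C"
    have "fip (\<Union>C)"
      unfolding fip_def
    proof (intro allI impI)
      fix S assume S: "finite S" "S \<subseteq> \<Union>C"
      have "\<exists>\<F>\<in>C. S \<subseteq> \<F>"
        using finite_subset_Union_chain[OF S C] by blast
      then show "\<Inter>S \<noteq> {}" using C(2) S(1) by (auto simp: pred_on.chain_def fip_def)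
    qed
    then show "\<Union>C \<in> ?Z" using C by (auto simp: pred_on.chain_def)
  qed
  then obtain \<F> where F: "\<F> \<in> ?Z" "\<forall>Y\<in>?Z. \<F> \<subseteq> Y \<longrightarrow> Y = \<F>" by blast
  have "maximal_affine_fip R \<mm> \<F>"
  proof
    show "A \<in> \<F> \<Longrightarrow> affine_set A" "fip \<F>" for A using F(1) by blast+
    show "A \<in> \<F>" if "affine_set A" "fip (insert A \<F>)" for A
    proof -
      have "insert A \<F> \<in> ?Z" using F(1) that by blast
      then show ?thesis using F(2) by blast
    qed
  qed
  then show ?thesis using F(1) by blast
qed

text \<open>The coordinates fixed by the maximal family assemble to a function \<open>l\<close>.  A set \<open>A\<close> that depends on finitely many
coordinates meets the set of functions agreeing with \<open>l\<close> on them, so it contains \<open>l\<close>.\<close>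

lemma complete_imp_linearly_compact:
  fixes \<F>0 :: "('x \<Rightarrow> 'a) set set"
  assumes complete: "adically_complete R \<mm>"
    and aff: "\<And>A. A \<in> \<F>0 \<Longrightarrow> affine_set A" and fip0: "fip \<F>0"
    and supp: "\<And>A. A \<in> \<F>0 \<Longrightarrow> \<exists>V. finite V \<and>
      (\<forall>f\<in>A. \<forall>g\<in>UNIV \<rightarrow> carrier R. (\<forall>x\<in>V. f x = g x) \<longrightarrow> g \<in> A)"
  shows "\<exists>f\<in>UNIV \<rightarrow> carrier R. \<forall>A\<in>\<F>0. f \<in> A"
proof -
  have "\<exists>\<F>. \<F>0 \<subseteq> \<F> \<and> maximal_affine_fip R \<mm> \<F>"
    by (rule exists_maximal_affine_fip[OF aff fip0])
  then obtain \<F> where F: "\<F>0 \<subseteq> \<F>" "maximal_affine_fip R \<mm> \<F>" by (elim exE conjE)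
  interpret maximal_affine_fip R \<mm> \<F> by (rule F(2))
  obtain l where l: "\<And>q. l q \<in> carrier R" "\<And>q. {f \<in> UNIV \<rightarrow> carrier R. f q = l q} \<in> \<F>"
    using bchoice[of UNIV "\<lambda>q a. a \<in> carrier R \<and> {f \<in> UNIV \<rightarrow> carrier R. f q = a} \<in> \<F>"]
      coord_point[OF complete] by auto
  have lF: "l \<in> UNIV \<rightarrow> carrier R" using l(1) by (rule Pi_I)
  have "l \<in> A" if A: "A \<in> \<F>0" for A
  proof -
    obtain V where V: "finite V" "\<forall>f\<in>A. \<forall>g\<in>UNIV \<rightarrow> carrier R. (\<forall>x\<in>V. f x = g x) \<longrightarrow> g \<in> A"
      using supp[OF A] by blast
    let ?S = "insert A ((\<lambda>q. {f \<in> UNIV \<rightarrow> carrier R. f q = l q}) ` V)"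
    have "finite ?S" "?S \<subseteq> \<F>" using V(1) A F(1) l(2) by auto
    then have "\<Inter>?S \<noteq> {}" using fip by (simp only: fip_def simp_thms)
    then have "\<exists>f. f \<in> \<Inter>?S" by (simp only: ex_in_conv simp_thms)
    then obtain f where "f \<in> \<Inter>?S" by (rule exE)
    then have "f \<in> A" "\<forall>x\<in>V. f x = l x" by simp_all
    then show ?thesis using V(2)[rule_format, of f l] lF by simp
  qed
  then show ?thesis using lF by blast
qed

end

section \<open>Noetherian modules and F-finiteness\<close>

text \<open>\<open>N\<close> is a submodule of a power of $R$, only the coordinates in the finite set \<open>T\<close> count, and the claim is that
finitely many elements of \<open>N\<close> imply all linear equations given by \<open>N\<close>.  For the induction, the values of \<open>N\<close> in
the new coordinate form an ideal; lifting finitely many generators of it reduces an element of \<open>N\<close> to one that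
vanishes there.\<close>

lemma (in cring) submodule_annihilators_finite:
  assumes noeth: "noetherian_ring R" and "finite T"
    and N: "N \<subseteq> UNIV \<rightarrow> carrier R" "(\<lambda>t. \<zero>) \<in> N"
    and Nadd: "\<And>c d. c \<in> N \<Longrightarrow> d \<in> N \<Longrightarrow> (\<lambda>t. c t \<oplus> d t) \<in> N"
    and Nmult: "\<And>r c. r \<in> carrier R \<Longrightarrow> c \<in> N \<Longrightarrow> (\<lambda>t. r \<otimes> c t) \<in> N"
  shows "\<exists>S. finite S \<and> S \<subseteq> N \<and> (\<forall>x\<in>T \<rightarrow> carrier R.
    (\<forall>c\<in>S. (\<Oplus>t\<in>T. c t \<otimes> x t) = \<zero>) \<longrightarrow> (\<forall>c\<in>N. (\<Oplus>t\<in>T. c t \<otimes> x t) = \<zero>))"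
  using \<open>finite T\<close> N Nadd Nmult
proof (induction T arbitrary: N)
  case empty
  show ?case by (intro exI[of _ "{}"]) simp
next
  case (insert t T N)
  interpret noetherian_ring R by (rule noeth)
  have car: "c s \<in> carrier R" if "c \<in> N" for c s using that insert.prems(1) by blast
  define I where "I = (\<lambda>c. c t) ` N"
  have "ideal I R"
  proof (rule idealI_cring)
    show "I \<subseteq> carrier R" using car by (auto simp: I_def)
    show "\<zero> \<in> I" unfolding I_def by (rule image_eqI[OF _ insert.prems(2)]) simp
  next
    fix a b assume "a \<in> I" "b \<in> I"
    then obtain c d where "a = c t" "b = d t" "c \<in> N" "d \<in> N" by (auto simp: I_def)
    then show "a \<oplus> b \<in> I" unfolding I_def using insert.prems(3)[of c d] by (intro image_eqI[where x = "\<lambda>s. c s \<oplus> d s"]) auto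
  next
    fix a r assume "a \<in> I" "r \<in> carrier R"
    then obtain c where "a = c t" "c \<in> N" by (auto simp: I_def)
    then show "r \<otimes> a \<in> I" unfolding I_def using insert.prems(4)[of r c] \<open>r \<in> carrier R\<close> by (intro image_eqI[where x = "\<lambda>s. r \<otimes> c s"]) auto
  qed
  then obtain A where A: "A \<subseteq> carrier R" "finite A" "I = Idl A" using finetely_gen by metis
  have "A \<subseteq> (\<lambda>c. c t) ` N" using genideal_self[OF A(1)] A(3) by (simp add: I_def)
  then obtain S1 where S1: "S1 \<subseteq> N" "finite S1" "A = (\<lambda>c. c t) ` S1"
    using A(2) by (meson finite_subset_image)
  define N' where "N' = {c \<in> N. c t = \<zero>}"
  have "\<exists>S. finite S \<and> S \<subseteq> N' \<and> (\<forall>x\<in>T \<rightarrow> carrier R.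
    (\<forall>c\<in>S. (\<Oplus>t\<in>T. c t \<otimes> x t) = \<zero>) \<longrightarrow> (\<forall>c\<in>N'. (\<Oplus>t\<in>T. c t \<otimes> x t) = \<zero>))"
    by (rule insert.IH) (use insert.prems in \<open>auto simp: N'_def\<close>)
  then obtain S2 where S2: "finite S2" "S2 \<subseteq> N'" "\<And>x c. x \<in> T \<rightarrow> carrier R \<Longrightarrow>
      \<forall>c\<in>S2. (\<Oplus>t\<in>T. c t \<otimes> x t) = \<zero> \<Longrightarrow> c \<in> N' \<Longrightarrow> (\<Oplus>t\<in>T. c t \<otimes> x t) = \<zero>"
    by metis
  show ?case
  proof (intro exI[of _ "S1 \<union> S2"] conjI ballI impI)
    show "finite (S1 \<union> S2)" "S1 \<union> S2 \<subseteq> N" using S1 S2 by (auto simp: N'_def)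
    fix x c assume x: "x \<in> insert t T \<rightarrow> carrier R" and kill: "\<forall>c\<in>S1 \<union> S2. (\<Oplus>t\<in>insert t T. c t \<otimes> x t) = \<zero>"
      and c: "c \<in> N"
    define dot where "dot c = (\<Oplus>s\<in>insert t T. c s \<otimes> x s)" for c
    have xT: "x \<in> T \<rightarrow> carrier R" "x t \<in> carrier R" using x by auto
    have fin: "finite T" "t \<notin> T" using insert.hyps by auto
    have terms: "(\<lambda>s. c s \<otimes> x s) \<in> insert t T \<rightarrow> carrier R" if "c \<in> N" for c using car[OF that] x by auto
    have split: "dot c = c t \<otimes> x t \<oplus> (\<Oplus>s\<in>T. c s \<otimes> x s)" if "c \<in> N" for c
      unfolding dot_def using fin terms[OF that] by (intro finsum_insert) auto
    have dotc: "dot c \<in> carrier R" if "c \<in> N" for c unfolding dot_def using terms[OF that] by simp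
    have dot_add: "dot (\<lambda>s. c s \<oplus> d s) = dot c \<oplus> dot d" if cd: "c \<in> N" "d \<in> N" for c d
    proof -
      have "dot (\<lambda>s. c s \<oplus> d s) = (\<Oplus>s\<in>insert t T. c s \<otimes> x s \<oplus> d s \<otimes> x s)"
        unfolding dot_def using cd car x by (intro finsum_cong') (auto simp: l_distr Pi_iff)
      also have "\<dots> = dot c \<oplus> dot d" unfolding dot_def using terms cd by (intro finsum_addf) auto
      finally show ?thesis .
    qed
    have dot_mult: "dot (\<lambda>s. r \<otimes> c s) = r \<otimes> dot c" if rc: "r \<in> carrier R" "c \<in> N" for r c
    proof -
      have "dot (\<lambda>s. r \<otimes> c s) = (\<Oplus>s\<in>insert t T. r \<otimes> (c s \<otimes> x s))"
        unfolding dot_def using rc car x by (intro finsum_cong') (auto simp: m_assoc Pi_iff)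
      also have "\<dots> = r \<otimes> dot c" unfolding dot_def using terms rc fin
        by (intro finsum_rdistr[symmetric]) auto
      finally show ?thesis .
    qed
    have N'0: "dot c = (\<Oplus>s\<in>T. c s \<otimes> x s)" if "c \<in> N'" for c
      using that split[of c] terms[of c] xT by (auto simp: N'_def Pi_iff)
    have killS2: "\<forall>c\<in>S2. (\<Oplus>t\<in>T. c t \<otimes> x t) = \<zero>"
      using kill N'0 S2(2) unfolding dot_def by fastforce
    have dot_N': "dot c = \<zero>" if "c \<in> N'" for c
      using S2(3)[OF xT(1) killS2 that] N'0[OF that] by simp
    define D where "D = {r \<in> carrier R. \<exists>d\<in>N. d t = r \<and> dot d = \<zero>}"
    have "ideal D R"
    proof (rule idealI_cring)
      show "D \<subseteq> carrier R" by (auto simp: D_def)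
      have "dot (\<lambda>t. \<zero>) = \<zero>" using dot_N' insert.prems(2) by (simp add: N'_def)
      then show "\<zero> \<in> D" using insert.prems(2) by (auto simp: D_def intro!: bexI[of _ "\<lambda>t. \<zero>"])
    next
      fix a b assume "a \<in> D" "b \<in> D"
      then obtain c d where "c \<in> N" "d \<in> N" "c t = a" "d t = b" "dot c = \<zero>" "dot d = \<zero>" by (auto simp: D_def)
      then show "a \<oplus> b \<in> D" using insert.prems(3)[of c d] dot_add[of c d] car
        by (auto simp: D_def intro!: bexI[of _ "\<lambda>t. c t \<oplus> d t"])
    next
      fix a r assume "a \<in> D" and r: "r \<in> carrier R"
      then obtain c where "c \<in> N" "c t = a" "dot c = \<zero>" by (auto simp: D_def)
      then show "r \<otimes> a \<in> D" using insert.prems(4)[OF r, of c] dot_mult[OF r, of c] car r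
        by (auto simp: D_def intro!: bexI[of _ "\<lambda>t. r \<otimes> c t"])
    qed
    moreover have "A \<subseteq> D" using S1 kill car by (auto simp: D_def dot_def)
    ultimately have "I \<subseteq> D" unfolding A(3) by (rule genideal_minimal)
    then obtain d where d: "d \<in> N" "d t = c t" "dot d = \<zero>" using c by (auto simp: I_def D_def)
    let ?m = "\<lambda>s. \<ominus> \<one> \<otimes> d s"
    have m: "?m \<in> N" using insert.prems(4)[OF _ d(1), of "\<ominus> \<one>"] by simp
    have "(\<lambda>s. c s \<oplus> ?m s) \<in> N'"
      using insert.prems(3)[OF c m] d(2) car[OF c] car[OF d(1)] by (simp add: N'_def l_minus r_neg)
    then have "dot c \<oplus> dot ?m = \<zero>" using dot_N' dot_add[OF c m] by simp
    moreover have "dot ?m = \<zero>" using dot_mult[OF _ d(1), of "\<ominus> \<one>"] d(3) by simp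
    ultimately show "(\<Oplus>t\<in>insert t T. c t \<otimes> x t) = \<zero>" using dotc[OF c] by (simp add: dot_def)
  qed
qed

lemma finsum_module_via [simp]: "finsum (module_via h S) f I = finsum S f I"
  by (simp add: finsum_def finprod_def module_via_def)

text \<open>The submodule generated by \<open>G\<close>.  Being inductive it handles families of generators with repetitions, which
finite sums indexed by a set of generators do not.\<close>

inductive_set mspan :: "('c, 'd) ring_scheme \<Rightarrow> ('c, 'x, 'e) module_scheme \<Rightarrow> 'x set \<Rightarrow> 'x set"
  for A M G where
  zero: "\<zero>\<^bsub>M\<^esub> \<in> mspan A M G"
| gen: "g \<in> G \<Longrightarrow> g \<in> mspan A M G"
| add: "u \<in> mspan A M G \<Longrightarrow> v \<in> mspan A M G \<Longrightarrow> u \<oplus>\<^bsub>M\<^esub> v \<in> mspan A M G"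
| smult: "a \<in> carrier A \<Longrightarrow> u \<in> mspan A M G \<Longrightarrow> a \<odot>\<^bsub>M\<^esub> u \<in> mspan A M G"

lemma mspan_mono: "G \<subseteq> H \<Longrightarrow> mspan A M G \<subseteq> mspan A M H"
proof
  fix x assume "G \<subseteq> H" "x \<in> mspan A M G"
  from this(2,1) show "x \<in> mspan A M H"
    by (induction rule: mspan.induct) (auto intro: mspan.intros)
qed

lemma mspan_closed:
  assumes "module A M" "G \<subseteq> carrier M" shows "mspan A M G \<subseteq> carrier M"
proof
  interpret M: module A M by fact
  fix x assume "x \<in> mspan A M G"
  then show "x \<in> carrier M" by (induction rule: mspan.induct) (use assms(2) in auto)
qed

lemma mspan_finsum_closed:
  assumes "module A M" "G \<subseteq> carrier M" "finite I" "\<And>i. i \<in> I \<Longrightarrow> q i \<in> mspan A M G"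
  shows "(\<Oplus>\<^bsub>M\<^esub>i\<in>I. q i) \<in> mspan A M G"
  using assms(3,4)
proof (induction I)
  case empty
  interpret M: module A M by fact
  show ?case by (simp add: mspan.zero)
next
  case (insert i I)
  interpret M: module A M by fact
  have "q j \<in> carrier M" if "j \<in> insert i I" for j
    using mspan_closed[OF assms(1,2)] insert.prems[OF that] by blast
  then have "(\<Oplus>\<^bsub>M\<^esub>i\<in>insert i I. q i) = q i \<oplus>\<^bsub>M\<^esub> (\<Oplus>\<^bsub>M\<^esub>i\<in>I. q i)"
    using insert.hyps by (intro M.finsum_insert) auto
  then show ?case using insert by (simp add: mspan.add)
qed

lemma finsum_lincomb_add:
  assumes M: "module A M" and q: "q \<in> G \<rightarrow> carrier M" and c: "c \<in> G \<rightarrow> carrier A" "d \<in> G \<rightarrow> carrier A"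
  shows "(\<Oplus>\<^bsub>M\<^esub>g\<in>G. (c g \<oplus>\<^bsub>A\<^esub> d g) \<odot>\<^bsub>M\<^esub> q g) = (\<Oplus>\<^bsub>M\<^esub>g\<in>G. c g \<odot>\<^bsub>M\<^esub> q g) \<oplus>\<^bsub>M\<^esub> (\<Oplus>\<^bsub>M\<^esub>g\<in>G. d g \<odot>\<^bsub>M\<^esub> q g)"
proof -
  interpret M: module A M by fact
  have "(\<Oplus>\<^bsub>M\<^esub>g\<in>G. (c g \<oplus>\<^bsub>A\<^esub> d g) \<odot>\<^bsub>M\<^esub> q g) = (\<Oplus>\<^bsub>M\<^esub>g\<in>G. c g \<odot>\<^bsub>M\<^esub> q g \<oplus>\<^bsub>M\<^esub> d g \<odot>\<^bsub>M\<^esub> q g)"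
    using c q by (intro M.finsum_cong') (auto simp: M.smult_l_distr Pi_iff)
  also have "\<dots> = (\<Oplus>\<^bsub>M\<^esub>g\<in>G. c g \<odot>\<^bsub>M\<^esub> q g) \<oplus>\<^bsub>M\<^esub> (\<Oplus>\<^bsub>M\<^esub>g\<in>G. d g \<odot>\<^bsub>M\<^esub> q g)"
    using c q by (intro M.finsum_addf) auto
  finally show ?thesis .
qed

lemma finsum_lincomb_smult:
  assumes M: "module A M" and q: "q \<in> G \<rightarrow> carrier M" "finite G" and c: "c \<in> G \<rightarrow> carrier A" "a \<in> carrier A"
  shows "(\<Oplus>\<^bsub>M\<^esub>g\<in>G. (a \<otimes>\<^bsub>A\<^esub> c g) \<odot>\<^bsub>M\<^esub> q g) = a \<odot>\<^bsub>M\<^esub> (\<Oplus>\<^bsub>M\<^esub>g\<in>G. c g \<odot>\<^bsub>M\<^esub> q g)"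
proof -
  interpret M: module A M by fact
  have "(\<Oplus>\<^bsub>M\<^esub>g\<in>G. (a \<otimes>\<^bsub>A\<^esub> c g) \<odot>\<^bsub>M\<^esub> q g) = (\<Oplus>\<^bsub>M\<^esub>g\<in>G. a \<odot>\<^bsub>M\<^esub> (c g \<odot>\<^bsub>M\<^esub> q g))"
    using c q by (intro M.finsum_cong') (auto simp: M.smult_assoc1 Pi_iff)
  also have "\<dots> = a \<odot>\<^bsub>M\<^esub> (\<Oplus>\<^bsub>M\<^esub>g\<in>G. c g \<odot>\<^bsub>M\<^esub> q g)"
    using c q by (intro M.finsum_smult_ldistr[symmetric]) auto
  finally show ?thesis .
qed

lemma finsum_lincomb_single:
  assumes M: "module A M" and q: "q \<in> G \<rightarrow> carrier M" "finite G" and h: "h \<in> G" "a \<in> carrier A"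
  shows "(\<Oplus>\<^bsub>M\<^esub>g\<in>G. (if h = g then a else \<zero>\<^bsub>A\<^esub>) \<odot>\<^bsub>M\<^esub> q g) = a \<odot>\<^bsub>M\<^esub> q h"
proof -
  interpret M: module A M by fact
  have "(\<Oplus>\<^bsub>M\<^esub>g\<in>G. (if h = g then a else \<zero>\<^bsub>A\<^esub>) \<odot>\<^bsub>M\<^esub> q g) = (\<Oplus>\<^bsub>M\<^esub>g\<in>G. if h = g then a \<odot>\<^bsub>M\<^esub> q g else \<zero>\<^bsub>M\<^esub>)"
    using q h(2) by (intro M.finsum_cong') (auto simp: Pi_iff)
  also have "\<dots> = a \<odot>\<^bsub>M\<^esub> q h" by (rule M.finsum_singleton[OF h(1) q(2)]) (use q h(2) in auto)
  finally show ?thesis .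
qed

lemma mspan_imp_lincomb:
  assumes M: "module A M" and G: "G \<subseteq> carrier M" "finite G" and x: "x \<in> mspan A M G"
  shows "\<exists>c\<in>G \<rightarrow> carrier A. x = (\<Oplus>\<^bsub>M\<^esub>g\<in>G. c g \<odot>\<^bsub>M\<^esub> g)"
proof -
  have id: "(\<lambda>g. g) \<in> G \<rightarrow> carrier M" using G(1) by blast
  show ?thesis
  using x
proof (induction rule: mspan.induct)
  case zero
  interpret M: module A M by fact
  have "(\<Oplus>\<^bsub>M\<^esub>g\<in>G. \<zero>\<^bsub>A\<^esub> \<odot>\<^bsub>M\<^esub> g) = \<zero>\<^bsub>M\<^esub>"
    using G by (intro M.add.finprod_one_eqI) auto
  then show ?case by (intro bexI[of _ "\<lambda>g. \<zero>\<^bsub>A\<^esub>"]) auto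
next
  case (gen h)
  interpret M: module A M by fact
  have "(\<Oplus>\<^bsub>M\<^esub>g\<in>G. (if h = g then \<one>\<^bsub>A\<^esub> else \<zero>\<^bsub>A\<^esub>) \<odot>\<^bsub>M\<^esub> g) = h"
    using finsum_lincomb_single[OF M id G(2) gen, of "\<one>\<^bsub>A\<^esub>"] G(1) gen by auto
  then show ?case by (intro bexI[of _ "\<lambda>g. if h = g then \<one>\<^bsub>A\<^esub> else \<zero>\<^bsub>A\<^esub>"]) auto
next
  case (add u v)
  then obtain c d where cd: "c \<in> G \<rightarrow> carrier A" "d \<in> G \<rightarrow> carrier A"
    "u = (\<Oplus>\<^bsub>M\<^esub>g\<in>G. c g \<odot>\<^bsub>M\<^esub> g)" "v = (\<Oplus>\<^bsub>M\<^esub>g\<in>G. d g \<odot>\<^bsub>M\<^esub> g)" by blast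
  interpret M: module A M by fact
  show ?case using finsum_lincomb_add[OF M id cd(1,2)] cd
    by (intro bexI[of _ "\<lambda>g. c g \<oplus>\<^bsub>A\<^esub> d g"]) auto
next
  case (smult a u)
  then obtain c where c: "c \<in> G \<rightarrow> carrier A" "u = (\<Oplus>\<^bsub>M\<^esub>g\<in>G. c g \<odot>\<^bsub>M\<^esub> g)" by blast
  interpret M: module A M by fact
  show ?case using finsum_lincomb_smult[OF M id G(2) c(1) smult(1)] c smult(1)
    by (intro bexI[of _ "\<lambda>g. a \<otimes>\<^bsub>A\<^esub> c g"]) auto
qed
qed

context witt_vectors
begin

lemma frobenius_pow_hom: "(\<lambda>r. r [^] (p ^ e)) \<in> ring_hom R R"
proof -
  interpret F: ring_hom_cring R R "\<lambda>r. r [^] p" by (rule frobenius_hom)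
  show ?thesis
  proof (induction e)
    case 0
    then show ?case by (intro ring_hom_memI) auto
  next
    case (Suc e)
    have "(\<lambda>r. r [^] p) \<circ> (\<lambda>r. r [^] (p ^ e)) \<in> ring_hom R R"
      by (rule ring_hom_trans[OF Suc F.homh])
    then show ?case
      by (rule ring_hom_restrict) (simp add: nat_pow_pow mult.commute)
  qed
qed

abbreviation "frob_mod e \<equiv> module_via (\<lambda>r. r [^] (p ^ e)) R"

lemma module_frob_mod: "module R (frob_mod e)"
  by (rule module_module_via[OF is_cring is_cring frobenius_pow_hom])

text \<open>If \<open>h\<close> runs over generators for \<open>e\<close> and \<open>g\<close> over generators for $1$, the products \<open>h\<^sup>p g\<close> are generators for
\<open>e + 1\<close>.\<close>

lemma F_finite_iterate:
  assumes "F_finite p R"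
  shows "\<exists>G. finite G \<and> G \<subseteq> carrier R \<and> carrier R \<subseteq> mspan R (frob_mod e) G"
proof (induction e)
  case 0
  have "x \<in> mspan R (frob_mod 0) {\<one>}" if "x \<in> carrier R" for x
    using mspan.smult[OF that mspan.gen[of \<one> "{\<one>}" R "frob_mod 0"]] that by simp
  then show ?case by (intro exI[of _ "{\<one>}"]) auto
next
  case (Suc e)
  then obtain H where H: "finite H" "H \<subseteq> carrier R" "carrier R \<subseteq> mspan R (frob_mod e) H" by blast
  obtain G where G: "finite G" "G \<subseteq> carrier R"
      "\<And>x. x \<in> carrier R \<Longrightarrow> \<exists>c\<in>G \<rightarrow> carrier R. x = (\<Oplus>g\<in>G. c g [^] p \<otimes> g)"
    using assms by (auto simp: F_finite_def fin_gen_module_def)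
  let ?K = "(\<lambda>(h, g). h [^] p \<otimes> g) ` (H \<times> G)"
  have K: "?K \<subseteq> carrier R" using G(2) H(2) by auto
  have cg: "c [^] p \<otimes> g \<in> mspan R (frob_mod (Suc e)) ?K" if g: "g \<in> G" and c: "c \<in> mspan R (frob_mod e) H" for c g
    using c
  proof (induction c rule: mspan.induct)
    case zero
    have "\<zero> [^] p \<otimes> g = \<zero>" using p_pos g G(2) by (auto simp: nat_pow_zero)
    then show ?case using mspan.zero[of "frob_mod (Suc e)" R ?K] by simp
  next
    case (gen h)
    then show ?case using g by (intro mspan.gen) auto
  next
    case (add u v)
    have uv: "u \<in> carrier R" "v \<in> carrier R"
      using mspan_closed[OF module_frob_mod, of H e] H(2) add.hyps by auto
    then have "(u \<oplus> v) [^] p \<otimes> g = (u [^] p \<otimes> g) \<oplus> (v [^] p \<otimes> g)"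
      using g G(2) by (auto simp: frobenius_add l_distr)
    then show ?case using mspan.add[OF add.IH] by simp
  next
    case (smult a u)
    have u: "u \<in> carrier R"
      using mspan_closed[OF module_frob_mod, of H e] H(2) smult.hyps by auto
    then have "(a [^] (p ^ e) \<otimes> u) [^] p \<otimes> g = a [^] (p ^ Suc e) \<otimes> (u [^] p \<otimes> g)"
      using smult.hyps(1) g G(2) by (auto simp: nat_pow_distrib nat_pow_pow m_assoc mult.commute)
    then show ?case using mspan.smult[OF smult.hyps(1) smult.IH] by simp
  qed
  have "x \<in> mspan R (frob_mod (Suc e)) ?K" if xc: "x \<in> carrier R" for x
  proof -
    obtain c where c: "c \<in> G \<rightarrow> carrier R" "x = (\<Oplus>g\<in>G. c g [^] p \<otimes> g)" using G(3)[OF xc] by blast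
    have "(\<Oplus>\<^bsub>frob_mod (Suc e)\<^esub>g\<in>G. c g [^] p \<otimes> g) \<in> mspan R (frob_mod (Suc e)) ?K"
      by (rule mspan_finsum_closed[OF module_frob_mod _ G(1)]) (use K c(1) H(3) cg in auto)
    then show ?thesis unfolding c(2) by simp
  qed
  then show ?case using G(1) H(1) K by (intro exI[of _ ?K]) auto
qed

text \<open>The image of \<open>V\<^sup>i\<close>.\<close>

definition V_fil :: "nat \<Rightarrow> (nat \<Rightarrow> 'a) set" where
  "V_fil i = {\<beta> \<in> carrier W. \<forall>j<i. \<beta> j = \<zero>}"

abbreviation "FW \<equiv> module_via (witt_frob p n R) W"

lemma module_FW: "module W FW"
  by (rule module_module_via[OF cring_W cring_W witt_frob_hom])

text \<open>Descending induction along the filtration: the Teichmueller representative of \<open>r\<close> multiplies coordinate $i$ of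
\<open>F\<^sub>*W\<^sub>n(R)\<close> by \<open>r\<close> to the power \<open>p\<^sup>i\<^sup>+\<^sup>1\<close>, so generators of $R$ over these powers, placed at position $i$,
adjust this coordinate.\<close>

lemma F_finite_imp_fin_gen_FW:
  assumes "F_finite p R"
  shows "\<exists>T. finite T \<and> T \<subseteq> carrier W \<and> carrier W \<subseteq> mspan W FW T"
proof -
  have "\<exists>T. finite T \<and> T \<subseteq> carrier W \<and> V_fil (n - k) \<subseteq> mspan W FW T" if "k \<le> n" for k
    using that
  proof (induction k)
    case 0
    have "V_fil n \<subseteq> {\<zero>\<^bsub>W\<^esub>}"
    proof
      fix \<beta> assume "\<beta> \<in> V_fil n"
      then have "\<beta> = \<zero>\<^bsub>W\<^esub>" by (intro W_eqI) (auto simp: V_fil_def witt_ring_def)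
      then show "\<beta> \<in> {\<zero>\<^bsub>W\<^esub>}" by simp
    qed
    then show ?case using mspan.zero[of FW W "{}"] by (intro exI[of _ "{}"]) auto
  next
    case (Suc k)
    then obtain T where T: "finite T" "T \<subseteq> carrier W" "V_fil (n - k) \<subseteq> mspan W FW T" by auto
    define i where "i = n - Suc k"
    have i: "i < n" "n - k = Suc i" using Suc.prems by (auto simp: i_def)
    obtain G where G: "finite G" "G \<subseteq> carrier R" "carrier R \<subseteq> mspan R (frob_mod (Suc i)) G"
      using F_finite_iterate[OF assms] by blast
    define \<delta> where "\<delta> h = (\<lambda>k\<in>{..<n}. if k = i then h else \<zero>)" for h
    let ?T = "T \<union> \<delta> ` G"
    have \<delta>: "\<delta> h \<in> V_fil i" if "h \<in> carrier R" for h
      using that i by (auto simp: \<delta>_def V_fil_def carrier_W)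
    have Tc: "?T \<subseteq> carrier W" using T(2) \<delta> G(2) by (auto simp: V_fil_def)
    have hit: "\<exists>\<epsilon>\<in>mspan W FW ?T. \<epsilon> \<in> V_fil i \<and> \<epsilon> i = b" if "b \<in> mspan R (frob_mod (Suc i)) G" for b
      using that
    proof (induction b rule: mspan.induct)
      case zero
      have "\<zero>\<^bsub>W\<^esub> \<in> V_fil i" "\<zero>\<^bsub>W\<^esub> i = \<zero>" using i W.zero_closed by (auto simp: V_fil_def witt_ring_def)
      then show ?case using mspan.zero[of FW W ?T] by (intro bexI[of _ "\<zero>\<^bsub>W\<^esub>"]) auto
    next
      case (gen h)
      have "\<delta> h \<in> mspan W FW ?T" using gen by (intro mspan.gen) auto
      moreover have "\<delta> h i = h" using i by (simp add: \<delta>_def)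
      ultimately show ?case using \<delta>[of h] gen G(2) by blast
    next
      case (add u v)
      then obtain \<epsilon> \<eta> where *: "\<epsilon> \<in> mspan W FW ?T" "\<eta> \<in> mspan W FW ?T" "\<epsilon> \<in> V_fil i" "\<eta> \<in> V_fil i" "\<epsilon> i = u" "\<eta> i = v"
        by blast
      have low: "(\<epsilon> \<oplus>\<^bsub>W\<^esub> \<eta>) j = \<epsilon> j \<oplus> \<eta> j" if "j \<le> i" for j
        by (rule W_add_low) (use * i that in \<open>auto simp: V_fil_def\<close>)
      have "\<epsilon> \<oplus>\<^bsub>W\<^esub> \<eta> \<in> V_fil i" using low * by (auto simp: V_fil_def)
      moreover have "\<epsilon> \<oplus>\<^bsub>W\<^esub> \<eta> \<in> mspan W FW ?T" using mspan.add[OF *(1,2)] by simp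
      ultimately show ?case using low[of i] * by (intro bexI[of _ "\<epsilon> \<oplus>\<^bsub>W\<^esub> \<eta>"]) auto
    next
      case (smult r u)
      then obtain \<epsilon> where *: "\<epsilon> \<in> mspan W FW ?T" "\<epsilon> \<in> V_fil i" "\<epsilon> i = u" by blast
      let ?\<eta> = "teichmuller n R (r [^] p) \<otimes>\<^bsub>W\<^esub> \<epsilon>"
      have \<epsilon>: "\<epsilon> \<in> carrier W" using * by (simp add: V_fil_def)
      have co: "?\<eta> j = (r [^] p) [^] (p ^ j) \<otimes> \<epsilon> j" if "j < n" for j
        using teichmuller_mult[OF _ \<epsilon> that] smult.hyps(1) by simp
      have "?\<eta> \<in> V_fil i"
        using co * i smult.hyps(1) \<epsilon> by (auto simp: V_fil_def)
      moreover have "?\<eta> i = r [^] (p ^ Suc i) \<otimes> u"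
        using co[OF i(1)] * smult.hyps(1) by (simp add: nat_pow_pow)
      moreover have "?\<eta> \<in> mspan W FW ?T"
        using mspan.smult[OF teichmuller_closed[OF smult.hyps(1)] *(1)] by (simp add: witt_frob_teichmuller)
      ultimately show ?case by (intro bexI[of _ ?\<eta>]) auto
    qed
    have "\<beta> \<in> mspan W FW ?T" if \<beta>: "\<beta> \<in> V_fil i" for \<beta>
    proof -
      have \<beta>c: "\<beta> \<in> carrier W" using \<beta> by (simp add: V_fil_def)
      have "\<beta> i \<in> mspan R (frob_mod (Suc i)) G" using W_coord_closed[OF \<beta>c i(1)] G(3) by blast
      then obtain \<epsilon> where \<epsilon>: "\<epsilon> \<in> mspan W FW ?T" "\<epsilon> \<in> V_fil i" "\<epsilon> i = \<beta> i" using hit by blast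
      have \<epsilon>c: "\<epsilon> \<in> carrier W" using \<epsilon> by (simp add: V_fil_def)
      have "\<beta> j = \<epsilon> j" if "j < Suc i" for j using that \<epsilon> \<beta> by (cases "j = i") (auto simp: V_fil_def)
      then have "\<beta> \<ominus>\<^bsub>W\<^esub> \<epsilon> \<in> V_fil (Suc i)"
        using W_diff_low[OF \<beta>c \<epsilon>c, of "Suc i"] i \<beta>c \<epsilon>c by (auto simp: V_fil_def)
      then have "\<beta> \<ominus>\<^bsub>W\<^esub> \<epsilon> \<in> mspan W FW ?T" using T(3) i(2) mspan_mono[of T ?T W FW] by auto
      from mspan.add[OF this \<epsilon>(1)] show ?thesis
        using \<beta>c \<epsilon>c by (simp add: W.minus_eq W.a_assoc W.l_neg)
    qed
    then show ?case using T(1) G(1) Tc unfolding i_def by (intro exI[of _ ?T]) auto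
  qed
  from this[of n] show ?thesis by (simp add: V_fil_def)
qed

end

section \<open>Splitting and purity\<close>

lemma (in cring) ideal_coset_eq_iff:
  assumes I: "ideal I R" and x: "x \<in> carrier R" and y: "y \<in> carrier R"
  shows "I +> x = I +> y \<longleftrightarrow> x \<ominus> y \<in> I"
proof -
  note ops = ideal_ops[OF I]
  have mem: "z \<in> I +> w \<longleftrightarrow> z \<ominus> w \<in> I" if z: "z \<in> carrier R" and w: "w \<in> carrier R" for z w
  proof
    assume "z \<in> I +> w"
    then obtain i where i: "i \<in> I" "z = i \<oplus> w" by (auto simp: a_r_coset_def')
    then have "z \<ominus> w = i" using w ops(6) by (simp add: minus_eq a_assoc r_neg)
    then show "z \<ominus> w \<in> I" using i(1) by simp
  next
    assume zw: "z \<ominus> w \<in> I"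
    have "z = (z \<ominus> w) \<oplus> w" using z w by (simp add: minus_eq a_assoc l_neg)
    then show "z \<in> I +> w" unfolding a_r_coset_def' using zw by blast
  qed
  show ?thesis
  proof
    assume "I +> x = I +> y"
    moreover have "x \<in> I +> x" using mem[OF x x] x ops(1) by (simp add: minus_eq r_neg)
    ultimately show "x \<ominus> y \<in> I" using mem[OF x y] by simp
  next
    assume xy: "x \<ominus> y \<in> I"
    have sub: "I +> w \<subseteq> carrier R" if "w \<in> carrier R" for w using that ops(7) by (auto simp: a_r_coset_def')
    have "z \<ominus> x \<in> I \<longleftrightarrow> z \<ominus> y \<in> I" if z: "z \<in> carrier R" for z
    proof
      assume "z \<ominus> x \<in> I"
      then have "(z \<ominus> x) \<oplus> (x \<ominus> y) \<in> I" using xy by (rule ops(2))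
      then show "z \<ominus> y \<in> I" using minus_split[OF z x y] by simp
    next
      assume "z \<ominus> y \<in> I"
      then have "(z \<ominus> y) \<ominus> (x \<ominus> y) \<in> I" using xy by (rule ops(4))
      then show "z \<ominus> x \<in> I" using minus_cancel_right[OF z x y] by simp
    qed
    then show "I +> x = I +> y" using mem[OF _ x] mem[OF _ y] sub[OF x] sub[OF y] by blast
  qed
qed

locale witt_vectors_pos = witt_vectors +
  assumes n_pos: "0 < n"
begin

abbreviation "IP \<equiv> witt_p_ideal p n R"
abbreviation "Q \<equiv> Q_module p n R"
abbreviation "base \<equiv> base_module R :: (nat \<Rightarrow> 'a, 'a) module"

definition cl :: "(nat \<Rightarrow> 'a) \<Rightarrow> (nat \<Rightarrow> 'a) set" where
  "cl \<alpha> = IP +>\<^bsub>W\<^esub> \<alpha>"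

lemma IP_ideal: "ideal IP W"
  unfolding witt_p_ideal_def by (rule W.cgenideal_ideal) simp

lemma p_mult_in_IP: "\<gamma> \<in> carrier W \<Longrightarrow> [p] \<cdot>\<^bsub>W\<^esub> \<gamma> \<in> IP"
  unfolding witt_p_ideal_def cgenideal_def
  using W.add_pow_rdistr[of \<gamma> "\<one>\<^bsub>W\<^esub>" p] by force

lemma cring_Wp: "cring (witt_mod_p p n R)"
  unfolding witt_mod_p_def by (rule ideal.quotient_is_cring[OF IP_ideal cring_W])

lemma cl_hom: "cl \<in> ring_hom W (witt_mod_p p n R)"
  unfolding witt_mod_p_def using ideal.rcos_ring_hom[OF IP_ideal] by (simp add: cl_def[abs_def])

lemma frob_cl_hom: "(\<lambda>\<alpha>. cl (witt_frob p n R \<alpha>)) \<in> ring_hom W (witt_mod_p p n R)"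
  using ring_hom_trans[OF witt_frob_hom cl_hom] by (simp add: comp_def)

lemma Q_eq: "Q = module_via (\<lambda>\<alpha>. cl (witt_frob p n R \<alpha>)) (witt_mod_p p n R)"
  by (simp add: Q_module_def cl_def)

lemma module_Q: "module W Q"
  unfolding Q_eq by (rule module_module_via[OF cring_W cring_Wp frob_cl_hom])

lemma coord0_ring_hom: "(\<lambda>\<alpha>. \<alpha> 0) \<in> ring_hom W R"
  by (rule coord0_hom[OF n_pos])

lemma module_base: "module W base"
  unfolding base_module_def by (rule module_module_via[OF cring_W is_cring coord0_ring_hom])

lemma coord0_surj: "(\<lambda>\<alpha>. \<alpha> 0) ` carrier W = carrier R"
proof
  show "(\<lambda>\<alpha>. \<alpha> 0) ` carrier W \<subseteq> carrier R" using W_coord_closed n_pos by auto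
  show "carrier R \<subseteq> (\<lambda>\<alpha>. \<alpha> 0) ` carrier W"
  proof
    fix r assume "r \<in> carrier R"
    then show "r \<in> (\<lambda>\<alpha>. \<alpha> 0) ` carrier W"
      using n_pos by (intro image_eqI[of _ _ "teichmuller n R r"]) (auto simp: teichmuller_def carrier_W)
  qed
qed

lemma teichmuller_0: "teichmuller n R r 0 = r"
  using n_pos by (simp add: teichmuller_def)

lemma carrier_Q: "carrier Q = cl ` carrier W"
  by (auto simp: Q_eq witt_mod_p_def FactRing_def A_RCOSETS_def' cl_def)

lemma cl_eq_iff: "\<alpha> \<in> carrier W \<Longrightarrow> \<beta> \<in> carrier W \<Longrightarrow> cl \<alpha> = cl \<beta> \<longleftrightarrow> \<alpha> \<ominus>\<^bsub>W\<^esub> \<beta> \<in> IP"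
  unfolding cl_def by (rule W.ideal_coset_eq_iff[OF IP_ideal])

lemma base_sel [simp]:
  "carrier base = carrier R" "\<zero>\<^bsub>base\<^esub> = \<zero>" "x \<oplus>\<^bsub>base\<^esub> y = x \<oplus> y" "\<alpha> \<odot>\<^bsub>base\<^esub> x = \<alpha> 0 \<otimes> x"
  "finsum base f I = finsum R f I"
  by (simp_all add: base_module_def)

lemma Q_ops:
  "\<alpha> \<in> carrier W \<Longrightarrow> cl \<alpha> \<in> carrier Q"
  "\<alpha> \<in> carrier W \<Longrightarrow> \<beta> \<in> carrier W \<Longrightarrow> cl \<alpha> \<oplus>\<^bsub>Q\<^esub> cl \<beta> = cl (\<alpha> \<oplus>\<^bsub>W\<^esub> \<beta>)"
  "\<gamma> \<in> carrier W \<Longrightarrow> \<beta> \<in> carrier W \<Longrightarrow> \<gamma> \<odot>\<^bsub>Q\<^esub> cl \<beta> = cl (witt_frob p n R \<gamma> \<otimes>\<^bsub>W\<^esub> \<beta>)"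
  using carrier_Q by (auto simp: Q_eq ring_hom_add[OF cl_hom] ring_hom_mult[OF cl_hom])

lemma cl_mod_hom: "cl \<in> mod_hom W FW Q"
  by (auto simp: mod_hom_def Q_ops)

text \<open>\<open>\<alpha>\<close> and \<open>[\<alpha>\<^sub>0]\<close> differ by a vector with zeroth coordinate zero, whose Frobenius is divisible by $p$.\<close>

lemma Phi_coord0:
  assumes \<alpha>: "\<alpha> \<in> carrier W"
  shows "Phi p n R (\<alpha> 0) = cl (witt_frob p n R \<alpha>)"
proof -
  have r: "\<alpha> 0 \<in> carrier R" using W_coord_closed[OF \<alpha> n_pos] .
  let ?t = "teichmuller n R (\<alpha> 0)"
  have t: "?t \<in> carrier W" using r by simp
  interpret F: ring_hom_cring W W "witt_frob p n R"
    by (intro ring_hom_cringI ring_hom_ringI2 witt_frob_hom cring_W W.ring_axioms)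
  have "(\<alpha> \<ominus>\<^bsub>W\<^esub> ?t) 0 = \<zero>"
    by (rule W_diff_low[OF \<alpha> t, of 1]) (use n_pos in \<open>auto simp: teichmuller_0\<close>)
  then obtain \<gamma> where "\<gamma> \<in> carrier W" "witt_frob p n R (\<alpha> \<ominus>\<^bsub>W\<^esub> ?t) = [p] \<cdot>\<^bsub>W\<^esub> \<gamma>"
    using witt_frob_dvd_p[of "\<alpha> \<ominus>\<^bsub>W\<^esub> ?t"] n_pos \<alpha> t by auto
  then have "witt_frob p n R \<alpha> \<ominus>\<^bsub>W\<^esub> witt_frob p n R ?t \<in> IP"
    using p_mult_in_IP \<alpha> t by (simp add: W.minus_eq)
  then have "cl (witt_frob p n R \<alpha>) = cl (witt_frob p n R ?t)" using cl_eq_iff \<alpha> t by simp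
  then show ?thesis by (simp add: Phi_def cl_def witt_frob_teichmuller)
qed

text \<open>\<open>\<alpha> \<mapsto> F(\<alpha>) mod p\<close> is visibly linear, and \<open>\<Phi>\<close> is what it induces on zeroth coordinates.\<close>

lemma Phi_mod_hom: "Phi p n R \<in> mod_hom W base Q"
proof -
  have rep: "Phi p n R r = cl (witt_frob p n R (teichmuller n R r))" if "r \<in> carrier R" for r
    using Phi_coord0[of "teichmuller n R r"] that by (simp add: teichmuller_0)
  show ?thesis
    unfolding mod_hom_def
  proof (intro CollectI conjI ballI)
    show "Phi p n R \<in> carrier base \<rightarrow> carrier Q" by (auto simp: rep Q_ops)
    fix x y assume xy: "x \<in> carrier base" "y \<in> carrier base"
    let ?x = "teichmuller n R x" and ?y = "teichmuller n R y"
    have "Phi p n R ((?x \<oplus>\<^bsub>W\<^esub> ?y) 0) = cl (witt_frob p n R (?x \<oplus>\<^bsub>W\<^esub> ?y))"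
      using xy by (intro Phi_coord0) simp
    then show "Phi p n R (x \<oplus>\<^bsub>base\<^esub> y) = Phi p n R x \<oplus>\<^bsub>Q\<^esub> Phi p n R y"
      using xy by (simp add: rep Q_ops ring_hom_add[OF coord0_ring_hom] ring_hom_add[OF witt_frob_hom] teichmuller_0)
  next
    fix \<alpha> x assume ax: "\<alpha> \<in> carrier W" "x \<in> carrier base"
    let ?x = "teichmuller n R x"
    have "Phi p n R ((\<alpha> \<otimes>\<^bsub>W\<^esub> ?x) 0) = cl (witt_frob p n R (\<alpha> \<otimes>\<^bsub>W\<^esub> ?x))"
      using ax by (intro Phi_coord0) simp
    then show "Phi p n R (\<alpha> \<odot>\<^bsub>base\<^esub> x) = \<alpha> \<odot>\<^bsub>Q\<^esub> Phi p n R x"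
      using ax by (simp add: rep Q_ops ring_hom_mult[OF coord0_ring_hom] ring_hom_mult[OF witt_frob_hom] teichmuller_0)
  qed
qed

text \<open>A splitting of Frobenius vanishes on multiples of $p = F(V 1)$, so it descends to a retraction of \<open>\<Phi>\<close>.\<close>

lemma split_imp_pure:
  assumes "quasi_F_split p n R" shows "quasi_F_pure U p n R"
proof -
  obtain \<phi> where \<phi>: "\<phi> \<in> mod_hom W FW base" and sec: "\<And>\<alpha>. \<alpha> \<in> carrier W \<Longrightarrow> \<phi> (witt_frob p n R \<alpha>) = \<alpha> 0"
    using assms by (auto simp: quasi_F_split_def)
  note hom = mod_homD[OF \<phi>, simplified]
  have \<phi>p: "\<phi> u = \<zero>" if u: "u \<in> IP" for u
  proof -
    obtain x where x: "x \<in> carrier W" "u = x \<otimes>\<^bsub>W\<^esub> ([p] \<cdot>\<^bsub>W\<^esub> \<one>\<^bsub>W\<^esub>)"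
      using u by (auto simp: witt_p_ideal_def cgenideal_def)
    obtain \<gamma> where \<gamma>: "\<gamma> \<in> carrier W" "\<gamma> 0 = \<zero>" "witt_frob p n R \<gamma> = [p] \<cdot>\<^bsub>W\<^esub> \<one>\<^bsub>W\<^esub>"
      using p_one_eq_frob_shift[OF n_pos] by blast
    have "u = witt_frob p n R \<gamma> \<otimes>\<^bsub>W\<^esub> x" using x \<gamma> by (simp add: W.m_comm)
    then show ?thesis using hom(3)[OF \<gamma>(1) x(1)] hom(1)[OF x(1)] \<gamma>(2) by simp
  qed
  have \<phi>cl: "\<phi> \<alpha> = \<phi> \<beta>" if ab: "\<alpha> \<in> carrier W" "\<beta> \<in> carrier W" "cl \<alpha> = cl \<beta>" for \<alpha> \<beta>
  proof -
    have "\<alpha> = (\<alpha> \<ominus>\<^bsub>W\<^esub> \<beta>) \<oplus>\<^bsub>W\<^esub> \<beta>" using ab by (simp add: W.minus_eq W.a_assoc W.l_neg)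
    then have "\<phi> \<alpha> = \<phi> (\<alpha> \<ominus>\<^bsub>W\<^esub> \<beta>) \<oplus> \<phi> \<beta>" using hom(2)[of "\<alpha> \<ominus>\<^bsub>W\<^esub> \<beta>" \<beta>] ab by simp
    then show ?thesis using \<phi>p cl_eq_iff ab hom(1) by simp
  qed
  define \<psi> where "\<psi> x = \<phi> (inv_into (carrier W) cl x)" for x
  have \<psi>: "\<psi> (cl \<alpha>) = \<phi> \<alpha>" if "\<alpha> \<in> carrier W" for \<alpha>
  proof -
    have im: "cl \<alpha> \<in> cl ` carrier W" using that by (rule imageI)
    show ?thesis
      unfolding \<psi>_def by (rule \<phi>cl[OF inv_into_into[OF im] that f_inv_into_f[OF im]])
  qed
  have "\<psi> \<in> mod_hom W Q base"
    by (auto simp: mod_hom_def carrier_Q Q_ops \<psi> hom)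
  moreover have "\<psi> (Phi p n R r) = r" if r: "r \<in> carrier R" for r
    using Phi_coord0[of "teichmuller n R r"] \<psi> sec r by (simp add: teichmuller_0)
  ultimately show ?thesis
    unfolding quasi_F_pure_def by (intro retract_imp_pure_hom[OF module_base module_Q Phi_mod_hom]) auto
qed

text \<open>Linearity and additivity in one equation, of the shape in which solutions of systems provide it.\<close>

lemma quasi_F_splitI:
  assumes f: "\<And>\<alpha>. \<alpha> \<in> carrier W \<Longrightarrow> f \<alpha> \<in> carrier R" and one: "f \<one>\<^bsub>W\<^esub> = \<one>"
    and lin: "\<And>\<gamma> \<alpha> \<beta>. \<gamma> \<in> carrier W \<Longrightarrow> \<alpha> \<in> carrier W \<Longrightarrow> \<beta> \<in> carrier W \<Longrightarrow>
      f (witt_frob p n R \<gamma> \<otimes>\<^bsub>W\<^esub> \<alpha> \<oplus>\<^bsub>W\<^esub> \<beta>) = \<gamma> 0 \<otimes> f \<alpha> \<oplus> f \<beta>"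
  shows "quasi_F_split p n R"
proof -
  have one0: "\<one>\<^bsub>W\<^esub> 0 = \<one>" using ring_hom_one[OF coord0_ring_hom] by simp
  have Fone: "witt_frob p n R \<one>\<^bsub>W\<^esub> = \<one>\<^bsub>W\<^esub>" using ring_hom_one[OF witt_frob_hom] .
  have add: "f (\<alpha> \<oplus>\<^bsub>W\<^esub> \<beta>) = f \<alpha> \<oplus> f \<beta>" if "\<alpha> \<in> carrier W" "\<beta> \<in> carrier W" for \<alpha> \<beta>
    using lin[of "\<one>\<^bsub>W\<^esub>" \<alpha> \<beta>] that f by (simp add: one0 Fone)
  have "f \<zero>\<^bsub>W\<^esub> \<oplus> f \<zero>\<^bsub>W\<^esub> = f \<zero>\<^bsub>W\<^esub>" using add[of "\<zero>\<^bsub>W\<^esub>" "\<zero>\<^bsub>W\<^esub>"] by simp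
  then have zero: "f \<zero>\<^bsub>W\<^esub> = \<zero>" using f[of "\<zero>\<^bsub>W\<^esub>"] by simp
  have smult: "f (witt_frob p n R \<gamma> \<otimes>\<^bsub>W\<^esub> \<alpha>) = \<gamma> 0 \<otimes> f \<alpha>" if "\<gamma> \<in> carrier W" "\<alpha> \<in> carrier W" for \<gamma> \<alpha>
    using lin[OF that W.zero_closed] that f W_coord_closed[OF that(1) n_pos] by (simp add: zero)
  have "f \<in> mod_hom W FW base" by (auto simp: mod_hom_def f add smult)
  moreover have "f (witt_frob p n R \<alpha>) = \<alpha> 0" if "\<alpha> \<in> carrier W" for \<alpha>
    using smult[OF that W.one_closed] that one W_coord_closed[OF that n_pos] by simp
  ultimately show ?thesis unfolding quasi_F_split_def by blast
qed

lemma pure_solves: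
  fixes emb :: "'a \<Rightarrow> 'u" and J :: "'j set"
  assumes pure: "quasi_F_pure TYPE('u) p n R" and inf: "infinite (UNIV :: 'u set)" and emb: "inj_on emb (carrier R)"
    and "finite I" "finite J" "\<And>j i. j \<in> J \<Longrightarrow> i \<in> I \<Longrightarrow> c j i \<in> carrier W" "b \<in> J \<rightarrow> carrier R"
    and "q \<in> I \<rightarrow> carrier Q" "\<And>j. j \<in> J \<Longrightarrow> (\<Oplus>\<^bsub>Q\<^esub>i\<in>I. c j i \<odot>\<^bsub>Q\<^esub> q i) = Phi p n R (b j)"
  shows "\<exists>y\<in>I \<rightarrow> carrier R. \<forall>j\<in>J. (\<Oplus>i\<in>I. c j i 0 \<otimes> y i) = b j"
  by (rule pure_hom_solves_system[OF cring_W is_cring coord0_ring_hom coord0_surj module_Q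
        pure[unfolded quasi_F_pure_def base_module_def] inf emb assms(4-)])

text \<open>The linear equation \<open>\<Sum>\<^sub>\<alpha> c\<^sub>\<alpha> x\<^sub>\<alpha> = b\<close> in unknowns indexed by Witt vectors, with the requirement that the
classes \<open>x\<^sub>\<alpha> = \<alpha> mod p\<close> satisfy it in \<open>Q\<close>.\<close>

definition valid_eq :: "(nat \<Rightarrow> 'a) set \<Rightarrow> ((nat \<Rightarrow> 'a) \<Rightarrow> nat \<Rightarrow> 'a) \<Rightarrow> 'a \<Rightarrow> bool" where
  "valid_eq V c b \<longleftrightarrow> finite V \<and> V \<subseteq> carrier W \<and> c \<in> V \<rightarrow> carrier W \<and> b \<in> carrier R \<and>
     (\<Oplus>\<^bsub>Q\<^esub>\<alpha>\<in>V. c \<alpha> \<odot>\<^bsub>Q\<^esub> cl \<alpha>) = Phi p n R b"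

definition solves :: "((nat \<Rightarrow> 'a) \<Rightarrow> 'a) \<Rightarrow> (nat \<Rightarrow> 'a) set \<Rightarrow> ((nat \<Rightarrow> 'a) \<Rightarrow> nat \<Rightarrow> 'a) \<Rightarrow> 'a \<Rightarrow> bool" where
  "solves f V c b \<longleftrightarrow> (\<Oplus>\<alpha>\<in>V. c \<alpha> 0 \<otimes> f \<alpha>) = b"

text \<open>The coefficients of a three-term equation are written as a sum of indicator functions, which stays correct if some of
the unknowns coincide.\<close>

lemma finsum_three_terms:
  assumes M: "module W M" and q: "q \<in> V \<rightarrow> carrier M" "finite V" and abd: "a \<in> V" "b \<in> V" "d \<in> V"
    and stu: "s \<in> carrier W" "t \<in> carrier W" "u \<in> carrier W"
  shows "(\<Oplus>\<^bsub>M\<^esub>x\<in>V. ((if a = x then s else \<zero>\<^bsub>W\<^esub>) \<oplus>\<^bsub>W\<^esub> ((if b = x then t else \<zero>\<^bsub>W\<^esub>) \<oplus>\<^bsub>W\<^esub>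
      (if d = x then u else \<zero>\<^bsub>W\<^esub>))) \<odot>\<^bsub>M\<^esub> q x) = s \<odot>\<^bsub>M\<^esub> q a \<oplus>\<^bsub>M\<^esub> (t \<odot>\<^bsub>M\<^esub> q b \<oplus>\<^bsub>M\<^esub> u \<odot>\<^bsub>M\<^esub> q d)"
  using stu finsum_lincomb_add[OF M q(1), of "\<lambda>x. if a = x then s else \<zero>\<^bsub>W\<^esub>"
      "\<lambda>x. (if b = x then t else \<zero>\<^bsub>W\<^esub>) \<oplus>\<^bsub>W\<^esub> (if d = x then u else \<zero>\<^bsub>W\<^esub>)"]
    finsum_lincomb_add[OF M q(1), of "\<lambda>x. if b = x then t else \<zero>\<^bsub>W\<^esub>" "\<lambda>x. if d = x then u else \<zero>\<^bsub>W\<^esub>"]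
  by (simp add: finsum_lincomb_single[OF M q] abd)

text \<open>The equations \<open>x\<^sub>\<delta> = \<gamma> x\<^sub>\<alpha> + x\<^sub>\<beta>\<close> for \<open>\<delta> = F(\<gamma>) \<alpha> + \<beta>\<close> and \<open>x\<^sub>1 = 1\<close> are valid, and they express that \<open>f\<close> is a
splitting.\<close>

lemma solves_all_imp_split:
  assumes f: "f \<in> UNIV \<rightarrow> carrier R" and sol: "\<And>V c b. valid_eq V c b \<Longrightarrow> solves f V c b"
  shows "quasi_F_split p n R"
proof (rule quasi_F_splitI)
  show fc: "f \<alpha> \<in> carrier R" for \<alpha> using f by auto
  interpret Q: module W Q by (rule module_Q)
  interpret B: module W base by (rule module_base)
  have one0: "\<one>\<^bsub>W\<^esub> 0 = \<one>" using ring_hom_one[OF coord0_ring_hom] by simp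
  have Phi1: "Phi p n R \<one> = cl \<one>\<^bsub>W\<^esub>"
    using Phi_coord0[of "\<one>\<^bsub>W\<^esub>"] ring_hom_one[OF witt_frob_hom] by (simp add: one0)
  have Phi0: "Phi p n R \<zero> = \<zero>\<^bsub>Q\<^esub>" using mod_hom_zero[OF module_base module_Q Phi_mod_hom] by simp
  have "valid_eq {\<one>\<^bsub>W\<^esub>} (\<lambda>x. \<one>\<^bsub>W\<^esub>) \<one>"
    using Q_ops(1)[of "\<one>\<^bsub>W\<^esub>"] by (simp add: valid_eq_def Phi1)
  from sol[OF this] show "f \<one>\<^bsub>W\<^esub> = \<one>" using fc by (simp add: solves_def one0)
  fix \<gamma> \<alpha> \<beta> assume abg: "\<gamma> \<in> carrier W" "\<alpha> \<in> carrier W" "\<beta> \<in> carrier W"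
  let ?\<delta> = "witt_frob p n R \<gamma> \<otimes>\<^bsub>W\<^esub> \<alpha> \<oplus>\<^bsub>W\<^esub> \<beta>"
  have \<delta>: "?\<delta> \<in> carrier W" using abg by simp
  let ?V = "{?\<delta>, \<alpha>, \<beta>}" and ?m = "\<ominus>\<^bsub>W\<^esub> \<one>\<^bsub>W\<^esub>"
  let ?c = "\<lambda>x. (if ?\<delta> = x then ?m else \<zero>\<^bsub>W\<^esub>) \<oplus>\<^bsub>W\<^esub> ((if \<alpha> = x then \<gamma> else \<zero>\<^bsub>W\<^esub>) \<oplus>\<^bsub>W\<^esub>
      (if \<beta> = x then \<one>\<^bsub>W\<^esub> else \<zero>\<^bsub>W\<^esub>))"
  have stu: "?m \<in> carrier W" "\<gamma> \<in> carrier W" "\<one>\<^bsub>W\<^esub> \<in> carrier W" using abg by auto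
  have sum: "(\<Oplus>\<^bsub>M\<^esub>x\<in>?V. ?c x \<odot>\<^bsub>M\<^esub> q x) = ?m \<odot>\<^bsub>M\<^esub> q ?\<delta> \<oplus>\<^bsub>M\<^esub> (\<gamma> \<odot>\<^bsub>M\<^esub> q \<alpha> \<oplus>\<^bsub>M\<^esub> \<one>\<^bsub>W\<^esub> \<odot>\<^bsub>M\<^esub> q \<beta>)"
    if "module W M" "q \<in> ?V \<rightarrow> carrier M" for M :: "(nat \<Rightarrow> 'a, 'y, 'z) module_scheme" and q
    by (rule finsum_three_terms[OF that _ _ _ _ stu]) auto
  have "(\<Oplus>\<^bsub>Q\<^esub>x\<in>?V. ?c x \<odot>\<^bsub>Q\<^esub> cl x) = ?m \<odot>\<^bsub>Q\<^esub> cl ?\<delta> \<oplus>\<^bsub>Q\<^esub> cl ?\<delta>"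
    by (subst sum[OF module_Q]) (use abg \<delta> in \<open>auto simp: Q_ops ring_hom_one[OF witt_frob_hom]\<close>)
  also have "\<dots> = \<zero>\<^bsub>Q\<^esub>"
    using Q_ops(1)[OF \<delta>] by (simp add: Q.smult_l_minus Q.l_neg)
  finally have "valid_eq ?V ?c \<zero>" using abg \<delta> by (auto simp: valid_eq_def Phi0)
  from sol[OF this] have "(\<Oplus>\<^bsub>base\<^esub>x\<in>?V. ?c x \<odot>\<^bsub>base\<^esub> f x) = \<zero>" by (simp add: solves_def)
  then have "?m \<odot>\<^bsub>base\<^esub> f ?\<delta> \<oplus> (\<gamma> 0 \<otimes> f \<alpha> \<oplus> f \<beta>) = \<zero>"
    by (subst (asm) sum[OF module_base]) (use fc in \<open>auto simp: one0\<close>)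
  moreover have "?m \<odot>\<^bsub>base\<^esub> f ?\<delta> = \<ominus> f ?\<delta>"
  proof -
    have "?m 0 \<oplus> \<one>\<^bsub>W\<^esub> 0 = (?m \<oplus>\<^bsub>W\<^esub> \<one>\<^bsub>W\<^esub>) 0"
      using ring_hom_add[OF coord0_ring_hom, of ?m "\<one>\<^bsub>W\<^esub>"] by simp
    also have "\<dots> = \<zero>" using n_pos by (simp add: W.l_neg) (simp add: witt_ring_def)
    finally have "?m 0 = \<ominus> \<one>" using W_coord_closed[OF stu(1) n_pos] by (simp add: one0 minus_equality)
    then show ?thesis using fc by (simp add: l_minus)
  qed
  moreover have "\<gamma> 0 \<otimes> f \<alpha> \<oplus> f \<beta> \<in> carrier R" using W_coord_closed[OF abg(1) n_pos] fc by simp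
  ultimately have s: "\<ominus> f ?\<delta> \<oplus> (\<gamma> 0 \<otimes> f \<alpha> \<oplus> f \<beta>) = \<zero>" "\<gamma> 0 \<otimes> f \<alpha> \<oplus> f \<beta> \<in> carrier R"
    by simp_all
  show "f ?\<delta> = \<gamma> 0 \<otimes> f \<alpha> \<oplus> f \<beta>"
    using r_neg2[OF fc[of ?\<delta>] s(2)] fc[of ?\<delta>] unfolding s(1) by simp
qed

lemma affine_solution_set:
  assumes nl: "noetherian_local R \<mm>" and v: "valid_eq V c b"
  shows "noetherian_local.affine_set R {f \<in> UNIV \<rightarrow> carrier R. solves f V c b}"
proof -
  interpret noetherian_local R \<mm> by (rule nl)
  have V: "finite V" "\<And>x. x \<in> V \<Longrightarrow> c x 0 \<in> carrier R" "b \<in> carrier R"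
    using v W_coord_closed n_pos by (auto simp: valid_eq_def)
  show ?thesis
    unfolding affine_set_def
  proof (intro conjI ballI)
    show "{f \<in> UNIV \<rightarrow> carrier R. solves f V c b} \<subseteq> UNIV \<rightarrow> carrier R" by blast
    fix f g h r
    assume fgh: "f \<in> {f \<in> UNIV \<rightarrow> carrier R. solves f V c b}" "g \<in> {f \<in> UNIV \<rightarrow> carrier R. solves f V c b}"
      "h \<in> {f \<in> UNIV \<rightarrow> carrier R. solves f V c b}" and r: "r \<in> carrier R"
    then have cc: "f x \<in> carrier R" "g x \<in> carrier R" "h x \<in> carrier R" for x by auto
    let ?S = "\<lambda>f. \<Oplus>x\<in>V. c x 0 \<otimes> f x"
    have S: "?S f = b" "?S g = b" "?S h = b" using fgh by (auto simp: solves_def)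
    have "?S (\<lambda>x. f x \<oplus> r \<otimes> (g x \<ominus> h x)) =
        (\<Oplus>x\<in>V. c x 0 \<otimes> f x \<oplus> (r \<otimes> (c x 0 \<otimes> g x) \<oplus> (\<ominus> r) \<otimes> (c x 0 \<otimes> h x)))"
    proof (rule finsum_cong')
      fix x assume x: "x \<in> V"
      show "c x 0 \<otimes> (f x \<oplus> r \<otimes> (g x \<ominus> h x)) = c x 0 \<otimes> f x \<oplus> (r \<otimes> (c x 0 \<otimes> g x) \<oplus> (\<ominus> r) \<otimes> (c x 0 \<otimes> h x))"
        using V(2)[OF x] cc[of x] r by (simp add: minus_eq r_distr l_minus r_minus m_lcomm)
    qed (use V(2) cc r in auto)
    also have "\<dots> = ?S f \<oplus> ((\<Oplus>x\<in>V. r \<otimes> (c x 0 \<otimes> g x)) \<oplus> (\<Oplus>x\<in>V. (\<ominus> r) \<otimes> (c x 0 \<otimes> h x)))"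
      using V(2) cc r by (subst finsum_addf; (subst finsum_addf)?; auto)
    also have "\<dots> = ?S f \<oplus> (r \<otimes> ?S g \<oplus> (\<ominus> r) \<otimes> ?S h)"
      using V(1,2) cc r by (simp add: finsum_rdistr)
    also have "\<dots> = b" unfolding S using V(3) r by (simp add: l_minus r_neg)
    finally show "(\<lambda>x. f x \<oplus> r \<otimes> (g x \<ominus> h x)) \<in> {f \<in> UNIV \<rightarrow> carrier R. solves f V c b}"
      using cc r by (auto simp: solves_def)
  qed
qed

text \<open>By purity finitely many valid equations have a common solution in $R$, so linear compactness yields a
solution of all of them.\<close>

lemma pure_imp_split_complete:
  fixes emb :: "'a \<Rightarrow> 'u"
  assumes nl: "noetherian_local R \<mm>" and complete: "adically_complete R \<mm>"
    and pure: "quasi_F_pure TYPE('u) p n R" and inf: "infinite (UNIV :: 'u set)" and emb: "inj_on emb (carrier R)"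
  shows "quasi_F_split p n R"
proof -
  interpret noetherian_local R \<mm> by (rule nl)
  let ?Sol = "\<lambda>V c b. {f \<in> UNIV \<rightarrow> carrier R. solves f V c b}"
  let ?F = "{?Sol V c b | V c b. valid_eq V c b}"
  have fipF: "fip ?F"
    unfolding fip_def
  proof (intro allI impI)
    fix S assume S: "finite S" "S \<subseteq> ?F"
    have "\<exists>e. \<forall>A\<in>S. A = ?Sol (fst (e A)) (fst (snd (e A))) (snd (snd (e A))) \<and>
        valid_eq (fst (e A)) (fst (snd (e A))) (snd (snd (e A)))"
    proof (rule bchoice, rule ballI)
      fix A assume "A \<in> S"
      then obtain V c b where "A = ?Sol V c b" "valid_eq V c b" using S(2) by blast
      then show "\<exists>z. A = ?Sol (fst z) (fst (snd z)) (snd (snd z)) \<and> valid_eq (fst z) (fst (snd z)) (snd (snd z))"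
        by (intro exI[of _ "(V, c, b)"]) simp
    qed
    then obtain e where e: "\<forall>A\<in>S. A = ?Sol (fst (e A)) (fst (snd (e A))) (snd (snd (e A))) \<and>
        valid_eq (fst (e A)) (fst (snd (e A))) (snd (snd (e A)))"
      by (rule exE)
    define V c b where "V A = fst (e A)" and "c A = fst (snd (e A))" and "b A = snd (snd (e A))" for A
    have Vcb: "A = ?Sol (V A) (c A) (b A)" "valid_eq (V A) (c A) (b A)" if "A \<in> S" for A
      using bspec[OF e that] by (simp_all only: V_def c_def b_def)
    define I where "I = (\<Union>A\<in>S. V A)"
    (* The equations are extended by zero to a common finite set of unknowns. *)
    define c' where "c' A x = (if x \<in> V A then c A x else \<zero>\<^bsub>W\<^esub>)" for A x
    note v = Vcb(2)[unfolded valid_eq_def]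
    interpret Q: module W Q by (rule module_Q)
    have I: "finite I" "I \<subseteq> carrier W" using v S(1) by (auto simp: I_def)
    have c': "c' A x \<in> carrier W" if "A \<in> S" "x \<in> I" for A x using v[OF that(1)] by (auto simp: c'_def)
    have zero0: "\<zero>\<^bsub>W\<^esub> 0 = \<zero>" using n_pos by (simp add: witt_ring_def)
    have "\<exists>y\<in>I \<rightarrow> carrier R. \<forall>A\<in>S. (\<Oplus>x\<in>I. c' A x 0 \<otimes> y x) = b A"
    proof (rule pure_solves[OF pure inf emb I(1) S(1) c', where q = cl])
      show "b \<in> S \<rightarrow> carrier R" using v by auto
      show "cl \<in> I \<rightarrow> carrier Q" using I(2) Q_ops(1) by auto
      fix A assume A: "A \<in> S"
      have "(\<Oplus>\<^bsub>Q\<^esub>x\<in>I. c' A x \<odot>\<^bsub>Q\<^esub> cl x) = (\<Oplus>\<^bsub>Q\<^esub>x\<in>V A. c A x \<odot>\<^bsub>Q\<^esub> cl x)"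
      proof (rule Q.add.finprod_mono_neutral_cong_right[OF I(1)])
        have clI: "cl x \<in> carrier Q" if "x \<in> I" for x using Q_ops(1) I(2) that by blast
        show "V A \<subseteq> I" using A by (auto simp: I_def)
        show "c' A x \<odot>\<^bsub>Q\<^esub> cl x = \<zero>\<^bsub>Q\<^esub>" if "x \<in> I - V A" for x
          using that clI[of x] by (simp add: c'_def)
        show "c' A x \<odot>\<^bsub>Q\<^esub> cl x = c A x \<odot>\<^bsub>Q\<^esub> cl x" if "x \<in> V A" for x
          using that by (simp add: c'_def)
        show "(\<lambda>x. c' A x \<odot>\<^bsub>Q\<^esub> cl x) \<in> I \<rightarrow> carrier Q"
          using c'[OF A] clI by (intro Pi_I Q.smult_closed)
      qed
      then show "(\<Oplus>\<^bsub>Q\<^esub>x\<in>I. c' A x \<odot>\<^bsub>Q\<^esub> cl x) = Phi p n R (b A)" using v[OF A] by simp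
    qed
    then obtain y where y: "y \<in> I \<rightarrow> carrier R" "\<And>A. A \<in> S \<Longrightarrow> (\<Oplus>x\<in>I. c' A x 0 \<otimes> y x) = b A" by blast
    define f where "f x = (if x \<in> I then y x else \<zero>)" for x
    have f: "f \<in> UNIV \<rightarrow> carrier R" using y(1) by (auto simp: f_def)
    have "f \<in> A" if A: "A \<in> S" for A
    proof -
      have "(\<Oplus>x\<in>V A. c A x 0 \<otimes> f x) = (\<Oplus>x\<in>I. c' A x 0 \<otimes> y x)"
      proof (rule add.finprod_mono_neutral_cong_left[OF I(1)])
        have yI: "y x \<in> carrier R" if "x \<in> I" for x using y(1) that by (rule funcset_mem)
        show sub: "V A \<subseteq> I" using A by (auto simp: I_def)
        show "c' A x 0 \<otimes> y x = \<zero>" if "x \<in> I - V A" for x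
          using that yI[of x] by (simp add: c'_def zero0)
        show "c A x 0 \<otimes> f x = c' A x 0 \<otimes> y x" if "x \<in> V A" for x
          using that sub by (auto simp: c'_def f_def)
        show "(\<lambda>x. c' A x 0 \<otimes> y x) \<in> I \<rightarrow> carrier R"
          using W_coord_closed[OF c'[OF A] n_pos] yI by (intro Pi_I m_closed)
      qed
      then have "f \<in> ?Sol (V A) (c A) (b A)" using f y(2)[OF A] by (simp add: solves_def)
      then show ?thesis using Vcb(1)[OF A] by simp
    qed
    then show "\<Inter>S \<noteq> {}" by blast
  qed
  have aff: "affine_set A" if "A \<in> ?F" for A using affine_solution_set[OF nl] that by auto
  have supp: "\<exists>V. finite V \<and> (\<forall>f\<in>A. \<forall>g\<in>UNIV \<rightarrow> carrier R. (\<forall>x\<in>V. f x = g x) \<longrightarrow> g \<in> A)" if A: "A \<in> ?F" for A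
  proof -
    obtain V c b where V: "A = ?Sol V c b" "valid_eq V c b" using A by blast
    have "g \<in> A" if "f \<in> A" "g \<in> UNIV \<rightarrow> carrier R" "\<forall>x\<in>V. f x = g x" for f g
    proof -
      have "(\<Oplus>x\<in>V. c x 0 \<otimes> f x) = (\<Oplus>x\<in>V. c x 0 \<otimes> g x)"
        using that V(2) W_coord_closed[OF _ n_pos] by (intro finsum_cong') (auto simp: valid_eq_def Pi_iff)
      then show ?thesis using that unfolding V(1) by (simp add: solves_def)
    qed
    then show ?thesis using V(2) by (auto simp: valid_eq_def)
  qed
  have "\<exists>f\<in>UNIV \<rightarrow> carrier R. \<forall>A\<in>?F. f \<in> A"
    by (rule complete_imp_linearly_compact[OF complete aff fipF supp])
  then obtain f where f: "f \<in> UNIV \<rightarrow> carrier R" "\<forall>A\<in>?F. f \<in> A" by blast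
  show ?thesis
  proof (rule solves_all_imp_split[OF f(1)])
    fix V c b assume "valid_eq V c b"
    then have "?Sol V c b \<in> ?F" by blast
    then have "f \<in> ?Sol V c b" using f(2) by blast
    then show "solves f V c b" by simp
  qed
qed

text \<open>With generators \<open>T\<close> of \<open>F\<^sub>*W\<^sub>n(R)\<close>, a splitting is determined by its values \<open>y\<^sub>t\<close> on \<open>T\<close>.  They have to satisfy
\<open>\<Sum>\<^sub>t \<pi>(c\<^sub>t) y\<^sub>t = 0\<close> for each relation \<open>\<Sum>\<^sub>t F(c\<^sub>t) t \<in> p W\<^sub>n(R)\<close>, and one more equation that expresses \<open>1 \<mapsto> 1\<close>.
The first kind follows from finitely many instances, so that purity provides \<open>y\<close>.\<close>

lemma pure_imp_split_F_finite:
  fixes emb :: "'a \<Rightarrow> 'u"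
  assumes noeth: "noetherian_ring R" and ffin: "F_finite p R"
    and pure: "quasi_F_pure TYPE('u) p n R" and inf: "infinite (UNIV :: 'u set)" and emb: "inj_on emb (carrier R)"
  shows "quasi_F_split p n R"
proof -
  obtain T where T: "finite T" "T \<subseteq> carrier W" "carrier W \<subseteq> mspan W FW T"
    using F_finite_imp_fin_gen_FW[OF ffin] by blast
  interpret FW: module W FW by (rule module_FW)
  interpret Q: module W Q by (rule module_Q)
  interpret B: module W base by (rule module_base)
  have id: "(\<lambda>t. t) \<in> T \<rightarrow> carrier FW" using T(2) by auto
  define L where "L c = (\<Oplus>\<^bsub>FW\<^esub>t\<in>T. c t \<odot>\<^bsub>FW\<^esub> t)" for c
  have Lc: "L c \<in> carrier W" if "c \<in> T \<rightarrow> carrier W" for c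
    unfolding L_def finsum_module_via using that T(2) by (intro W.finsum_closed) (auto simp: Pi_iff subset_iff)
  have Ladd: "L (\<lambda>t. c t \<oplus>\<^bsub>W\<^esub> d t) = L c \<oplus>\<^bsub>W\<^esub> L d" if "c \<in> T \<rightarrow> carrier W" "d \<in> T \<rightarrow> carrier W" for c d
    using finsum_lincomb_add[OF module_FW id that] by (simp add: L_def)
  have Lsmult: "L (\<lambda>t. a \<otimes>\<^bsub>W\<^esub> c t) = witt_frob p n R a \<otimes>\<^bsub>W\<^esub> L c" if "c \<in> T \<rightarrow> carrier W" "a \<in> carrier W" for a c
    using finsum_lincomb_smult[OF module_FW id T(1) that] by (simp add: L_def)
  have LQ: "(\<Oplus>\<^bsub>Q\<^esub>t\<in>T. c t \<odot>\<^bsub>Q\<^esub> cl t) = cl (L c)" if "c \<in> T \<rightarrow> carrier W" for c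
  proof -
    have "cl (L c) = (\<Oplus>\<^bsub>Q\<^esub>t\<in>T. cl (c t \<odot>\<^bsub>FW\<^esub> t))"
      unfolding L_def by (rule mod_hom_finsum[OF module_FW module_Q cl_mod_hom T(1)]) (use that T(2) in \<open>auto simp: Pi_iff subset_iff\<close>)
    also have "\<dots> = (\<Oplus>\<^bsub>Q\<^esub>t\<in>T. c t \<odot>\<^bsub>Q\<^esub> cl t)"
      using that T(2) by (intro Q.finsum_cong') (auto simp: Q_ops Pi_iff subset_iff)
    finally show ?thesis by simp
  qed
  have one0: "\<one>\<^bsub>W\<^esub> 0 = \<one>" using ring_hom_one[OF coord0_ring_hom] by simp
  have zero0: "\<zero>\<^bsub>W\<^esub> 0 = \<zero>" using n_pos by (simp add: witt_ring_def)
  note IP = W.ideal_ops[OF IP_ideal]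
  (* L c is the combination of the generators with coefficients c, C the module of relations, N its image in R. *)
  define C where "C = {c \<in> UNIV \<rightarrow> carrier W. L c \<in> IP}"
  define N where "N = (\<lambda>c t. c t 0) ` C"
  have CT: "c \<in> T \<rightarrow> carrier W" if "c \<in> C" for c using that by (auto simp: C_def)
  have C0: "(\<lambda>t. \<zero>\<^bsub>W\<^esub>) \<in> C"
  proof -
    have "L (\<lambda>t. \<zero>\<^bsub>W\<^esub>) = \<zero>\<^bsub>W\<^esub>"
      using T(2) unfolding L_def by (subst FW.add.finprod_one_eqI) (auto simp: ring_hom_zero[OF witt_frob_hom W.ring_axioms W.ring_axioms])
    then show ?thesis using IP(1) by (simp add: C_def)
  qed
  have Cadd: "(\<lambda>t. c t \<oplus>\<^bsub>W\<^esub> d t) \<in> C" if "c \<in> C" "d \<in> C" for c d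
    using that Ladd[OF CT CT, OF that] IP(2) by (auto simp: C_def)
  have Csmult: "(\<lambda>t. a \<otimes>\<^bsub>W\<^esub> c t) \<in> C" if "a \<in> carrier W" "c \<in> C" for a c
    using that Lsmult[OF CT, OF that(2,1)] IP(5) by (auto simp: C_def)
  have N0: "(\<lambda>t. \<zero>) \<in> N" unfolding N_def using C0 by (intro image_eqI[OF _ C0]) (simp add: zero0)
  have Nsub: "N \<subseteq> UNIV \<rightarrow> carrier R" using W_coord_closed[OF _ n_pos] by (auto simp: N_def C_def)
  have Nadd: "(\<lambda>t. u t \<oplus> v t) \<in> N" if uv: "u \<in> N" "v \<in> N" for u v
  proof -
    obtain c d where cd: "c \<in> C" "d \<in> C" "u = (\<lambda>t. c t 0)" "v = (\<lambda>t. d t 0)" using uv by (auto simp: N_def)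
    then have "(\<lambda>t. u t \<oplus> v t) = (\<lambda>t. (c t \<oplus>\<^bsub>W\<^esub> d t) 0)"
      by (auto simp: C_def ring_hom_add[OF coord0_ring_hom] Pi_iff)
    then show ?thesis unfolding N_def by (rule image_eqI[OF _ Cadd[OF cd(1,2)]])
  qed
  have Nmult: "(\<lambda>t. r \<otimes> u t) \<in> N" if ru: "r \<in> carrier R" "u \<in> N" for r u
  proof -
    obtain c where c: "c \<in> C" "u = (\<lambda>t. c t 0)" using ru by (auto simp: N_def)
    have r: "teichmuller n R r \<in> carrier W" using ru by simp
    have "(\<lambda>t. r \<otimes> u t) = (\<lambda>t. (teichmuller n R r \<otimes>\<^bsub>W\<^esub> c t) 0)"
      using c r by (auto simp: C_def ring_hom_mult[OF coord0_ring_hom] Pi_iff teichmuller_0)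
    then show ?thesis unfolding N_def by (rule image_eqI[OF _ Csmult[OF r c(1)]])
  qed
  obtain S where S: "finite S" "S \<subseteq> N" "\<forall>y\<in>T \<rightarrow> carrier R.
    (\<forall>u\<in>S. (\<Oplus>t\<in>T. u t \<otimes> y t) = \<zero>) \<longrightarrow> (\<forall>u\<in>N. (\<Oplus>t\<in>T. u t \<otimes> y t) = \<zero>)"
    using submodule_annihilators_finite[OF noeth T(1) Nsub N0 Nadd Nmult] by blast
  have "\<forall>u\<in>S. \<exists>c. c \<in> C \<and> u = (\<lambda>t. c t 0)" using S(2) by (auto simp: N_def)
  then obtain lc where lc: "\<And>u. u \<in> S \<Longrightarrow> lc u \<in> C" "\<And>u. u \<in> S \<Longrightarrow> u = (\<lambda>t. lc u t 0)" by metis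
  have "\<exists>c. c \<in> T \<rightarrow> carrier W \<and> \<beta> = L c" if "\<beta> \<in> carrier W" for \<beta>
    using mspan_imp_lincomb[OF module_FW _ T(1), of \<beta>] T(2,3) that by (auto simp: L_def)
  then obtain cb where cb: "\<And>\<beta>. \<beta> \<in> carrier W \<Longrightarrow> cb \<beta> \<in> T \<rightarrow> carrier W" "\<And>\<beta>. \<beta> \<in> carrier W \<Longrightarrow> \<beta> = L (cb \<beta>)"
    by metis
  (* The index None stands for the equation that expresses 1, the others for the chosen relations. *)
  define c where "c j = (case j of None \<Rightarrow> cb \<one>\<^bsub>W\<^esub> | Some u \<Rightarrow> lc u)" for j
  define b where "b j = (case j of None \<Rightarrow> \<one> | Some u \<Rightarrow> \<zero>)" for j :: "((nat \<Rightarrow> 'a) \<Rightarrow> 'a) option"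
  let ?J = "insert None (Some ` S)"
  have cJ: "c j \<in> T \<rightarrow> carrier W" if "j \<in> ?J" for j
    using that cb(1)[OF W.one_closed] CT[OF lc(1)] by (auto simp: c_def Pi_iff)
  have "\<exists>y\<in>T \<rightarrow> carrier R. \<forall>j\<in>?J. (\<Oplus>t\<in>T. c j t 0 \<otimes> y t) = b j"
  proof (rule pure_solves[OF pure inf emb T(1), where q = cl])
    show "finite ?J" using S(1) by simp
    show "c j t \<in> carrier W" if "j \<in> ?J" "t \<in> T" for j t using cJ[OF that(1)] that(2) by auto
    show "b \<in> ?J \<rightarrow> carrier R" by (auto simp: b_def)
    show "cl \<in> T \<rightarrow> carrier Q" using T(2) Q_ops(1) by auto
    fix j assume j: "j \<in> ?J"
    have "cl (L (c j)) = Phi p n R (b j)"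
    proof (cases j)
      case None
      have "Phi p n R \<one> = cl \<one>\<^bsub>W\<^esub>"
        using Phi_coord0[of "\<one>\<^bsub>W\<^esub>"] ring_hom_one[OF witt_frob_hom] by (simp add: one0)
      then show ?thesis using cb(2)[OF W.one_closed] None by (simp add: c_def b_def)
    next
      case (Some u)
      then have u: "u \<in> S" using j by auto
      have "cl (L (lc u)) = cl \<zero>\<^bsub>W\<^esub>"
        using lc(1)[OF u] Lc[OF CT[OF lc(1)[OF u]]] by (subst cl_eq_iff) (auto simp: C_def W.minus_eq)
      also have "\<dots> = \<zero>\<^bsub>Q\<^esub>" using mod_hom_zero[OF module_FW module_Q cl_mod_hom] by simp
      also have "\<dots> = Phi p n R \<zero>" using mod_hom_zero[OF module_base module_Q Phi_mod_hom] by simp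
      finally show ?thesis using Some by (simp add: c_def b_def)
    qed
    then show "(\<Oplus>\<^bsub>Q\<^esub>t\<in>T. c j t \<odot>\<^bsub>Q\<^esub> cl t) = Phi p n R (b j)" using LQ[OF cJ[OF j]] by simp
  qed
  then obtain y where y: "y \<in> T \<rightarrow> carrier R" "\<And>j. j \<in> ?J \<Longrightarrow> (\<Oplus>t\<in>T. c j t 0 \<otimes> y t) = b j" by blast
  define D where "D c = (\<Oplus>t\<in>T. c t 0 \<otimes> y t)" for c :: "(nat \<Rightarrow> 'a) \<Rightarrow> nat \<Rightarrow> 'a"
  have yB: "y \<in> T \<rightarrow> carrier base" using y(1) by simp
  have Dc: "D c \<in> carrier R" if "c \<in> T \<rightarrow> carrier W" for c
    unfolding D_def using that y(1) W_coord_closed[OF _ n_pos] by (intro finsum_closed) auto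
  have Dadd: "D (\<lambda>t. c t \<oplus>\<^bsub>W\<^esub> d t) = D c \<oplus> D d" if "c \<in> T \<rightarrow> carrier W" "d \<in> T \<rightarrow> carrier W" for c d
    using finsum_lincomb_add[OF module_base yB that] by (simp add: D_def)
  have Dsmult: "D (\<lambda>t. a \<otimes>\<^bsub>W\<^esub> c t) = a 0 \<otimes> D c" if "c \<in> T \<rightarrow> carrier W" "a \<in> carrier W" for a c
    using finsum_lincomb_smult[OF module_base yB T(1) that] by (simp add: D_def)
  have "(\<Oplus>t\<in>T. u t \<otimes> y t) = \<zero>" if u: "u \<in> S" for u
  proof -
    have "(\<Oplus>t\<in>T. lc u t 0 \<otimes> y t) = \<zero>" using y(2)[of "Some u"] u by (simp add: c_def b_def)
    then show ?thesis using fun_cong[OF lc(2)[OF u]] by simp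
  qed
  then have "\<forall>u\<in>N. (\<Oplus>t\<in>T. u t \<otimes> y t) = \<zero>" using S(3) y(1) by blast
  then have DC: "D d = \<zero>" if "d \<in> C" for d using that by (auto simp: N_def D_def)
  have Dwell: "D d = D e" if de: "d \<in> T \<rightarrow> carrier W" "e \<in> T \<rightarrow> carrier W" "L d = L e" for d e
  proof -
    let ?m = "\<ominus>\<^bsub>W\<^esub> \<one>\<^bsub>W\<^esub>"
    have me: "(\<lambda>t. ?m \<otimes>\<^bsub>W\<^esub> e t) \<in> T \<rightarrow> carrier W" using de by auto
    (* Members of C are total functions, so the difference of d and e is extended by zero outside T. *)
    define g where "g t = (if t \<in> T then d t \<oplus>\<^bsub>W\<^esub> ?m \<otimes>\<^bsub>W\<^esub> e t else \<zero>\<^bsub>W\<^esub>)" for t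
    have gT: "L g = L (\<lambda>t. d t \<oplus>\<^bsub>W\<^esub> ?m \<otimes>\<^bsub>W\<^esub> e t)" "D g = D (\<lambda>t. d t \<oplus>\<^bsub>W\<^esub> ?m \<otimes>\<^bsub>W\<^esub> e t)"
      unfolding L_def D_def
      using de T(2) y(1) W_coord_closed[OF _ n_pos]
      by (intro FW.finsum_cong' finsum_cong'; auto simp: g_def Pi_iff subset_iff)+
    have Fm: "witt_frob p n R ?m = ?m"
    proof -
      interpret F: ring_hom_cring W W "witt_frob p n R"
        by (intro ring_hom_cringI ring_hom_ringI2 witt_frob_hom cring_W W.ring_axioms)
      show ?thesis by simp
    qed
    have "L g = \<zero>\<^bsub>W\<^esub>"
      unfolding gT Ladd[OF de(1) me] Lsmult[OF de(2), of ?m, OF W.a_inv_closed[OF W.one_closed]] Fm de(3)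
      using Lc[OF de(2)] by (simp add: W.l_minus W.r_neg)
    then have "g \<in> C" using de IP(1) by (auto simp: C_def g_def Pi_iff)
    then have "D d \<oplus> ?m 0 \<otimes> D e = \<zero>"
      using DC[of g] Dadd[OF de(1) me] Dsmult[OF de(2), of ?m] gT(2) by simp
    moreover have "?m 0 = \<ominus> \<one>"
    proof -
      interpret F: ring_hom_cring W R "\<lambda>\<alpha>. \<alpha> 0"
        by (intro ring_hom_cringI ring_hom_ringI2 coord0_ring_hom cring_W W.ring_axioms ring_axioms is_cring)
      show ?thesis using F.hom_a_inv[of "\<one>\<^bsub>W\<^esub>"] by (simp add: one0)
    qed
    ultimately have "D d \<ominus> D e = \<zero>" using Dc[OF de(1)] Dc[OF de(2)] by (simp add: l_minus minus_eq)
    then show ?thesis using Dc[OF de(1)] Dc[OF de(2)] by simp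
  qed
  show ?thesis
  proof (rule quasi_F_splitI[where f = "\<lambda>\<beta>. D (cb \<beta>)"])
    show "D (cb \<alpha>) \<in> carrier R" if "\<alpha> \<in> carrier W" for \<alpha> using Dc cb(1)[OF that] .
    show "D (cb \<one>\<^bsub>W\<^esub>) = \<one>" using y(2)[of None] by (simp add: D_def c_def b_def)
    fix \<gamma> \<alpha> \<beta> assume abg: "\<gamma> \<in> carrier W" "\<alpha> \<in> carrier W" "\<beta> \<in> carrier W"
    let ?\<delta> = "witt_frob p n R \<gamma> \<otimes>\<^bsub>W\<^esub> \<alpha> \<oplus>\<^bsub>W\<^esub> \<beta>"
    have \<delta>: "?\<delta> \<in> carrier W" using abg by simp
    have ga: "(\<lambda>t. \<gamma> \<otimes>\<^bsub>W\<^esub> cb \<alpha> t) \<in> T \<rightarrow> carrier W" using cb(1)[OF abg(2)] abg(1) by auto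
    have "D (cb ?\<delta>) = D (\<lambda>t. \<gamma> \<otimes>\<^bsub>W\<^esub> cb \<alpha> t \<oplus>\<^bsub>W\<^esub> cb \<beta> t)"
    proof (rule Dwell[OF cb(1)[OF \<delta>]])
      show "(\<lambda>t. \<gamma> \<otimes>\<^bsub>W\<^esub> cb \<alpha> t \<oplus>\<^bsub>W\<^esub> cb \<beta> t) \<in> T \<rightarrow> carrier W"
        using ga cb(1)[OF abg(3)] by auto
      show "L (cb ?\<delta>) = L (\<lambda>t. \<gamma> \<otimes>\<^bsub>W\<^esub> cb \<alpha> t \<oplus>\<^bsub>W\<^esub> cb \<beta> t)"
        using Ladd[OF ga cb(1)[OF abg(3)]] Lsmult[OF cb(1)[OF abg(2)] abg(1)]
          cb(2)[OF \<delta>] cb(2)[OF abg(2)] cb(2)[OF abg(3)] by simp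
    qed
    then show "D (cb ?\<delta>) = \<gamma> 0 \<otimes> D (cb \<alpha>) \<oplus> D (cb \<beta>)"
      using Dadd[OF ga cb(1)[OF abg(3)]] Dsmult[OF cb(1)[OF abg(2)] abg(1)] by simp
  qed
qed

end

lemma local_ring_imp_noetherian_local:
  assumes "local_ring R" "noetherian_ring R"
  shows "noetherian_local R (max_ideal R)"
proof -
  have R: "cring R" and ex: "\<exists>!m. maximalideal m R" using assms(1) by (auto simp: local_ring_def)
  have max: "maximalideal (max_ideal R) R" unfolding max_ideal_def by (rule theI'[OF ex])
  show ?thesis
    by (intro noetherian_local.intro noetherian_local_axioms.intro assms(2) R max) (use ex max in blast)
qed

theorem theorem3p5:
  fixes R :: "('a, 'b) ring_scheme" and p :: nat and \<iota> :: "'a \<Rightarrow> 'u"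
  assumes "Factorial_Ring.prime p"
    and "local_ring R" and "noetherian_ring R" and "has_char p R"
    and "complete_local_ring R \<or> F_finite p R"
    and "infinite (UNIV :: 'u set)" and "inj_on \<iota> (carrier R)"
  shows "(\<forall>n\<ge>1. quasi_F_split p n R \<longleftrightarrow> quasi_F_pure TYPE('u) p n R) \<and>
         quasi_F_pure_height TYPE('u) p R = quasi_F_split_height p R"
proof -
  have R: "cring R" using assms(2) by (simp add: local_ring_def)
  have nl: "noetherian_local R (max_ideal R)" by (rule local_ring_imp_noetherian_local[OF assms(2,3)])
  have iff: "quasi_F_split p n R \<longleftrightarrow> quasi_F_pure TYPE('u) p n R" if n: "n \<ge> 1" for n
  proof -
    interpret witt_vectors_pos R p n
      by (intro witt_vectors_pos.intro witt_vectors.intro witt_vectors_axioms.intro witt_vectors_pos_axioms.intro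
          R assms(1,4)) (use n in simp)
    show ?thesis
    proof
      assume "quasi_F_split p n R"
      then show "quasi_F_pure TYPE('u) p n R" by (rule split_imp_pure)
    next
      assume pure: "quasi_F_pure TYPE('u) p n R"
      from assms(5) show "quasi_F_split p n R"
      proof
        assume "complete_local_ring R"
        then have "adically_complete R (max_ideal R)" by (simp add: complete_local_ring_def)
        then show ?thesis by (rule pure_imp_split_complete[OF nl _ pure assms(6,7)])
      next
        assume "F_finite p R"
        then show ?thesis by (rule pure_imp_split_F_finite[OF assms(3) _ pure assms(6,7)])
      qed
    qed
  qed
  then have "{n. 1 \<le> n \<and> quasi_F_pure TYPE('u) p n R} = {n. 1 \<le> n \<and> quasi_F_split p n R}" by blast
  then show ?thesis using iff by (simp add: quasi_F_pure_height_def quasi_F_split_height_def)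
qed

end
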